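(* For every partition $\lambda$, the double factorial Schur function $\tau(\mathbf t)=s_\lambda(\mathbf t\,\|\,\boldsymbol\alpha;\boldsymbol\beta)$ is a tau function solution of the KP hierarchy.
   Context: KP hierarchy: for variables $\mathbf t=(t_1,t_2,\dots)$, let $D_i$ be the Hirota derivatives, i.e. $P(D_1,D_2,\dots)f\cdot g=P(\partial_{y_1},\partial_{y_2},\dots)f(\mathbf t+\mathbf y)g(\mathbf t-\mathbf y)|_{\mathbf y=0}$. Let $h_k$ be the polynomials defined by $\sum_{k\ge0}h_k(\mathbf t)z^k=\exp\bigl(\sum_{k\ge1}\frac{t_k}{k}z^k\bigr)$, and $\widetilde{\mathbf D}=(D_1,2D_2,3D_3,\dots)$. With the normalization used here (power-sum-type variables $t_k$), $\tau(\mathbf t)$ is a tau function of the KP hierarchy if it satisfies the Hirota bilinear equations $$\sum_{k=0}^\infty h_k(-2\mathbf x)\,h_{k+1}(\widetilde{\mathbf D})\exp\Bigl(\sum_{i=1}^\infty x_iD_i\Bigr)\tau(\mathbf t)\cdot\tau(\mathbf t)=0$$ identically in the auxiliary variables $\mathbf x=(x_1,x_2,\dots)$. $\boldsymbol\alpha=(\alpha_i)_{i\in\mathbb Z}$, $\boldsymbol\beta=(\beta_i)_{i\in\mathbb Z}$ are sequences in $\mathbb C$. For $k\in\mathbb Z$, $(z;\boldsymbol\alpha)^k=\prod_{i=1}^k(1-z\alpha_i)$ if $k\ge 0$ and $\prod_{i=k+1}^{0}(1-z\alpha_i)^{-1}$ if $k<0$; $(z|\boldsymbol\beta)^k=\prod_{i=1}^k(z-\beta_i)$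 if $k\ge0$ and $\prod_{i=k+1}^0(z-\beta_i)^{-1}$ if $k<0$. The Clifford algebra is generated by $\psi_i,\psi_i^*$ ($i\in\mathbb Z$) with $[\psi_i,\psi_j]_+=[\psi_i^*,\psi_j^*]_+=0$, $[\psi_i,\psi_j^*]_+=\delta_{ij}$. The charge $0$ Fock space has basis $|\lambda\rangle=v_{\lambda_1}\wedge v_{\lambda_2-1}\wedge v_{\lambda_3-2}\wedge\cdots$ over partitions; $\psi_j$ acts by $v_j\wedge$, $\psi_j^*$ by contraction against $v_j$; $\langle\lambda|$ is the dual basis. Normal ordering: $:\!\psi_i\psi_j^*\!:\,=\psi_i\psi_j^*$ if $i>0$, $=-\psi_j^*\psi_i$ if $i\le0$. Deformed currents for $k>0$: $J_k^{(\boldsymbol\alpha;\boldsymbol\beta)}=\sum_{i,j}A_{ij}^k:\!\psi_i\psi_j^*\!:$, the coefficient of $z^{-k}$ in $:\!\psi(z|\boldsymbol\alpha;\boldsymbol\beta)\psi^*(z|\boldsymbol\alpha;\boldsymbol\beta)\!:$ (expanded for $|\beta_a|<|z|<|\alpha_b^{-1}|$, all $a,b$), where $\psi(z|\boldsymbol\alpha;\boldsymbol\beta)=\sum_i z\frac{(z|\boldsymbol\beta)^{i-1}}{(z;\boldsymbol\alpha)^i}\psi_i$, $\psi^*(w|\boldsymbol\alpha;\boldsymbol\beta)=\sum_j(1-\alpha_j\beta_j)\frac{(w;\boldsymbol\alpha)^{j-1}}{(w|\boldsymbol\beta)^j}\psi_j^*$; explicitly $A_{ii}^k=\beta_i^k$,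 $A_{ij}^k=0$ for $j<i$, and $A_{ij}^k=(1-\alpha_j\beta_j)\sum_{r-s=j-i-k}e_r(-\alpha_{i+1},\dots,-\alpha_{j-1})h_s(\beta_i,\dots,\beta_j)$ for $j>i$, with $e_r,h_s$ here the elementary and complete homogeneous symmetric polynomials. $H_+(\mathbf t|\boldsymbol\alpha;\boldsymbol\beta)=\sum_{k\ge1}\frac{t_k}{k}J_k^{(\boldsymbol\alpha;\boldsymbol\beta)}$ and $s_\lambda(\mathbf t\,\|\,\boldsymbol\alpha;\boldsymbol\beta)=\langle\varnothing|e^{H_+(\mathbf t|\boldsymbol\alpha;\boldsymbol\beta)}|\lambda\rangle\in\mathbb C[[\mathbf t]]$. *)

theory Defs
  imports "HOL-Library.Poly_Mapping" "HOL-Library.Multiset" Complex_Main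
begin

section \<open>Formal power series in arbitrarily many variables\<close>

text \<open>
  An element of \<open>'v mfps\<close> is a formal power series with complex coefficients in the variables \<open>'v\<close>
  (possibly infinitely many); a monomial is the multiset of its variables, and every
  family of coefficients is allowed.
\<close>

typedef 'v mfps = "UNIV :: ('v multiset \<Rightarrow> complex) set"
  morphisms mfps_coeff Abs_mfps ..

lemma mfps_coeff_Abs [simp]: "mfps_coeff (Abs_mfps f) = f"
  by (simp add: Abs_mfps_inverse)

lemma mfps_eqI: "(\<And>M. mfps_coeff f M = mfps_coeff g M) \<Longrightarrow> f = g"
  by (metis ext mfps_coeff_inject)

lemma finite_submsets: "finite {A. A \<subseteq># M}"
proof (induction M)
  case (add x M)
  have "{A. A \<subseteq># add_mset x M} \<subseteq> {A. A \<subseteq># M} \<union> add_mset x ` {A. A \<subseteq># M}"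
  proof
    fix A assume "A \<in> {A. A \<subseteq># add_mset x M}"
    then have A: "A \<subseteq># add_mset x M" by simp
    show "A \<in> {A. A \<subseteq># M} \<union> add_mset x ` {A. A \<subseteq># M}"
    proof (cases "x \<in># A")
      case True
      then obtain B where "A = add_mset x B" by (meson mset_add)
      with A show ?thesis by auto
    next
      case False
      with A have "A \<subseteq># M"
        by (metis diff_single_trivial subset_eq_diff_conv add_mset_add_single)
      then show ?thesis by simp
    qed
  qed
  with add show ?case by (meson finite_UnI finite_imageI finite_subset)
qed simp

instantiation mfps :: (type) comm_ring_1
begin

definition "0 = Abs_mfps (\<lambda>M. 0)"
definition "1 = Abs_mfps (\<lambda>M. if M = {#} then 1 else 0)"
definition "f + g = Abs_mfps (\<lambda>M. mfps_coeff f M + mfps_coeff g M)"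
definition "f - g = Abs_mfps (\<lambda>M. mfps_coeff f M - mfps_coeff g M)"
definition "- f = Abs_mfps (\<lambda>M. - mfps_coeff f M)"
definition "f * g = Abs_mfps (\<lambda>M. \<Sum>A | A \<subseteq># M. mfps_coeff f A * mfps_coeff g (M - A))"

instance
proof
  fix a b c :: "'a mfps"
  show "a + b + c = a + (b + c)" "a + b = b + a" "0 + a = a" "- a + a = 0" "a - b = a + - b"
    by (auto intro!: mfps_eqI simp: plus_mfps_def zero_mfps_def uminus_mfps_def minus_mfps_def)
  show "(0 :: 'a mfps) \<noteq> 1"
  proof
    assume "(0 :: 'a mfps) = 1"
    then have "mfps_coeff (0 :: 'a mfps) {#} = mfps_coeff 1 {#}" by simp
    then show False by (simp add: zero_mfps_def one_mfps_def)
  qed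
  show "(a + b) * c = a * c + b * c"
    by (auto intro!: mfps_eqI simp: plus_mfps_def times_mfps_def distrib_right sum.distrib)
  show "a * b = b * a"
  proof (rule mfps_eqI)
    fix M
    show "mfps_coeff (a * b) M = mfps_coeff (b * a) M"
      unfolding times_mfps_def mfps_coeff_Abs
      by (rule sum.reindex_bij_witness[where i = "\<lambda>A. M - A" and j = "\<lambda>A. M - A"])
         (auto simp: mult.commute subset_mset.diff_diff_right)
  qed
  show "1 * a = a"
  proof (rule mfps_eqI)
    fix M
    have "mfps_coeff (1 * a) M = (\<Sum>A | A \<subseteq># M. if A = {#} then mfps_coeff a (M - A) else 0)"
      unfolding times_mfps_def one_mfps_def by (auto intro!: sum.cong)
    then show "mfps_coeff (1 * a) M = mfps_coeff a M"
      by (simp add: finite_submsets)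
  qed
  show "a * b * c = a * (b * c)"
  proof (rule mfps_eqI)
    fix M
    have "mfps_coeff (a * b * c) M =
      (\<Sum>A | A \<subseteq># M. \<Sum>B | B \<subseteq># A. mfps_coeff a B * mfps_coeff b (A - B) * mfps_coeff c (M - A))"
      by (simp add: times_mfps_def sum_distrib_right)
    also have "\<dots> = (\<Sum>(A, B) \<in> (SIGMA A:{A. A \<subseteq># M}. {B. B \<subseteq># A}).
        mfps_coeff a B * mfps_coeff b (A - B) * mfps_coeff c (M - A))"
      by (rule sum.Sigma) (auto simp: finite_submsets)
    also have "\<dots> = (\<Sum>(B, C) \<in> (SIGMA B:{B. B \<subseteq># M}. {C. C \<subseteq># M - B}).
        mfps_coeff a B * (mfps_coeff b C * mfps_coeff c (M - B - C)))"
    proof (rule sum.reindex_bij_witness[where i = "\<lambda>(B, C). (B + C, B)" and j = "\<lambda>(A, B). (B, A - B)"])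
      fix p assume p: "p \<in> (SIGMA A:{A. A \<subseteq># M}. {B. B \<subseteq># A})"
      then obtain A B where [simp]: "p = (A, B)" and AB: "A \<subseteq># M" "B \<subseteq># A" by blast
      from AB(2) obtain C where A: "A = B + C" by (auto simp: mset_subset_eq_exists_conv)
      show "(case case p of (A, B) \<Rightarrow> (B, A - B) of (B, C) \<Rightarrow> (B + C, B)) = p"
        by (simp add: A)
      show "(case p of (A, B) \<Rightarrow> (B, A - B)) \<in> (SIGMA B:{B. B \<subseteq># M}. {C. C \<subseteq># M - B})"
        using AB(1) by (auto simp: A mset_subset_eq_exists_conv add.assoc)
      show "(case case p of (A, B) \<Rightarrow> (B, A - B) of (B, C) \<Rightarrow>
              mfps_coeff a B * (mfps_coeff b C * mfps_coeff c (M - B - C))) =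
            (case p of (A, B) \<Rightarrow> mfps_coeff a B * mfps_coeff b (A - B) * mfps_coeff c (M - A))"
        by (simp add: A mult.assoc)
    next
      fix p assume p: "p \<in> (SIGMA B:{B. B \<subseteq># M}. {C. C \<subseteq># M - B})"
      then obtain B C where [simp]: "p = (B, C)" and BC: "B \<subseteq># M" "C \<subseteq># M - B" by blast
      from BC(1) obtain D where M: "M = B + D" by (auto simp: mset_subset_eq_exists_conv)
      show "(case case p of (B, C) \<Rightarrow> (B + C, B) of (A, B) \<Rightarrow> (B, A - B)) = p"
        by simp
      show "(case p of (B, C) \<Rightarrow> (B + C, B)) \<in> (SIGMA A:{A. A \<subseteq># M}. {B. B \<subseteq># A})"
        using BC by (simp add: M)
    qed
    also have "\<dots> = (\<Sum>B | B \<subseteq># M. \<Sum>C | C \<subseteq># M - B.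
        mfps_coeff a B * (mfps_coeff b C * mfps_coeff c (M - B - C)))"
      by (rule sum.Sigma [symmetric]) (auto simp: finite_submsets)
    also have "\<dots> = mfps_coeff (a * (b * c)) M"
      by (simp add: times_mfps_def sum_distrib_left)
    finally show "mfps_coeff (a * b * c) M = mfps_coeff (a * (b * c)) M" .
  qed
qed

end

definition mfps_const :: "complex \<Rightarrow> 'v mfps" where
  "mfps_const c = Abs_mfps (\<lambda>M. if M = {#} then c else 0)"

definition mfps_var :: "'v \<Rightarrow> 'v mfps" where
  "mfps_var v = Abs_mfps (\<lambda>M. if M = {#v#} then 1 else 0)"

text \<open>
  Possibly infinite sums are taken coefficientwise.  They are only used for families in which each monomial
  has a nonzero coefficient in finitely many members (\<open>Sum_any\<close> would otherwise return 0).
\<close>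

definition mfps_Sum :: "('i \<Rightarrow> 'v mfps) \<Rightarrow> 'v mfps" where
  "mfps_Sum F = Abs_mfps (\<lambda>M. Sum_any (\<lambda>i. mfps_coeff (F i) M))"

text \<open>Meaningful for series without constant term.\<close>

definition mfps_exp :: "'v mfps \<Rightarrow> 'v mfps" where
  "mfps_exp f = mfps_Sum (\<lambda>n. mfps_const (1 / fact n) * f ^ n)"

text \<open>The result of substituting \<open>\<sigma> v\<close> for each variable \<open>v\<close>.\<close>

definition mfps_subst :: "('v \<Rightarrow> 'w mfps) \<Rightarrow> 'v mfps \<Rightarrow> 'w mfps" where
  "mfps_subst \<sigma> f = mfps_Sum (\<lambda>M. mfps_const (mfps_coeff f M) * (\<Prod>v\<in>#M. \<sigma> v))"

definition mfps_deriv :: "'v \<Rightarrow> 'v mfps \<Rightarrow> 'v mfps" where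
  "mfps_deriv v f = Abs_mfps (\<lambda>M. of_nat (count M v + 1) * mfps_coeff f (add_mset v M))"


section \<open>The KP hierarchy in Hirota form\<close>

text \<open>
  Infinite sequences of variables are indexed by \<open>nat\<close>; only the indices \<open>\<ge> 1\<close> are used, so the
  variable with index 0 never occurs.
\<close>

text \<open>\<open>h_gen\<close> is the generating function, with \<open>None\<close> playing the role of \<open>z\<close> and \<open>Some k\<close> that of \<open>t\<^sub>k\<close>.\<close>

definition h_gen :: "nat option mfps" where
  "h_gen = mfps_exp (mfps_Sum (\<lambda>i. mfps_const (1 / of_nat (Suc i)) * mfps_var (Some (Suc i)) * mfps_var None ^ Suc i))"

definition h_poly :: "nat \<Rightarrow> nat mfps" where
  "h_poly k = Abs_mfps (\<lambda>M. mfps_coeff h_gen (image_mset Some M + replicate_mset k None))"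

text \<open>
  \<open>hirota P f g\<close> is \<open>P(D\<^sub>1, D\<^sub>2, \<dots>) f \<cdot> g\<close> for a polynomial \<open>P\<close>.
  In \<open>f(t + y) g(t - y)\<close>, \<open>Inl k\<close> stands for \<open>t\<^sub>k\<close> and \<open>Inr k\<close> for \<open>y\<^sub>k\<close>.
\<close>

definition hirota_shift :: "nat mfps \<Rightarrow> nat mfps \<Rightarrow> (nat + nat) mfps" where
  "hirota_shift f g =
     mfps_subst (\<lambda>k. mfps_var (Inl k) + mfps_var (Inr k)) f *
     mfps_subst (\<lambda>k. mfps_var (Inl k) - mfps_var (Inr k)) g"

definition hirota :: "nat mfps \<Rightarrow> nat mfps \<Rightarrow> nat mfps \<Rightarrow> nat mfps" where
  "hirota P f g = mfps_subst (case_sum mfps_var (\<lambda>_. 0))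
     (mfps_Sum (\<lambda>M. mfps_const (mfps_coeff P M) *
        fold_mset (\<lambda>k. mfps_deriv (Inr k)) (hirota_shift f g) M))"

text \<open>
  The operator \<open>\<Sum>\<^sub>k h\<^sub>k(-2x) h\<^sub>k\<^sub>+\<^sub>1(D\<^sub>1, 2D\<^sub>2, \<dots>) exp(\<Sum>\<^sub>i x\<^sub>i D\<^sub>i)\<close>, as a power series in the symbols
  \<open>x\<^sub>i\<close> (\<open>Inl i\<close>) and \<open>D\<^sub>i\<close> (\<open>Inr i\<close>).
  The coefficient of each monomial in the \<open>x\<^sub>i\<close> is a polynomial in the \<open>D\<^sub>i\<close>.
\<close>

definition KP_operator :: "(nat + nat) mfps" where
  "KP_operator = mfps_Sum (\<lambda>k.
     mfps_subst (\<lambda>i. mfps_const (- 2) * mfps_var (Inl i)) (h_poly k) *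
     mfps_subst (\<lambda>i. mfps_const (of_nat i) * mfps_var (Inr i)) (h_poly (k + 1)) *
     mfps_exp (mfps_Sum (\<lambda>i. mfps_var (Inl (Suc i)) * mfps_var (Inr (Suc i)))))"

definition KP_operator_coeff :: "nat multiset \<Rightarrow> nat mfps" where
  "KP_operator_coeff N = Abs_mfps (\<lambda>M. mfps_coeff KP_operator (image_mset Inl N + image_mset Inr M))"

definition KP_tau_function :: "nat mfps \<Rightarrow> bool" where
  "KP_tau_function \<tau> \<longleftrightarrow> (\<forall>N. hirota (KP_operator_coeff N) \<tau> \<tau> = 0)"


section \<open>The fermionic Fock space\<close>

text \<open>
  A semi-infinite monomial \<open>v\<^bsub>i1\<^esub> \<and> v\<^bsub>i2\<^esub> \<and> \<dots>\<close> with \<open>i1 > i2 > \<dots>\<close> is represented by its set of indices.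
  All charges are included because the single fermions change the charge.
\<close>

typedef maya = "{S :: int set. finite (S \<inter> {1..}) \<and> finite ({..0} - S)}"
  morphisms occupied Abs_maya
  by (rule exI[of _ "{..0}"]) (auto simp: disjoint_iff intro!: finite_subset[of _ "{}"])

setup_lifting type_definition_maya

lift_definition maya_insert :: "int \<Rightarrow> maya \<Rightarrow> maya" is insert
proof -
  fix j :: int and S :: "int set"
  assume *: "finite (S \<inter> {1..}) \<and> finite ({..0} - S)"
  have "insert j S \<inter> {1..} \<subseteq> insert j (S \<inter> {1..})" "{..0} - insert j S \<subseteq> {..0} - S" by auto
  with * show "finite (insert j S \<inter> {1..}) \<and> finite ({..0} - insert j S)"
    by (meson finite_insert finite_subset)
qed

lift_definition maya_remove :: "int \<Rightarrow> maya \<Rightarrow> maya" is "\<lambda>j S. S - {j}"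
proof -
  fix j :: int and S :: "int set"
  assume *: "finite (S \<inter> {1..}) \<and> finite ({..0} - S)"
  have "(S - {j}) \<inter> {1..} \<subseteq> S \<inter> {1..}" "{..0} - (S - {j}) \<subseteq> insert j ({..0} - S)" by auto
  with * show "finite ((S - {j}) \<inter> {1..}) \<and> finite ({..0} - (S - {j}))"
    by (meson finite_insert finite_subset)
qed

type_synonym fock = "maya \<Rightarrow>\<^sub>0 complex"

abbreviation fock_scale :: "complex \<Rightarrow> fock \<Rightarrow> fock" (infixr \<open>*\<^sub>F\<close> 75) where
  "c *\<^sub>F v \<equiv> Poly_Mapping.map ((*) c) v"

definition maya_sign :: "int \<Rightarrow> maya \<Rightarrow> complex" where
  "maya_sign j S = (- 1) ^ card {i \<in> occupied S. i > j}"

definition psi :: "int \<Rightarrow> fock \<Rightarrow> fock" where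
  "psi j v = (\<Sum>S | S \<in> Poly_Mapping.keys v \<and> j \<notin> occupied S.
     Poly_Mapping.single (maya_insert j S) (maya_sign j S * Poly_Mapping.lookup v S))"

definition psi_star :: "int \<Rightarrow> fock \<Rightarrow> fock" where
  "psi_star j v = (\<Sum>S | S \<in> Poly_Mapping.keys v \<and> j \<in> occupied S.
     Poly_Mapping.single (maya_remove j S) (maya_sign j S * Poly_Mapping.lookup v S))"

definition normal_ordered :: "int \<Rightarrow> int \<Rightarrow> fock \<Rightarrow> fock" where
  "normal_ordered i j v = (if i > 0 then psi i (psi_star j v) else - psi_star j (psi i v))"

text \<open>The parts of a partition are numbered from 0 and continued by zeros.\<close>

definition is_partition :: "(nat \<Rightarrow> nat) \<Rightarrow> bool" where
  "is_partition \<mu> \<longleftrightarrow> antimono \<mu> \<and> finite {i. \<mu> i \<noteq> 0}"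

definition partition_maya :: "(nat \<Rightarrow> nat) \<Rightarrow> maya" where
  "partition_maya \<mu> = Abs_maya (range (\<lambda>i. int (\<mu> i) - int i))"

definition ket :: "(nat \<Rightarrow> nat) \<Rightarrow> fock" where
  "ket \<mu> = Poly_Mapping.single (partition_maya \<mu>) 1"

definition bra :: "(nat \<Rightarrow> nat) \<Rightarrow> fock \<Rightarrow> complex" where
  "bra \<mu> v = Poly_Mapping.lookup v (partition_maya \<mu>)"


section \<open>Deformed currents and double factorial Schur functions\<close>

definition elementary_sym :: "nat \<Rightarrow> ('a \<Rightarrow> complex) \<Rightarrow> 'a set \<Rightarrow> complex" where
  "elementary_sym r x I = (\<Sum>S | S \<subseteq> I \<and> card S = r. \<Prod>a\<in>S. x a)"

definition complete_sym :: "nat \<Rightarrow> ('a \<Rightarrow> complex) \<Rightarrow> 'a set \<Rightarrow> complex" where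
  "complete_sym s x I = (\<Sum>M | set_mset M \<subseteq> I \<and> size M = s. \<Prod>a\<in>#M. x a)"

text \<open>
  For \<open>i < j\<close> the sum over \<open>r - s = j - i - k\<close> is restricted to \<open>r \<le> j - i - 1\<close>, the number of
  arguments of the elementary symmetric polynomial; then \<open>s < k\<close>.
\<close>

definition current_coeff :: "(int \<Rightarrow> complex) \<Rightarrow> (int \<Rightarrow> complex) \<Rightarrow> nat \<Rightarrow> int \<Rightarrow> int \<Rightarrow> complex" where
  "current_coeff \<alpha> \<beta> k i j =
     (if j < i then 0
      else if j = i then \<beta> i ^ k
      else (1 - \<alpha> j * \<beta> j) *
        (\<Sum>(r, s) \<in> {(r, s) \<in> {..nat (j - i - 1)} \<times> {..k}. int r - int s = j - i - int k}.
           elementary_sym r (\<lambda>a. - \<alpha> a) {i + 1..j - 1} * complete_sym s \<beta> {i..j}))"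

text \<open>Only finitely many terms act nontrivially on a given vector; see \<open>finite_current_terms\<close>.\<close>

definition current :: "(int \<Rightarrow> complex) \<Rightarrow> (int \<Rightarrow> complex) \<Rightarrow> nat \<Rightarrow> fock \<Rightarrow> fock" where
  "current \<alpha> \<beta> k v = Sum_any (\<lambda>(i, j). current_coeff \<alpha> \<beta> k i j *\<^sub>F normal_ordered i j v)"

text \<open>
  \<open>H_plus\<close> and its exponential act on power series in \<open>t\<close> with coefficients in the Fock space, given by
  their coefficient functions.  Multiplication by \<open>t\<^sub>k\<close> moves the coefficient at \<open>M - {#k#}\<close> to \<open>M\<close>.
\<close>

definition H_plus ::
  "(int \<Rightarrow> complex) \<Rightarrow> (int \<Rightarrow> complex) \<Rightarrow> (nat multiset \<Rightarrow> fock) \<Rightarrow> (nat multiset \<Rightarrow> fock)" where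
  "H_plus \<alpha> \<beta> F = (\<lambda>M. \<Sum>k | k \<in># M \<and> k \<ge> 1. (1 / of_nat k) *\<^sub>F current \<alpha> \<beta> k (F (M - {#k#})))"

definition exp_H_plus ::
  "(int \<Rightarrow> complex) \<Rightarrow> (int \<Rightarrow> complex) \<Rightarrow> (nat multiset \<Rightarrow> fock) \<Rightarrow> (nat multiset \<Rightarrow> fock)" where
  "exp_H_plus \<alpha> \<beta> F = (\<lambda>M. Sum_any (\<lambda>n. (1 / fact n) *\<^sub>F (H_plus \<alpha> \<beta> ^^ n) F M))"

definition double_schur :: "(int \<Rightarrow> complex) \<Rightarrow> (int \<Rightarrow> complex) \<Rightarrow> (nat \<Rightarrow> nat) \<Rightarrow> nat mfps" where
  "double_schur \<alpha> \<beta> \<mu> = Abs_mfps (\<lambda>M.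
     bra (\<lambda>_. 0) (exp_H_plus \<alpha> \<beta> (\<lambda>M. if M = {#} then ket \<mu> else 0) M))"


section \<open>Well-definedness\<close>

text \<open>
  Every infinite sum occurring above is coefficientwise finite, the \<open>x\<close>-coefficients of \<open>KP_operator\<close> are
  polynomials, the derivatives folded over a multiset commute, and the index set of a partition is admissible.
  In \<open>finite_subst_terms\<close>, the hypothesis holds for all the linear substitutions used.
\<close>

lemma mfps_coeff_add: "mfps_coeff (f + g) M = mfps_coeff f M + mfps_coeff g M" by (simp add: plus_mfps_def)
lemma mfps_mult_nonzero: assumes "mfps_coeff (f * g) M \<noteq> 0"
  obtains A B where "M = A + B" "mfps_coeff f A \<noteq> 0" "mfps_coeff g B \<noteq> 0"
proof -
  from assms obtain A where "A \<subseteq># M" "mfps_coeff f A * mfps_coeff g (M - A) \<noteq> 0"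
    unfolding times_mfps_def mfps_coeff_Abs by (metis (mono_tags, lifting) mem_Collect_eq sum.not_neutral_contains_not_neutral)
  then show ?thesis using that[of A "M - A"] by auto
qed

lemma mfps_Sum_nonzero: assumes "mfps_coeff (mfps_Sum F) M \<noteq> 0" obtains i where "mfps_coeff (F i) M \<noteq> 0"
  using assms unfolding mfps_Sum_def mfps_coeff_Abs by (meson Sum_any.not_neutral_obtains_not_neutral)

lemma mfps_coeff_const_mult [simp]: "mfps_coeff (mfps_const c * f) M = c * mfps_coeff f M"
proof -
  have "mfps_coeff (mfps_const c * f) M = (\<Sum>A | A \<subseteq># M. if A = {#} then c * mfps_coeff f (M - A) else 0)"
    unfolding times_mfps_def mfps_const_def by (auto intro!: sum.cong)
  then show ?thesis by (simp add: sum.delta' finite_submsets)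
qed

lemma mfps_power_nonzero: assumes "mfps_coeff (f ^ n) M \<noteq> 0" "mfps_coeff f {#} = 0" shows "n \<le> size M"
  using assms
proof (induction n arbitrary: M)
  case (Suc n)
  from Suc.prems(1) obtain A B where *: "M = A + B" "mfps_coeff f A \<noteq> 0" "mfps_coeff (f ^ n) B \<noteq> 0"
    by (metis mfps_mult_nonzero power_Suc)
  then have "A \<noteq> {#}" using Suc.prems by auto
  then have "size A \<ge> 1" by (simp add: Suc_leI nonempty_has_size)
  with Suc.IH[OF *(3) Suc.prems(2)] *(1) show ?case by simp
qed simp

lemma finite_exp_terms: assumes "mfps_coeff f {#} = 0"
  shows "finite {n. mfps_coeff (mfps_const (1 / fact n) * f ^ n) M \<noteq> 0}"
  by (rule finite_subset[of _ "{..size M}"]) (auto dest!: mfps_power_nonzero[OF _ assms])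

lemma mfps_prod_nonzero: assumes "mfps_coeff (\<Prod>v\<in>#M. \<sigma> v) N \<noteq> 0"
  "\<And>v N. mfps_coeff (\<sigma> v) N \<noteq> 0 \<Longrightarrow> \<exists>w. N = {#w#} \<and> \<pi> w = v"
  shows "image_mset \<pi> N = M"
  using assms(1)
proof (induction M arbitrary: N)
  case empty then show ?case by (auto simp: one_mfps_def split: if_splits)
next
  case (add x M)
  then have "mfps_coeff (\<sigma> x * (\<Prod>v\<in>#M. \<sigma> v)) N \<noteq> 0" by simp
  then obtain A B where *: "N = A + B" "mfps_coeff (\<sigma> x) A \<noteq> 0" "mfps_coeff (\<Prod>v\<in>#M. \<sigma> v) B \<noteq> 0"
    by (rule mfps_mult_nonzero)
  from assms(2)[OF *(2)] add.IH[OF *(3)] *(1) show ?case by auto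
qed

lemma finite_subst_terms: 
  assumes "\<And>v N. mfps_coeff (\<sigma> v) N \<noteq> 0 \<Longrightarrow> \<exists>w. N = {#w#} \<and> \<pi> w = v"
  shows "finite {M. mfps_coeff (mfps_const (mfps_coeff f M) * (\<Prod>v\<in>#M. \<sigma> v)) N \<noteq> 0}"
  by (rule finite_subset[of _ "{image_mset \<pi> N}"]) (auto dest!: mfps_prod_nonzero[OF _ assms])

lemma mfps_subst_nonzero: 
  assumes "mfps_coeff (mfps_subst \<sigma> f) N \<noteq> 0" "\<And>v N. mfps_coeff (\<sigma> v) N \<noteq> 0 \<Longrightarrow> \<exists>w. N = {#w#} \<and> \<pi> w = v"
  shows "mfps_coeff f (image_mset \<pi> N) \<noteq> 0" "mfps_coeff (\<Prod>v\<in>#image_mset \<pi> N. \<sigma> v) N \<noteq> 0"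
proof -
  obtain M where M: "mfps_coeff (mfps_const (mfps_coeff f M) * (\<Prod>v\<in>#M. \<sigma> v)) N \<noteq> 0"
    using mfps_Sum_nonzero[OF assms(1)[unfolded mfps_subst_def]] by blast
  with mfps_prod_nonzero[of \<sigma> M N \<pi>] assms(2) have "image_mset \<pi> N = M" by auto
  with M show "mfps_coeff f (image_mset \<pi> N) \<noteq> 0" "mfps_coeff (\<Prod>v\<in>#image_mset \<pi> N. \<sigma> v) N \<noteq> 0" by auto
qed

lemma hirota_subst_plus: "\<exists>w. N = {#w#} \<and> case_sum id id w = v" if "mfps_coeff (mfps_var (Inl v) + mfps_var (Inr v)) N \<noteq> 0"
  using that by (auto simp: mfps_coeff_add mfps_var_def split: if_splits)
lemma hirota_subst_minus: "\<exists>w. N = {#w#} \<and> case_sum id id w = v" if "mfps_coeff (mfps_var (Inl v) - mfps_var (Inr v)) N \<noteq> 0"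
  using that by (auto simp: minus_mfps_def mfps_var_def split: if_splits)
lemma hirota_subst_zero: "\<exists>w. N = {#w#} \<and> Inl w = v" if "mfps_coeff (case_sum mfps_var (\<lambda>_. 0) v) N \<noteq> 0"
  using that by (auto simp: zero_mfps_def mfps_var_def split: if_splits sum.splits)

lemma mfps_deriv_commute: "mfps_deriv u (mfps_deriv v f) = mfps_deriv v (mfps_deriv u f)"
  by (rule mfps_eqI) (auto simp: mfps_deriv_def add_mset_commute)

interpretation mfps_deriv: comp_fun_commute "\<lambda>k. mfps_deriv (e k)" for e
  by standard (auto simp: mfps_deriv_commute)

lemma mfps_power_support: assumes "mfps_coeff (f ^ n) M \<noteq> 0" "\<And>M. mfps_coeff f M \<noteq> 0 \<Longrightarrow> M \<in> S" "{#} \<in> S"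
   "\<And>A B. A \<in> S \<Longrightarrow> B \<in> S \<Longrightarrow> A + B \<in> S" shows "M \<in> S"
  using assms(1)
proof (induction n arbitrary: M)
  case 0 then show ?case using assms(3) by (auto simp: one_mfps_def split: if_splits)
next
  case (Suc n)
  then show ?case by (metis mfps_mult_nonzero power_Suc assms(2,4))
qed
lemma mfps_exp_support: assumes "mfps_coeff (mfps_exp f) M \<noteq> 0" "\<And>M. mfps_coeff f M \<noteq> 0 \<Longrightarrow> M \<in> S" "{#} \<in> S"
   "\<And>A B. A \<in> S \<Longrightarrow> B \<in> S \<Longrightarrow> A + B \<in> S" shows "M \<in> S"
  using assms(1) unfolding mfps_exp_def by (elim mfps_Sum_nonzero) (use mfps_power_support assms in auto)

definition h_support :: "nat option multiset set" where "h_support = {M. Some 0 \<notin># M \<and> (\<Sum>x\<in>#M. case x of None \<Rightarrow> (-1::int) | Some k \<Rightarrow> int k) = 0}"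

lemma mfps_var_power_nonzero: "mfps_coeff (mfps_var v ^ n) M \<noteq> 0 \<Longrightarrow> M = replicate_mset n v"
proof (induction n arbitrary: M)
  case 0 then show ?case by (auto simp: one_mfps_def split: if_splits)
next
  case (Suc n)
  then show ?case unfolding power_Suc by (elim mfps_mult_nonzero) (auto simp: mfps_var_def split: if_splits)
qed

lemma h_gen_arg_nonzero: "mfps_coeff (mfps_Sum (\<lambda>i. mfps_const (1 / of_nat (Suc i)) * mfps_var (Some (Suc i)) * mfps_var None ^ Suc i)) M \<noteq> 0
  \<Longrightarrow> \<exists>i. M = add_mset (Some (Suc i)) (replicate_mset (Suc i) None)"
  apply (erule mfps_Sum_nonzero)
  apply (erule mfps_mult_nonzero)
  apply (drule mfps_var_power_nonzero)
  apply (auto simp: mfps_var_def simp del: replicate_mset_Suc split: if_splits)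
  done

lemma h_poly_nonzero: assumes "mfps_coeff (h_poly k) M \<noteq> 0" shows "sum_mset M = k" "0 \<notin># M"
proof -
  from assms have "mfps_coeff h_gen (image_mset Some M + replicate_mset k None) \<noteq> 0" by (simp add: h_poly_def)
  then have *: "image_mset Some M + replicate_mset k None \<in> h_support"
    unfolding h_gen_def
  proof (rule mfps_exp_support)
    show "M \<in> h_support" if "mfps_coeff (mfps_Sum (\<lambda>i. mfps_const (1 / of_nat (Suc i)) * mfps_var (Some (Suc i)) * mfps_var None ^ Suc i)) M \<noteq> 0" for M
      using h_gen_arg_nonzero[OF that] by (auto simp: h_support_def simp del: replicate_mset_Suc) 
  qed (auto simp: h_support_def)
  then show "0 \<notin># M" by (auto simp: h_support_def)
  from * have "(\<Sum>x\<in>#M. int x) = int k" by (simp add: h_support_def image_mset.compositionality o_def)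
  moreover have "(\<Sum>x\<in>#M. int x) = int (sum_mset M)" by (induction M) auto
  ultimately show "sum_mset M = k" by linarith
qed

definition "KP_exp = mfps_exp (mfps_Sum (\<lambda>i. mfps_var (Inl (Suc i)) * mfps_var (Inr (Suc i))))"
definition "x_weight M = (\<Sum>x\<in>#M. case x of Inl k \<Rightarrow> k | Inr k \<Rightarrow> (0::nat))"
definition "D_weight M = (\<Sum>x\<in>#M. case x of Inl k \<Rightarrow> (0::nat) | Inr k \<Rightarrow> k)"

lemma KP_exp_arg_nonzero: "mfps_coeff (mfps_Sum (\<lambda>i. mfps_var (Inl (Suc i)) * mfps_var (Inr (Suc i)))) M \<noteq> 0 \<Longrightarrow> \<exists>i. M = {#Inl (Suc i), Inr (Suc i)#}"
  by (elim mfps_Sum_nonzero mfps_mult_nonzero) (auto simp: mfps_var_def split: if_splits)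

lemma KP_exp_nonzero: assumes "mfps_coeff KP_exp M \<noteq> 0" shows "x_weight M = D_weight M \<and> Inr 0 \<notin># M"
proof -
  have "M \<in> {M. x_weight M = D_weight M \<and> Inr 0 \<notin># M}"
    using assms unfolding KP_exp_def
    by (rule mfps_exp_support) (use KP_exp_arg_nonzero in \<open>fastforce simp: x_weight_def D_weight_def\<close>)+
  then show ?thesis by simp
qed

lemma mfps_prod_scaled_vars: assumes "mfps_coeff (\<Prod>v\<in>#M. mfps_const (c v) * mfps_var (e v)) N \<noteq> 0" shows "N = image_mset e M"
  using assms
proof (induction M arbitrary: N)
  case empty then show ?case by (auto simp: one_mfps_def split: if_splits)
next
  case (add x M)
  then have "mfps_coeff ((mfps_const (c x) * mfps_var (e x)) * (\<Prod>v\<in>#M. mfps_const (c v) * mfps_var (e v))) N \<noteq> 0" by simp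
  then show ?case using add.IH by (elim mfps_mult_nonzero) (auto simp: mfps_var_def mfps_const_def[of "c x"] split: if_splits)
qed

lemma mfps_subst_scaled_nonzero: assumes "mfps_coeff (mfps_subst (\<lambda>v. mfps_const (c v) * mfps_var (e v)) f) N \<noteq> 0"
  obtains M where "N = image_mset e M" "mfps_coeff f M \<noteq> 0"
  using assms unfolding mfps_subst_def by (elim mfps_Sum_nonzero) (use mfps_prod_scaled_vars in fastforce)

lemma KP_term_nonzero: assumes "mfps_coeff (
     mfps_subst (\<lambda>i. mfps_const (- 2) * mfps_var (Inl i)) (h_poly k) *
     mfps_subst (\<lambda>i. mfps_const (of_nat i) * mfps_var (Inr i)) (h_poly (k + 1)) * KP_exp) M \<noteq> 0"
  shows "k \<le> x_weight M \<and> D_weight M = x_weight M + 1 \<and> Inr 0 \<notin># M"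
proof -
  obtain A B C where M: "M = A + B + C"
    and A: "mfps_coeff (mfps_subst (\<lambda>i. mfps_const (- 2) * mfps_var (Inl i)) (h_poly k)) A \<noteq> 0"
    and B: "mfps_coeff (mfps_subst (\<lambda>i. mfps_const (of_nat i) * mfps_var (Inr i)) (h_poly (k+1))) B \<noteq> 0"
    and C: "mfps_coeff KP_exp C \<noteq> 0"
    using assms by (elim mfps_mult_nonzero) auto
  from mfps_subst_scaled_nonzero[OF A] h_poly_nonzero obtain A' where A': "A = image_mset Inl A'" "sum_mset A' = k" by metis
  from mfps_subst_scaled_nonzero[OF B] h_poly_nonzero obtain B' where B': "B = image_mset Inr B'" "sum_mset B' = k + 1" "0 \<notin># B'" by metis
  from KP_exp_nonzero[OF C] A' B' M show ?thesis
    by (auto simp: x_weight_def D_weight_def image_mset.compositionality o_def)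
qed

lemma finite_KP_terms: "finite {k. mfps_coeff (
     mfps_subst (\<lambda>i. mfps_const (- 2) * mfps_var (Inl i)) (h_poly k) *
     mfps_subst (\<lambda>i. mfps_const (of_nat i) * mfps_var (Inr i)) (h_poly (k + 1)) * KP_exp) M \<noteq> 0}"
proof (rule finite_subset)
  show "{k. mfps_coeff (
     mfps_subst (\<lambda>i. mfps_const (- 2) * mfps_var (Inl i)) (h_poly k) *
     mfps_subst (\<lambda>i. mfps_const (of_nat i) * mfps_var (Inr i)) (h_poly (k + 1)) * KP_exp) M \<noteq> 0} \<subseteq> {..x_weight M}"
    using KP_term_nonzero by blast
qed simp

lemma KP_operator_coeff_polynomial: "finite {M. mfps_coeff (KP_operator_coeff N) M \<noteq> 0}"
proof (rule finite_subset)
  show "{M. mfps_coeff (KP_operator_coeff N) M \<noteq> 0} \<subseteq> {M. sum_mset M = sum_mset N + 1 \<and> 0 \<notin># M}"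
  proof
    fix M assume "M \<in> {M. mfps_coeff (KP_operator_coeff N) M \<noteq> 0}"
    then have "mfps_coeff KP_operator (image_mset Inl N + image_mset Inr M) \<noteq> 0" by (simp add: KP_operator_coeff_def)
    then show "M \<in> {M. sum_mset M = sum_mset N + 1 \<and> 0 \<notin># M}"
      unfolding KP_operator_def KP_exp_def[symmetric]
      by (elim mfps_Sum_nonzero, drule_tac KP_term_nonzero) (auto simp: x_weight_def D_weight_def image_mset.compositionality o_def)
  qed
  have "{M. sum_mset M = n \<and> 0 \<notin># M} \<subseteq> mset ` {xs. set xs \<subseteq> {..n} \<and> length xs \<le> n}" for n :: nat
  proof
    fix M assume "M \<in> {M. sum_mset M = n \<and> 0 \<notin># M}"
    moreover have "x \<in># M \<Longrightarrow> x \<le> sum_mset M" for x by (metis le_add1 mset_add sum_mset.add_mset)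
    moreover have "0 \<notin># M \<Longrightarrow> size M \<le> sum_mset M" by (induction M) auto
    moreover obtain xs where "mset xs = M" using ex_mset by blast
    ultimately show "M \<in> mset ` {xs. set xs \<subseteq> {..n} \<and> length xs \<le> n}"
      by (intro image_eqI[of _ _ xs]) auto
  qed
  moreover have "finite {xs. set xs \<subseteq> {..n} \<and> length xs \<le> n}" for n :: nat
    by (rule finite_lists_length_le) simp
  ultimately show "finite {M. sum_mset M = sum_mset N + 1 \<and> 0 \<notin># M}"
    by (meson finite_imageI finite_subset)
qed

lemma psi_nonzero: "psi j v \<noteq> 0 \<Longrightarrow> \<exists>S\<in>Poly_Mapping.keys v. j \<notin> occupied S"
  unfolding psi_def by (erule sum.not_neutral_contains_not_neutral) blast
lemma psi_star_nonzero: "psi_star j v \<noteq> 0 \<Longrightarrow> \<exists>S\<in>Poly_Mapping.keys v. j \<in> occupied S"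
  unfolding psi_star_def by (erule sum.not_neutral_contains_not_neutral) blast
lemma psi_zero [simp]: "psi j 0 = 0" "psi_star j 0 = 0" by (auto simp: psi_def psi_star_def)
lemma fock_scale_zero_right [simp]: "Poly_Mapping.map ((*) c) (0::fock) = 0" by (rule poly_mapping_eqI) (simp add: Poly_Mapping.map.rep_eq)
lemma fock_scale_zero_left [simp]: "Poly_Mapping.map ((*) 0) (v::fock) = 0" by (rule poly_mapping_eqI) (simp add: Poly_Mapping.map.rep_eq when_def)

lemma occupied_finite: "finite (occupied S \<inter> {1..})" "finite ({..0} - occupied S)" using occupied[of S] by blast+
lemma finite_occupied_atLeast: "finite (occupied S \<inter> {i..})"
proof (rule finite_subset)
  show "occupied S \<inter> {i..} \<subseteq> (occupied S \<inter> {1..}) \<union> {i..0}" by (auto simp: not_le)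
qed (simp add: occupied_finite)

lemma finite_current_terms: "finite {p. (case p of (i, j) \<Rightarrow> current_coeff \<alpha> \<beta> k i j *\<^sub>F normal_ordered i j v) \<noteq> 0}"
proof -
  let ?P = "\<Union>S\<in>Poly_Mapping.keys v. occupied S \<inter> {1..}"
  let ?Q = "\<Union>S\<in>Poly_Mapping.keys v. {..0} - occupied S"
  let ?R = "\<lambda>i. \<Union>S\<in>Poly_Mapping.keys (psi i v). occupied S \<inter> {i..}"
  have fin: "finite ?P" "finite ?Q" "\<And>i. finite (?R i)" by (intro finite_UN_I finite_keys occupied_finite finite_occupied_atLeast)+
  have "(i, j) \<in> (SIGMA j:?P. {1..j})\<inverse> \<union> Sigma ?Q ?R"
    if nz: "current_coeff \<alpha> \<beta> k i j *\<^sub>F normal_ordered i j v \<noteq> 0" for i j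
  proof -
    from nz have "current_coeff \<alpha> \<beta> k i j \<noteq> 0" by (metis fock_scale_zero_left)
    then have ij: "i \<le> j" by (auto simp: current_coeff_def split: if_splits)
    from nz have no: "normal_ordered i j v \<noteq> 0" by (metis fock_scale_zero_right)
    show ?thesis
    proof (cases "i > 0")
      case True
      with no have "psi_star j v \<noteq> 0" by (auto simp: normal_ordered_def)
      with psi_star_nonzero True ij show ?thesis by fastforce
    next
      case False
      with no have "psi_star j (psi i v) \<noteq> 0" "psi i v \<noteq> 0" by (auto simp: normal_ordered_def)
      with psi_star_nonzero[of j "psi i v"] psi_nonzero[of i v] False ij show ?thesis by fastforce
    qed
  qed
  then have "{p. (case p of (i, j) \<Rightarrow> current_coeff \<alpha> \<beta> k i j *\<^sub>F normal_ordered i j v) \<noteq> 0} \<subseteq> (SIGMA j:?P. {1..j})\<inverse> \<union> Sigma ?Q ?R"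
    (is "?L \<subseteq> _") by (intro subsetI) (simp only: mem_Collect_eq split: prod.splits)
  moreover have "finite ((SIGMA j:?P. {1..j})\<inverse> \<union> Sigma ?Q ?R)"
    by (intro finite_UnI finite_SigmaI finite_converse[THEN iffD2] fin finite_atLeastAtMost_int)
  ultimately show ?thesis by (rule finite_subset)
qed

lemma normal_ordered_zero [simp]: "normal_ordered i j 0 = 0" by (simp add: normal_ordered_def)

lemma current_zero: "current \<alpha> \<beta> k 0 = 0"
  by (simp add: current_def case_prod_unfold)

lemma H_plus_power_eq_0: "size M \<noteq> n \<Longrightarrow> (H_plus \<alpha> \<beta> ^^ n) (\<lambda>M. if M = {#} then v else 0) M = 0"
proof (induction n arbitrary: M)
  case (Suc n)
  have "(H_plus \<alpha> \<beta> ^^ n) (\<lambda>M. if M = {#} then v else 0) (M - {#k#}) = 0" if "k \<in># M" for k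
  proof (rule Suc.IH)
    have "size M = Suc (size (M - {#k#}))" using that by (metis insert_DiffM size_add_mset)
    with Suc.prems show "size (M - {#k#}) \<noteq> n" by simp
  qed
  then show ?case by (auto simp add: H_plus_def[of \<alpha> \<beta> "(H_plus \<alpha> \<beta> ^^ n) (\<lambda>M. if M = {#} then v else 0)"] current_zero intro!: sum.neutral)
qed auto

lemma exp_H_plus_homogeneous: "exp_H_plus \<alpha> \<beta> (\<lambda>M. if M = {#} then v else 0) M = 
   (1 / fact (size M)) *\<^sub>F (H_plus \<alpha> \<beta> ^^ size M) (\<lambda>M. if M = {#} then v else 0) M"
proof -
  let ?g = "\<lambda>n. (1 / fact n) *\<^sub>F (H_plus \<alpha> \<beta> ^^ n) (\<lambda>M. if M = {#} then v else 0) M"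
  have "?g n = 0" if "n \<noteq> size M" for n
    by (simp only: H_plus_power_eq_0[OF that[symmetric]] fock_scale_zero_right)
  then have "Sum_any ?g = sum ?g {size M}" by (intro Sum_any.expand_superset) auto
  then show ?thesis unfolding exp_H_plus_def by simp
qed

lemma occupied_partition_maya: assumes "is_partition \<mu>" shows "occupied (partition_maya \<mu>) = range (\<lambda>i. int (\<mu> i) - int i)"
proof -
  let ?f = "\<lambda>i. int (\<mu> i) - int i"
  let ?F = "{i. \<mu> i \<noteq> 0}"
  have F: "finite ?F" using assms by (simp add: is_partition_def)
  have "range ?f \<inter> {1..} \<subseteq> ?f ` ?F" by auto
  moreover have "{..0} - range ?f \<subseteq> (\<lambda>i. - int i) ` ?F"
  proof
    fix x :: int assume x: "x \<in> {..0} - range ?f"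
    then have "\<mu> (nat (- x)) \<noteq> 0" by (auto intro: rev_image_eqI[of "nat (-x)"])
    with x show "x \<in> (\<lambda>i. - int i) ` ?F" by (intro rev_image_eqI[of "nat (-x)"]) auto
  qed
  ultimately have "range ?f \<in> {S. finite (S \<inter> {1..}) \<and> finite ({..0} - S)}"
    using F by (simp only: mem_Collect_eq) (meson finite_imageI finite_subset)
  then show ?thesis unfolding partition_maya_def by (rule Abs_maya_inverse)
qed

end

theory Submission
  imports Defs "HOL-Computational_Algebra.Formal_Power_Series" "Jordan_Normal_Form.Determinant"
begin

text \<open>
  Let \<open>A\<^sub>k\<close> be the matrix of the \<open>k\<close>-th deformed current and \<open>X = \<Sum>\<^sub>k t\<^sub>k A\<^sub>k / k\<close>.  Split the indices into the block 1 of
  nonpositive and the block 2 of positive integers, and choose \<open>n\<close> at least the length of the partition.  The proof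
  rests on three observations.

  First, \<open>A\<^sub>k = A\<^sub>1\<^sup>k\<close>, all these matrices are upper triangular, and the off-diagonal block \<open>u v\<close> of \<open>A\<^sub>1\<close> has rank one.
  This follows from the explicit entries through the two-term recursion \<open>cur_recursion\<close>, as a polynomial identity in \<open>\<alpha>\<close> and
  \<open>\<beta>\<close> (\<open>cur_add\<close>, \<open>cur_rank_one\<close>).

  Second, the double factorial Schur function is a minor.  A current acts on a wedge product as a derivation, so the
  exponential replaces every factor by the corresponding column of \<open>e\<^sup>X\<close>, and the vacuum component is a determinant of
  entries of \<open>e\<^sup>X\<close> with the rows \<open>0, -1, \<dots>, 1 - n\<close>.  Normal ordering contributes the factor
  \<open>det (exp(-X\<^sub>1\<^sub>1))\<close>, so that altogether \<open>\<tau> = det G\<close> where \<open>G\<close> consists of columns of \<open>K = exp(-X\<^sub>1\<^sub>1) (e\<^sup>X)\<^sub>1\<^sub>*\<close>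
  (\<open>exp_H_plus_wedge\<close>, \<open>vacuum_component\<close>).

  Third, every such determinant is a tau function.  Because the off-diagonal block has rank one, a translation
  \<open>t\<^sub>i \<mapsto> t\<^sub>i + w\<^sup>i\<close> changes \<open>K\<close> by a matrix of rank one built from \<open>\<phi>\<^sub>p = exp(-X\<^sub>1\<^sub>1) A\<^sub>1\<^sub>1\<^sup>p u\<close> and
  \<open>\<psi>\<^sub>q = v A\<^sub>2\<^sub>2\<^sup>q (e\<^sup>X)\<^sub>2\<^sub>*\<close>, and \<open>\<tau>\<close> by a bilinear expression in these vectors and the cofactors of \<open>G\<close>.  The Hirota
  equations say that \<open>\<Sum>\<^sub>k h\<^sub>k(-2y)\<close> times the coefficient of \<open>w\<^sup>k\<^sup>+\<^sup>1\<close> in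
  \<open>\<tau>(t + y + [w]) \<tau>(t - y - [w])\<close> vanishes (\<open>KP_tau_functionI\<close>).  Multiplication by \<open>h\<^sub>k(-2y)\<close> and summation turn the vectors at
  \<open>t + y\<close> into those at \<open>t - y\<close> and conversely, and turn the convolution of \<open>\<phi>\<close> and \<open>\<psi>\<close> into \<open>K(t - y) - K(t + y)\<close>;
  the relations between a matrix and its cofactors then make the three resulting terms cancel (\<open>KP_tau_function_det\<close>).
\<close>


section \<open>Calculus of formal power series\<close>

lemma mfps_coeff_zero [simp]: "mfps_coeff 0 M = 0"
  by (simp add: zero_mfps_def)

lemma mfps_coeff_one: "mfps_coeff 1 M = (if M = {#} then 1 else 0)"
  by (simp add: one_mfps_def)

lemma mfps_coeff_diff: "mfps_coeff (f - g) M = mfps_coeff f M - mfps_coeff g M"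
  by (simp add: minus_mfps_def)

lemma mfps_coeff_uminus: "mfps_coeff (- f) M = - mfps_coeff f M"
  by (simp add: uminus_mfps_def)

lemma mfps_coeff_sum: "mfps_coeff (sum f A) M = (\<Sum>x\<in>A. mfps_coeff (f x) M)"
  by (induction A rule: infinite_finite_induct) (auto simp: mfps_coeff_add)

lemma mfps_coeff_mult: "mfps_coeff (f * g) M = (\<Sum>A | A \<subseteq># M. mfps_coeff f A * mfps_coeff g (M - A))"
  by (simp add: times_mfps_def)

lemma mfps_coeff_const: "mfps_coeff (mfps_const c) M = (if M = {#} then c else 0)"
  by (simp add: mfps_const_def)

lemma mfps_const_0 [simp]: "mfps_const 0 = 0"
  by (rule mfps_eqI) (simp add: mfps_coeff_const)

lemma mfps_const_1 [simp]: "mfps_const 1 = 1"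
  by (rule mfps_eqI) (simp add: mfps_coeff_const mfps_coeff_one)

lemma mfps_const_add: "mfps_const (a + b) = mfps_const a + mfps_const b"
  by (rule mfps_eqI) (simp add: mfps_coeff_const mfps_coeff_add)

lemma mfps_const_uminus: "mfps_const (- a) = - mfps_const a"
  by (rule mfps_eqI) (simp add: mfps_coeff_const mfps_coeff_uminus)

lemma mfps_const_mult: "mfps_const (a * b) = mfps_const a * mfps_const b"
  by (rule mfps_eqI) (simp add: mfps_coeff_const)

lemma mfps_const_of_nat: "mfps_const (of_nat n) = of_nat n"
  by (induction n) (simp_all add: mfps_const_add)

lemma mfps_coeff_of_nat_mult: "mfps_coeff (of_nat n * f) M = of_nat n * mfps_coeff f M"
  by (simp flip: mfps_const_of_nat)

lemma mfps_of_nat_mult_cancel: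
  fixes f g :: "'v mfps"
  assumes "of_nat n * f = of_nat n * g" "n > 0"
  shows "f = g"
proof (rule mfps_eqI)
  fix M
  have "mfps_coeff (of_nat n * f) M = mfps_coeff (of_nat n * g) M" using assms by simp
  then show "mfps_coeff f M = mfps_coeff g M" using assms(2) by (simp add: mfps_coeff_of_nat_mult)
qed

lemma mfps_coeff_deriv: "mfps_coeff (mfps_deriv v f) M = of_nat (count M v + 1) * mfps_coeff f (add_mset v M)"
  by (simp add: mfps_deriv_def)

lemma mfps_deriv_add: "mfps_deriv v (f + g) = mfps_deriv v f + mfps_deriv v g"
  by (rule mfps_eqI) (simp add: mfps_coeff_deriv mfps_coeff_add distrib_left)

lemma mfps_deriv_diff: "mfps_deriv v (f - g) = mfps_deriv v f - mfps_deriv v g"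
  by (rule mfps_eqI) (simp add: mfps_coeff_deriv mfps_coeff_diff right_diff_distrib)

lemma mfps_deriv_uminus: "mfps_deriv v (- f) = - mfps_deriv v f"
  by (rule mfps_eqI) (simp add: mfps_coeff_deriv mfps_coeff_uminus)

lemma mfps_deriv_const_mult: "mfps_deriv v (mfps_const c * f) = mfps_const c * mfps_deriv v f"
  by (rule mfps_eqI) (simp add: mfps_coeff_deriv)

lemma mfps_deriv_const [simp]: "mfps_deriv v (mfps_const c) = 0"
  by (rule mfps_eqI) (simp add: mfps_coeff_deriv mfps_coeff_const)

lemma mfps_deriv_0 [simp]: "mfps_deriv v 0 = 0"
  by (rule mfps_eqI) (simp add: mfps_coeff_deriv)

lemma mfps_deriv_1 [simp]: "mfps_deriv v 1 = 0"
  using mfps_deriv_const[of v 1] by simp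

lemma mfps_deriv_sum: "mfps_deriv v (sum f A) = (\<Sum>x\<in>A. mfps_deriv v (f x))"
  by (induction A rule: infinite_finite_induct) (auto simp: mfps_deriv_add)

lemma mfps_deriv_var: "mfps_deriv v (mfps_var w) = (if v = w then 1 else 0)"
  by (rule mfps_eqI) (auto simp: mfps_coeff_deriv mfps_coeff_one mfps_var_def)

lemma sum_submsets_containing:
  "(\<Sum>A | A \<subseteq># add_mset v M. of_nat (count A v) * F A) =
   (\<Sum>A | A \<subseteq># M. of_nat (count A v + 1) * F (add_mset v A) :: complex)"
proof -
  have "(\<Sum>A | A \<subseteq># add_mset v M. of_nat (count A v) * F A) =
        (\<Sum>A | A \<subseteq># add_mset v M \<and> v \<in># A. of_nat (count A v) * F A)"
    by (rule sum.mono_neutral_right) (auto simp: finite_submsets not_in_iff)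
  also have "\<dots> = (\<Sum>A | A \<subseteq># M. of_nat (count A v + 1) * F (add_mset v A))"
    by (rule sum.reindex_bij_witness[where i = "add_mset v" and j = "\<lambda>A. A - {#v#}"])
       (auto simp: subset_eq_diff_conv)
  finally show ?thesis .
qed

lemma mfps_deriv_mult: "mfps_deriv v (f * g) = mfps_deriv v f * g + f * mfps_deriv v g"
proof (rule mfps_eqI)
  fix M
  let ?N = "add_mset v M"
  have split: "of_nat (count M v + 1) * (mfps_coeff f A * mfps_coeff g (?N - A)) =
      of_nat (count A v) * (mfps_coeff f A * mfps_coeff g (?N - A)) +
      of_nat (count (?N - A) v) * (mfps_coeff f A * mfps_coeff g (?N - A))" if "A \<subseteq># ?N" for A
  proof -
    have "count A v + count (?N - A) v = count M v + 1"
      using mset_subset_eq_count[OF that, of v] by simp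
    then have "of_nat (count M v + 1) = (of_nat (count A v) + of_nat (count (?N - A) v) :: complex)"
      by (metis of_nat_add)
    then show ?thesis by (simp only: distrib_right)
  qed
  have "mfps_coeff (mfps_deriv v (f * g)) M =
      (\<Sum>A | A \<subseteq># ?N. of_nat (count A v) * (mfps_coeff f A * mfps_coeff g (?N - A))) +
      (\<Sum>A | A \<subseteq># ?N. of_nat (count (?N - A) v) * (mfps_coeff f A * mfps_coeff g (?N - A)))"
    unfolding mfps_coeff_deriv mfps_coeff_mult sum_distrib_left sum.distrib[symmetric]
    by (intro sum.cong refl) (use split in auto)
  also have "(\<Sum>A | A \<subseteq># ?N. of_nat (count A v) * (mfps_coeff f A * mfps_coeff g (?N - A))) =
      mfps_coeff (mfps_deriv v f * g) M"
    unfolding sum_submsets_containing mfps_coeff_mult mfps_coeff_deriv by (simp add: mult.assoc)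
  also have "(\<Sum>A | A \<subseteq># ?N. of_nat (count (?N - A) v) * (mfps_coeff f A * mfps_coeff g (?N - A))) =
      (\<Sum>A | A \<subseteq># ?N. of_nat (count A v) * (mfps_coeff f (?N - A) * mfps_coeff g A))"
    by (rule sum.reindex_bij_witness[where i = "\<lambda>A. ?N - A" and j = "\<lambda>A. ?N - A"])
       (auto simp: subset_mset.diff_diff_right)
  also have "\<dots> = mfps_coeff (mfps_deriv v g * f) M"
    unfolding sum_submsets_containing mfps_coeff_mult mfps_coeff_deriv by (simp add: mult_ac)
  finally show "mfps_coeff (mfps_deriv v (f * g)) M = mfps_coeff (mfps_deriv v f * g + f * mfps_deriv v g) M"
    by (simp add: mfps_coeff_add mult.commute)
qed

lemma mfps_deriv_power_Suc: "mfps_deriv v (f ^ Suc n) = of_nat (Suc n) * (mfps_deriv v f * f ^ n)"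
  by (induction n) (simp_all add: mfps_deriv_mult algebra_simps)

text \<open>Up to degree \<open>k\<close> the exponential is a polynomial, to which the power rule applies.\<close>

lemma mfps_coeff_exp:
  assumes "mfps_coeff f {#} = 0" "size M \<le> k"
  shows "mfps_coeff (mfps_exp f) M = (\<Sum>n\<le>k. mfps_coeff (f ^ n) M / fact n)"
proof -
  have "Sum_any (\<lambda>n. mfps_coeff (mfps_const (1 / fact n) * f ^ n) M) = (\<Sum>n\<le>k. mfps_coeff (mfps_const (1 / fact n) * f ^ n) M)"
    by (rule Sum_any.expand_superset) (use mfps_power_nonzero[OF _ assms(1)] assms(2) in fastforce)+
  then show ?thesis by (simp add: mfps_exp_def mfps_Sum_def)
qed

lemma mfps_deriv_exp:
  fixes f :: "'v mfps"
  assumes "mfps_coeff f {#} = 0"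
  shows "mfps_deriv v (mfps_exp f) = mfps_deriv v f * mfps_exp f"
proof (rule mfps_eqI)
  fix M :: "'v multiset"
  let ?e = "\<Sum>n\<le>size M. mfps_const (1 / fact n) * f ^ n"
  have "mfps_coeff (mfps_deriv v (mfps_exp f)) M =
      of_nat (count M v + 1) * (\<Sum>n\<le>Suc (size M). mfps_coeff (f ^ n) (add_mset v M) / fact n)"
    by (subst mfps_coeff_deriv, subst mfps_coeff_exp[OF assms]) auto
  also have "\<dots> = (\<Sum>n\<le>Suc (size M). mfps_coeff (mfps_deriv v (f ^ n)) M / fact n)"
    by (simp only: sum_distrib_left mfps_coeff_deriv times_divide_eq_right)
  also have "\<dots> = (\<Sum>n\<le>size M. mfps_coeff (mfps_deriv v (f ^ Suc n)) M / fact (Suc n))"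
    by (subst sum.atMost_Suc_shift) simp
  also have "\<dots> = (\<Sum>n\<le>size M. mfps_coeff (mfps_deriv v f * f ^ n) M / fact n)"
  proof (rule sum.cong[OF refl])
    fix n
    have "of_nat (Suc n) \<noteq> (0 :: complex)" by (simp only: of_nat_eq_0_iff)
    then show "mfps_coeff (mfps_deriv v (f ^ Suc n)) M / fact (Suc n) = mfps_coeff (mfps_deriv v f * f ^ n) M / fact n"
      unfolding mfps_deriv_power_Suc mfps_coeff_of_nat_mult fact_Suc by simp
  qed
  also have "\<dots> = mfps_coeff (mfps_deriv v f * ?e) M"
  proof -
    have "mfps_deriv v f * ?e = (\<Sum>n\<le>size M. mfps_const (1 / fact n) * (mfps_deriv v f * f ^ n))"
      by (simp add: sum_distrib_left mult_ac)
    then show ?thesis by (simp add: mfps_coeff_sum)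
  qed
  also have "\<dots> = mfps_coeff (mfps_deriv v f * mfps_exp f) M"
    unfolding mfps_coeff_mult
  proof (intro sum.cong refl arg_cong2[of _ _ _ _ "(*)"])
    fix A
    have "mfps_coeff ?e (M - A) = (\<Sum>n\<le>size M. mfps_coeff (f ^ n) (M - A) / fact n)"
      by (simp add: mfps_coeff_sum)
    also have "\<dots> = mfps_coeff (mfps_exp f) (M - A)"
      by (rule mfps_coeff_exp[symmetric, OF assms]) (simp add: diff_subset_eq_self size_mset_mono)
    finally show "mfps_coeff ?e (M - A) = mfps_coeff (mfps_exp f) (M - A)" .
  qed
  finally show "mfps_coeff (mfps_deriv v (mfps_exp f)) M = mfps_coeff (mfps_deriv v f * mfps_exp f) M" .
qed

lemma mfps_exp_const_coeff:
  assumes "mfps_coeff f {#} = 0"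
  shows "mfps_coeff (mfps_exp f) {#} = 1"
  using mfps_coeff_exp[OF assms, of "{#}" 0] by (simp add: mfps_coeff_one)

lemma mfps_coeff_var_mult:
  "mfps_coeff (mfps_var v * f) M = (if v \<in># M then mfps_coeff f (M - {#v#}) else 0)"
proof -
  have "mfps_coeff (mfps_var v * f) M = (\<Sum>A | A \<subseteq># M. if A = {#v#} then mfps_coeff f (M - A) else 0)"
    unfolding mfps_coeff_mult by (intro sum.cong) (auto simp: mfps_var_def)
  also have "\<dots> = (if v \<in># M then mfps_coeff f (M - {#v#}) else 0)"
    by (simp add: sum.delta' finite_submsets)
  finally show ?thesis .
qed

text \<open>
  A substitution of homogeneous linear forms in which every new variable \<open>w\<close> occurs only in the form
  that replaces \<open>\<pi> w\<close>: each coefficient of the result comes from a single coefficient of the argument.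
\<close>

locale linear_subst =
  fixes \<sigma> :: "'v \<Rightarrow> 'w mfps" and \<pi> :: "'w \<Rightarrow> 'v"
  assumes linear: "mfps_coeff (\<sigma> v) N \<noteq> 0 \<Longrightarrow> \<exists>w. N = {#w#} \<and> \<pi> w = v"
begin

lemma coeff_subst:
  "mfps_coeff (mfps_subst \<sigma> f) N = mfps_coeff f (image_mset \<pi> N) * mfps_coeff (\<Prod>v\<in>#image_mset \<pi> N. \<sigma> v) N"
proof -
  have "Sum_any (\<lambda>M. mfps_coeff (mfps_const (mfps_coeff f M) * (\<Prod>v\<in>#M. \<sigma> v)) N) =
      (\<Sum>M\<in>{image_mset \<pi> N}. mfps_coeff (mfps_const (mfps_coeff f M) * (\<Prod>v\<in>#M. \<sigma> v)) N)"
    by (rule Sum_any.expand_superset) (auto dest!: mfps_prod_nonzero[OF _ linear])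
  then show ?thesis by (simp add: mfps_subst_def mfps_Sum_def)
qed

lemma subst_add: "mfps_subst \<sigma> (f + g) = mfps_subst \<sigma> f + mfps_subst \<sigma> g"
  by (rule mfps_eqI) (simp add: coeff_subst mfps_coeff_add distrib_right)

lemma subst_const: "mfps_subst \<sigma> (mfps_const c) = mfps_const c"
  by (rule mfps_eqI) (simp add: coeff_subst mfps_coeff_const mfps_coeff_one)

lemma subst_mult: "mfps_subst \<sigma> (f * g) = mfps_subst \<sigma> f * mfps_subst \<sigma> g"
proof (rule mfps_eqI)
  fix N
  let ?P = "\<lambda>M. \<Prod>v\<in>#M. \<sigma> v"
  let ?t = "\<lambda>A C. mfps_coeff f C * mfps_coeff g (image_mset \<pi> N - C) *
              (mfps_coeff (?P C) A * mfps_coeff (?P (image_mset \<pi> N - C)) (N - A))"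
  have "mfps_coeff (mfps_subst \<sigma> f * mfps_subst \<sigma> g) N = (\<Sum>A | A \<subseteq># N. ?t A (image_mset \<pi> A))"
    unfolding mfps_coeff_mult coeff_subst
    by (intro sum.cong refl) (simp add: image_mset_Diff)
  also have "\<dots> = (\<Sum>A | A \<subseteq># N. \<Sum>C | C \<subseteq># image_mset \<pi> N. ?t A C)"
  proof (intro sum.cong refl)
    fix A assume "A \<in> {A. A \<subseteq># N}"
    then have A: "image_mset \<pi> A \<subseteq># image_mset \<pi> N" by (simp add: image_mset_subseteq_mono)
    have "(\<Sum>C | C \<subseteq># image_mset \<pi> N. ?t A C) = (\<Sum>C \<in> {image_mset \<pi> A}. ?t A C)"
    proof (rule sum.mono_neutral_right)
      have "mfps_coeff (?P C) A = 0" if "C \<noteq> image_mset \<pi> A" for C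
        using mfps_prod_nonzero[OF _ linear, of \<sigma> C A] that by blast
      then show "\<forall>C \<in> {C. C \<subseteq># image_mset \<pi> N} - {image_mset \<pi> A}. ?t A C = 0" by simp
    qed (use A in \<open>auto simp: finite_submsets\<close>)
    then show "?t A (image_mset \<pi> A) = (\<Sum>C | C \<subseteq># image_mset \<pi> N. ?t A C)" by simp
  qed
  also have "\<dots> = (\<Sum>C | C \<subseteq># image_mset \<pi> N. \<Sum>A | A \<subseteq># N. ?t A C)"
    by (rule sum.swap)
  also have "\<dots> = (\<Sum>C | C \<subseteq># image_mset \<pi> N. mfps_coeff f C * mfps_coeff g (image_mset \<pi> N - C) *
      mfps_coeff (?P (image_mset \<pi> N)) N)"
  proof (intro sum.cong refl)
    fix C assume "C \<in> {C. C \<subseteq># image_mset \<pi> N}"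
    then have C: "image_mset \<pi> N = C + (image_mset \<pi> N - C)" by simp
    have "?P (image_mset \<pi> N) = ?P C * ?P (image_mset \<pi> N - C)"
      by (subst C, simp only: image_mset_union prod_mset_Un)
    then show "(\<Sum>A | A \<subseteq># N. ?t A C) = mfps_coeff f C * mfps_coeff g (image_mset \<pi> N - C) *
      mfps_coeff (?P (image_mset \<pi> N)) N"
      by (simp add: mfps_coeff_mult sum_distrib_left)
  qed
  also have "\<dots> = mfps_coeff (mfps_subst \<sigma> (f * g)) N"
    by (simp add: coeff_subst mfps_coeff_mult sum_distrib_right)
  finally show "mfps_coeff (mfps_subst \<sigma> (f * g)) N = mfps_coeff (mfps_subst \<sigma> f * mfps_subst \<sigma> g) N" ..
qed

lemma comm_ring_hom_subst: "comm_ring_hom (mfps_subst \<sigma>)"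
proof
  show "mfps_subst \<sigma> 0 = 0" using subst_const[of 0] by simp
  show "mfps_subst \<sigma> 1 = 1" using subst_const[of 1] by simp
qed (simp_all add: subst_add subst_mult)

lemma subst_deriv:
  assumes "\<And>v. mfps_deriv u (\<sigma> v) = mfps_const (if v = \<pi> u then c else 0)"
  shows "mfps_deriv u (mfps_subst \<sigma> f) = mfps_const c * mfps_subst \<sigma> (mfps_deriv (\<pi> u) f)"
proof (rule mfps_eqI)
  fix N
  let ?P = "\<lambda>M. \<Prod>v\<in>#M. \<sigma> v"
  have P: "mfps_deriv u (?P M) = mfps_const (c * of_nat (count M (\<pi> u))) * ?P (M - {#\<pi> u#})" for M
  proof (induction M)
    case (add x M)
    show ?case
    proof (cases "x = \<pi> u")
      case True
      have "\<sigma> x * (mfps_const (c * of_nat (count M x)) * ?P (M - {#x#})) = mfps_const (c * of_nat (count M x)) * ?P M"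
        by (cases "x \<in># M") (auto simp: not_in_iff mult.left_commute dest!: multi_member_split)
      then show ?thesis using True add.IH
        by (simp add: mfps_deriv_mult assms mfps_const_add algebra_simps)
    qed (use add.IH assms in \<open>simp add: mfps_deriv_mult mult.left_commute\<close>)
  qed simp
  have "mfps_coeff (mfps_deriv u (mfps_subst \<sigma> f)) N =
      mfps_coeff f (add_mset (\<pi> u) (image_mset \<pi> N)) *
      mfps_coeff (mfps_deriv u (?P (add_mset (\<pi> u) (image_mset \<pi> N)))) N"
    by (simp add: mfps_coeff_deriv coeff_subst)
  then show "mfps_coeff (mfps_deriv u (mfps_subst \<sigma> f)) N =
      mfps_coeff (mfps_const c * mfps_subst \<sigma> (mfps_deriv (\<pi> u) f)) N"
    unfolding P by (simp add: coeff_subst mfps_coeff_deriv)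
qed

lemma coeff_subst_image:
  assumes "\<And>v. \<pi> (e v) = v"
  shows "mfps_coeff (mfps_subst \<sigma> f) (image_mset e M) = mfps_coeff f M * (\<Prod>v\<in>#M. mfps_coeff (\<sigma> v) {#e v#})"
proof -
  have "mfps_coeff (\<Prod>v\<in>#M. \<sigma> v) (image_mset e M) = (\<Prod>v\<in>#M. mfps_coeff (\<sigma> v) {#e v#})"
  proof (induction M)
    case (add x M)
    have "mfps_coeff (\<Prod>v\<in>#add_mset x M. \<sigma> v) (image_mset e (add_mset x M)) =
        (\<Sum>A | A \<subseteq># image_mset e (add_mset x M). mfps_coeff (\<sigma> x) A * mfps_coeff (\<Prod>v\<in>#M. \<sigma> v) (image_mset e (add_mset x M) - A))"
      by (simp add: mfps_coeff_mult)
    also have "\<dots> = (\<Sum>A \<in> {{#e x#}}. mfps_coeff (\<sigma> x) A * mfps_coeff (\<Prod>v\<in>#M. \<sigma> v) (image_mset e (add_mset x M) - A))"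
    proof (rule sum.mono_neutral_right)
      show "\<forall>A \<in> {A. A \<subseteq># image_mset e (add_mset x M)} - {{#e x#}}.
          mfps_coeff (\<sigma> x) A * mfps_coeff (\<Prod>v\<in>#M. \<sigma> v) (image_mset e (add_mset x M) - A) = 0"
      proof
        fix A assume A: "A \<in> {A. A \<subseteq># image_mset e (add_mset x M)} - {{#e x#}}"
        have "mfps_coeff (\<sigma> x) A = 0"
        proof (rule ccontr)
          assume "mfps_coeff (\<sigma> x) A \<noteq> 0"
          then obtain w where w: "A = {#w#}" "\<pi> w = x" using linear by blast
          with A obtain y where "w = e y" by auto
          with w assms A show False by auto
        qed
        then show "mfps_coeff (\<sigma> x) A * mfps_coeff (\<Prod>v\<in>#M. \<sigma> v) (image_mset e (add_mset x M) - A) = 0" by simp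
      qed
    qed (auto simp: finite_submsets)
    also have "\<dots> = (\<Prod>v\<in>#add_mset x M. mfps_coeff (\<sigma> v) {#e v#})"
      using add.IH by simp
    finally show ?case .
  qed (simp add: mfps_coeff_one)
  then show ?thesis by (simp add: coeff_subst image_mset.compositionality o_def assms)
qed

end

text \<open>A system of linear differential equations in the variables \<open>y\<^sub>i\<close> (\<open>Inr i\<close>) determines its solutions from
  their values at \<open>y = 0\<close>: a coefficient is obtained from one of a derivative, at a shorter monomial.\<close>

lemma coeff_zero_by_derivatives:
  fixes \<F> :: "('a + 'b) mfps set"
  assumes initial: "\<And>f T. f \<in> \<F> \<Longrightarrow> mfps_coeff f (image_mset Inl T) = 0"
    and deriv: "\<And>f i N. f \<in> \<F> \<Longrightarrow> (\<And>g. g \<in> \<F> \<Longrightarrow> mfps_coeff g N = 0) \<Longrightarrow> mfps_coeff (mfps_deriv (Inr i) f) N = 0"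
    and "f \<in> \<F>"
  shows "f = 0"
proof (rule mfps_eqI)
  fix N
  show "mfps_coeff f N = mfps_coeff 0 N" using \<open>f \<in> \<F>\<close>
  proof (induction N arbitrary: f rule: measure_induct_rule[of size])
    case (less N)
    show ?case
    proof (cases "\<exists>i. Inr i \<in># N")
      case True
      then obtain i N' where N: "N = add_mset (Inr i) N'" by (metis mset_add)
      have "mfps_coeff (mfps_deriv (Inr i) f) N' = 0"
        by (rule deriv[OF less.prems]) (use less.IH N in auto)
      moreover have "of_nat (count N' (Inr i) + 1) \<noteq> (0 :: complex)"
        by (simp only: of_nat_eq_0_iff)
      ultimately show ?thesis unfolding N mfps_coeff_deriv by simp
    next
      case False
      then have "\<forall>x\<in>#N. \<exists>a. x = Inl a" by (metis sum.exhaust)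
      then have "image_mset (Inl \<circ> projl) N = image_mset id N" by (metis (no_types, lifting) comp_apply id_apply image_mset_cong sum.sel(1))
      then have "N = image_mset Inl (image_mset projl N)" by (simp add: image_mset.compositionality)
      then show ?thesis using initial[OF less.prems] by (metis mfps_coeff_zero)
    qed
  qed
qed

section \<open>Coefficients of the Hirota operator\<close>

lemma mfps_coeff_Sum: "mfps_coeff (mfps_Sum F) M = Sum_any (\<lambda>i. mfps_coeff (F i) M)"
  by (simp add: mfps_Sum_def)

lemma mfps_deriv_Sum: "mfps_deriv v (mfps_Sum F) = mfps_Sum (\<lambda>i. mfps_deriv v (F i))"
proof (rule mfps_eqI)
  fix M
  have "of_nat (count M v + 1) \<noteq> (0 :: complex)"
    by (simp only: of_nat_eq_0_iff)
  then show "mfps_coeff (mfps_deriv v (mfps_Sum F)) M = mfps_coeff (mfps_Sum (\<lambda>i. mfps_deriv v (F i))) M"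
    by (simp add: mfps_coeff_deriv mfps_Sum_def Sum_any.expand_set sum_distrib_left)
qed

lemma mfps_Sum_single: "mfps_Sum (\<lambda>i. if i = a then F i else 0) = F a"
proof (rule mfps_eqI)
  fix M
  have "Sum_any (\<lambda>i. mfps_coeff (if i = a then F i else 0) M) = (\<Sum>i\<in>{a}. mfps_coeff (if i = a then F i else 0) M)"
    by (rule Sum_any.expand_superset) auto
  then show "mfps_coeff (mfps_Sum (\<lambda>i. if i = a then F i else 0)) M = mfps_coeff (F a) M"
    by (simp add: mfps_Sum_def)
qed

lemma mfps_coeff_var_power_mult:
  "mfps_coeff (mfps_var v ^ n * f) M = (if n \<le> count M v then mfps_coeff f (M - replicate_mset n v) else 0)"
proof (induction n arbitrary: M)
  case (Suc n)
  have "mfps_coeff (mfps_var v ^ Suc n * f) M = mfps_coeff (mfps_var v * (mfps_var v ^ n * f)) M"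
    by (simp add: mult.assoc)
  then show ?case unfolding mfps_coeff_var_mult Suc.IH
    by (auto simp flip: count_greater_zero_iff)
qed simp

lemma count_image_mset_inj: "inj f \<Longrightarrow> count (image_mset f M) (f x) = count M x"
  by (induction M) (auto dest: injD)

text \<open>By homogeneity a monomial occurs in only one of the polynomials \<open>h\<^sub>k\<close>, so their coefficients form a single family.\<close>

definition h_coeff :: "nat multiset \<Rightarrow> complex" where
  "h_coeff M = mfps_coeff (h_poly (sum_mset M)) M"

lemma coeff_h_poly: "mfps_coeff (h_poly k) M = (if sum_mset M = k then h_coeff M else 0)"
  using h_poly_nonzero(1) by (auto simp: h_coeff_def)

lemma h_gen_arg_const:
  "mfps_coeff (mfps_Sum (\<lambda>i. mfps_const (1 / of_nat (Suc i)) * mfps_var (Some (Suc i)) * mfps_var None ^ Suc i)) {#} = 0"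
  (is "?c = 0")
proof (rule ccontr)
  assume "?c \<noteq> 0"
  from h_gen_arg_nonzero[OF this] show False by simp
qed

lemma KP_exp_arg_const:
  "mfps_coeff (mfps_Sum (\<lambda>i. mfps_var (Inl (Suc i)) * mfps_var (Inr (Suc i)))) {#} = 0"
  (is "?c = 0")
proof (rule ccontr)
  assume "?c \<noteq> 0"
  from KP_exp_arg_nonzero[OF this] show False by simp
qed

lemma h_coeff_empty: "h_coeff {#} = 1"
proof -
  have "mfps_coeff h_gen {#} = 1"
    unfolding h_gen_def by (rule mfps_exp_const_coeff[OF h_gen_arg_const])
  then show ?thesis by (simp add: h_coeff_def h_poly_def)
qed

text \<open>Differentiating the generating function by \<open>t\<^sub>i\<close> multiplies it by \<open>z\<^sup>i / i\<close>.  For \<open>i = 0\<close> both sides vanish,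
  by the convention \<open>x / 0 = 0\<close>.\<close>

lemma h_coeff_add_mset: "of_nat (count M i + 1) * h_coeff (add_mset i M) = h_coeff M / of_nat i"
proof -
  let ?t = "\<lambda>j. mfps_const (1 / of_nat (Suc j)) * mfps_var (Some (Suc j)) * mfps_var None ^ Suc j :: nat option mfps"
  let ?K = "image_mset Some M + replicate_mset (i + sum_mset M) None"
  have z: "mfps_deriv (Some i) (mfps_var None ^ Suc n) = 0" for n :: nat
    by (simp only: mfps_deriv_power_Suc mfps_deriv_var) simp
  have "mfps_deriv (Some i) (?t j) = mfps_deriv (Some i) (mfps_const (1 / of_nat (Suc j)) * mfps_var (Some (Suc j))) * mfps_var None ^ Suc j" for j
    unfolding mfps_deriv_mult[of _ _ "mfps_var None ^ Suc j"] z by simp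
  then have t: "mfps_deriv (Some i) (?t j) = (if j = i - 1 then mfps_const (1 / of_nat i) * mfps_var None ^ i else 0)" for j
    unfolding mfps_deriv_const_mult mfps_deriv_var by (cases i) auto
  have "mfps_deriv (Some i) (mfps_Sum ?t) = mfps_const (1 / of_nat i) * mfps_var None ^ i"
    unfolding mfps_deriv_Sum t by (rule mfps_Sum_single)
  then have "mfps_deriv (Some i) h_gen = mfps_const (1 / of_nat i) * (mfps_var None ^ i * h_gen)"
    unfolding h_gen_def mfps_deriv_exp[OF h_gen_arg_const] by (simp only: mult.assoc)
  then have "mfps_coeff (mfps_deriv (Some i) h_gen) ?K = 1 / of_nat i * mfps_coeff (mfps_var None ^ i * h_gen) ?K"
    by simp
  moreover have "count ?K (Some i) = count M i"
    by (simp add: count_image_mset_inj)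
  moreover have "mfps_coeff (mfps_var None ^ i * h_gen) ?K = h_coeff M"
  proof -
    have "i \<le> count ?K None" by simp
    moreover have "?K - replicate_mset i None = image_mset Some M + replicate_mset (sum_mset M) None"
      by (simp add: multiset_eq_iff)
    ultimately show ?thesis unfolding mfps_coeff_var_power_mult by (simp add: h_coeff_def h_poly_def)
  qed
  ultimately show ?thesis
    by (simp add: mfps_coeff_deriv h_coeff_def h_poly_def)
qed

text \<open>The coefficient of the monomial \<open>D\<^sup>M\<close> in \<open>h\<^sub>k(D\<^sub>1, 2D\<^sub>2, \<dots>)\<close>, where \<open>k\<close> is the sum of \<open>M\<close>.\<close>

definition D_coeff :: "nat multiset \<Rightarrow> complex" where
  "D_coeff M = h_coeff M * of_nat (prod_mset M)"

lemma D_coeff_empty: "D_coeff {#} = 1"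
  by (simp add: D_coeff_def h_coeff_empty)

lemma D_coeff_add_mset: "of_nat i * (of_nat (count M i + 1) * D_coeff (add_mset i M)) = of_nat i * D_coeff M"
proof (cases "i = 0")
  case False
  have "of_nat (count M i + 1) * D_coeff (add_mset i M) = of_nat (count M i + 1) * h_coeff (add_mset i M) * (of_nat i * of_nat (prod_mset M))"
    by (simp add: D_coeff_def)
  also have "\<dots> = D_coeff M"
    unfolding h_coeff_add_mset using False by (simp add: D_coeff_def)
  finally show ?thesis by simp
qed simp

definition weight_msets :: "nat \<Rightarrow> nat multiset set" where
  "weight_msets k = {M. sum_mset M = k \<and> 0 \<notin># M}"

lemma finite_weight_msets: "finite (weight_msets k)"
proof (induction k rule: less_induct)
  case (less k)
  have "weight_msets k \<subseteq> insert {#} (\<Union>i\<in>{1..k}. add_mset i ` weight_msets (k - i))"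
  proof
    fix M assume M: "M \<in> weight_msets k"
    show "M \<in> insert {#} (\<Union>i\<in>{1..k}. add_mset i ` weight_msets (k - i))"
    proof (cases "M = {#}")
      case False
      then obtain i M' where "M = add_mset i M'" by (metis multiset_nonemptyE mset_add)
      with M have "i \<in> {1..k}" "M \<in> add_mset i ` weight_msets (k - i)" by (auto simp: weight_msets_def)
      then show ?thesis by blast
    qed simp
  qed
  moreover have "finite (insert {#} (\<Union>i\<in>{1..k}. add_mset i ` weight_msets (k - i)))"
    using less.IH by auto
  ultimately show ?case by (rule finite_subset)
qed

lemma D_coeff_nonzero: "D_coeff M \<noteq> 0 \<Longrightarrow> 0 \<notin># M"
  using h_poly_nonzero(2) unfolding D_coeff_def h_coeff_def by fastforce

text \<open>In a power of \<open>\<Sum> x\<^sub>i D\<^sub>i\<close> every \<open>x\<^sub>i\<close> occurs as often as \<open>D\<^sub>i\<close>.\<close>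

lemma KP_exp_support:
  assumes "mfps_coeff KP_exp (image_mset Inl N + image_mset Inr M) \<noteq> 0"
  shows "N = M \<and> 0 \<notin># M"
proof -
  let ?S = "{image_mset Inl A + image_mset Inr A | A. (0::nat) \<notin># A}"
  have "image_mset Inl N + image_mset Inr M \<in> ?S"
    using assms unfolding KP_exp_def
  proof (rule mfps_exp_support)
    fix K assume "mfps_coeff (mfps_Sum (\<lambda>i. mfps_var (Inl (Suc i)) * mfps_var (Inr (Suc i)))) K \<noteq> 0"
    then obtain i where "K = {#Inl (Suc i), Inr (Suc i)#}" using KP_exp_arg_nonzero by blast
    then show "K \<in> ?S" by (intro CollectI exI[of _ "{#Suc i#}"]) auto
  next
    show "{#} \<in> ?S" by (intro CollectI exI[of _ "{#}"]) auto
  next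
    fix A B assume "A \<in> ?S" "B \<in> ?S"
    then obtain A' B' where AB: "A = image_mset Inl A' + image_mset Inr A'" "0 \<notin># A'"
      "B = image_mset Inl B' + image_mset Inr B'" "0 \<notin># B'" by blast
    show "A + B \<in> ?S" by (intro CollectI exI[of _ "A' + B'"]) (use AB in auto)
  qed
  then obtain A where A: "image_mset Inl N + image_mset Inr M = image_mset Inl A + image_mset Inr A" "0 \<notin># A"
    by blast
  have "count N i = count A i \<and> count M i = count A i" for i
  proof -
    have "count (image_mset Inr X) (Inl i) = 0" "count (image_mset Inl X) (Inr i) = 0" for X :: "nat multiset"
      by (auto simp: not_in_iff[symmetric])
    then show ?thesis
      using arg_cong[OF A(1), of "\<lambda>K. (count K (Inl i), count K (Inr i))"]
      by (simp add: count_image_mset_inj)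
  qed
  then have "N = A" "M = A" by (auto intro: multiset_eqI)
  with A(2) show ?thesis by simp
qed

abbreviation mfps_derivs :: "('v \<Rightarrow> 'w) \<Rightarrow> 'v multiset \<Rightarrow> 'w mfps \<Rightarrow> 'w mfps" where
  "mfps_derivs e M f \<equiv> fold_mset (\<lambda>k. mfps_deriv (e k)) f M"

lemma mfps_derivs_deriv: "mfps_derivs e M (mfps_deriv (e i) f) = mfps_deriv (e i) (mfps_derivs e M f)"
  using mfps_deriv.fold_mset_fun_left_comm[of e i f M] by simp

text \<open>Taylor's formula: \<open>exp(\<Sum> x\<^sub>i \<partial>/\<partial>y\<^sub>i)\<close> followed by \<open>y = 0\<close> is the substitution of \<open>x\<close> for \<open>y\<close>.\<close>

lemma KP_exp_taylor:
  fixes g :: "(nat + nat) mfps"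
  assumes "0 \<notin># N"
  shows "mfps_coeff KP_exp (image_mset Inl N + image_mset Inr N) * mfps_coeff (mfps_derivs Inr N g) (image_mset Inl T) =
    mfps_coeff g (image_mset Inl T + image_mset Inr N)"
  using assms
proof (induction N arbitrary: g)
  case empty
  have "mfps_coeff KP_exp {#} = 1"
    unfolding KP_exp_def by (rule mfps_exp_const_coeff[OF KP_exp_arg_const])
  then show ?case by simp
next
  case (add i N)
  let ?c = "of_nat (count N i + 1) :: complex"
  let ?K = "\<lambda>N. image_mset Inl N + image_mset Inr N :: (nat + nat) multiset"
  have c: "?c \<noteq> 0" by (simp only: of_nat_eq_0_iff)
  have cnt: "count (image_mset Inl X) (Inr i) = 0" "count (image_mset Inr N) (Inr i) = count N i" for X :: "nat multiset"
    by (auto simp: count_image_mset_inj not_in_iff[symmetric])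
  let ?t = "\<lambda>j. mfps_var (Inl (Suc j)) * mfps_var (Inr (Suc j)) :: (nat + nat) mfps"
  have "mfps_deriv (Inr i) (?t j) = (if j = i - 1 then mfps_var (Inl i) else 0)" for j
    using add.prems by (cases i) (auto simp: mfps_deriv_mult mfps_deriv_var)
  then have "mfps_deriv (Inr i) (mfps_Sum ?t) = mfps_var (Inl i)"
    unfolding mfps_deriv_Sum by (simp only: mfps_Sum_single)
  then have "mfps_deriv (Inr i) KP_exp = mfps_var (Inl i) * KP_exp"
    unfolding KP_exp_def mfps_deriv_exp[OF KP_exp_arg_const] by (simp only:)
  from arg_cong[OF this, of "\<lambda>f. mfps_coeff f (add_mset (Inl i) (?K N))"]
  have "?c * mfps_coeff KP_exp (?K (add_mset i N)) = mfps_coeff KP_exp (?K N)"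
    by (simp add: mfps_coeff_deriv mfps_coeff_var_mult add_mset_commute cnt)
  moreover have "mfps_coeff (mfps_deriv (Inr i) g) (image_mset Inl T + image_mset Inr N) =
      ?c * mfps_coeff g (image_mset Inl T + image_mset Inr (add_mset i N))"
    by (simp add: mfps_coeff_deriv cnt)
  moreover have "mfps_coeff KP_exp (?K N) * mfps_coeff (mfps_derivs Inr N (mfps_deriv (Inr i) g)) (image_mset Inl T) =
      mfps_coeff (mfps_deriv (Inr i) g) (image_mset Inl T + image_mset Inr N)"
    using add by simp
  moreover have "mfps_derivs Inr (add_mset i N) g = mfps_derivs Inr N (mfps_deriv (Inr i) g)"
    by (simp add: mfps_derivs_deriv)
  ultimately have "?c * (mfps_coeff KP_exp (?K (add_mset i N)) * mfps_coeff (mfps_derivs Inr (add_mset i N) g) (image_mset Inl T)) =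
      ?c * mfps_coeff g (image_mset Inl T + image_mset Inr (add_mset i N))"
    by (metis mult.assoc)
  then show ?case using c by simp
qed

text \<open>Separation of variables: a factor in the variables of \<open>range e\<close> takes up only the corresponding part of a monomial.\<close>

lemma coeff_mult_supported:
  assumes "inj e" and "set_mset R \<inter> range e = {}"
    and f: "\<And>A. mfps_coeff f A \<noteq> 0 \<Longrightarrow> set_mset A \<subseteq> range e"
  shows "mfps_coeff (f * g) (image_mset e N + R) =
    (\<Sum>A | A \<subseteq># N. mfps_coeff f (image_mset e A) * mfps_coeff g (image_mset e (N - A) + R))"
proof -
  have "mfps_coeff (f * g) (image_mset e N + R) =
      (\<Sum>A \<in> image_mset e ` {A. A \<subseteq># N}. mfps_coeff f A * mfps_coeff g (image_mset e N + R - A))"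
    unfolding mfps_coeff_mult
  proof (rule sum.mono_neutral_right)
    show "finite {A. A \<subseteq># image_mset e N + R}" by (rule finite_submsets)
    show "image_mset e ` {A. A \<subseteq># N} \<subseteq> {A. A \<subseteq># image_mset e N + R}"
      by (auto intro: subset_mset.add_increasing2 image_mset_subseteq_mono)
    show "\<forall>A \<in> {A. A \<subseteq># image_mset e N + R} - image_mset e ` {A. A \<subseteq># N}.
        mfps_coeff f A * mfps_coeff g (image_mset e N + R - A) = 0"
    proof (rule ballI, rule ccontr)
      fix A assume A: "A \<in> {A. A \<subseteq># image_mset e N + R} - image_mset e ` {A. A \<subseteq># N}"
        and "mfps_coeff f A * mfps_coeff g (image_mset e N + R - A) \<noteq> 0"
      then have sub: "set_mset A \<subseteq> range e" using f by auto
      let ?B = "image_mset (inv_into UNIV e) A"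
      have "image_mset (e \<circ> inv_into UNIV e) A = image_mset id A"
        by (rule image_mset_cong) (use sub in \<open>auto simp: f_inv_into_f\<close>)
      then have B: "A = image_mset e ?B" by (simp add: image_mset.compositionality)
      have "?B \<subseteq># N"
      proof (rule mset_subset_eqI)
        fix x
        have "count A (e x) \<le> count (image_mset e N + R) (e x)"
          using A mset_subset_eq_count[of A "image_mset e N + R"] by blast
        moreover have "count R (e x) = 0" using assms(2) by (auto simp: not_in_iff[symmetric])
        ultimately show "count ?B x \<le> count N x"
          using arg_cong[OF B, of "\<lambda>K. count K (e x)"] by (simp add: count_image_mset_inj[OF \<open>inj e\<close>])
      qed
      with A B show False by blast
    qed
  qed
  also have "\<dots> = (\<Sum>A | A \<subseteq># N. mfps_coeff f (image_mset e A) * mfps_coeff g (image_mset e N + R - image_mset e A))"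
    by (subst sum.reindex[OF inj_on_subset[OF multiset.inj_map[OF \<open>inj e\<close>] subset_UNIV]]) (simp only: o_def)
  also have "\<dots> = (\<Sum>A | A \<subseteq># N. mfps_coeff f (image_mset e A) * mfps_coeff g (image_mset e (N - A) + R))"
  proof (intro sum.cong refl)
    fix A assume "A \<in> {A. A \<subseteq># N}"
    then have "image_mset e N = image_mset e (N - A) + image_mset e A"
      by (simp flip: image_mset_union)
    then have "image_mset e N + R - image_mset e A = image_mset e (N - A) + R"
      by (metis add.assoc add.commute add_diff_cancel_right')
    then show "mfps_coeff f (image_mset e A) * mfps_coeff g (image_mset e N + R - image_mset e A) =
        mfps_coeff f (image_mset e A) * mfps_coeff g (image_mset e (N - A) + R)" by simp
  qed
  finally show ?thesis .
qed

lemma linear_subst_scaled: "linear_subst (\<lambda>v. mfps_const (c v) * mfps_var (e v)) \<pi>" if "\<And>v. \<pi> (e v) = v"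
  by unfold_locales (use that in \<open>auto simp: mfps_var_def split: if_splits\<close>)

lemma coeff_subst_scaled:
  assumes "inj e"
  shows "mfps_coeff (mfps_subst (\<lambda>v. mfps_const (c v) * mfps_var (e v)) f) (image_mset e M) = mfps_coeff f M * (\<Prod>v\<in>#M. c v)"
proof -
  interpret linear_subst "\<lambda>v. mfps_const (c v) * mfps_var (e v)" "inv_into UNIV e"
    by (rule linear_subst_scaled) (simp add: assms)
  show ?thesis using coeff_subst_image[of e f M] assms by (simp add: mfps_var_def)
qed

lemma subst_scaled_support:
  assumes "mfps_coeff (mfps_subst (\<lambda>v. mfps_const (c v) * mfps_var (e v)) f) A \<noteq> 0"
  shows "set_mset A \<subseteq> range e"
  by (rule mfps_subst_scaled_nonzero[OF assms]) auto

lemma coeff_KP_operator: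
  "mfps_coeff KP_operator (image_mset Inl N + image_mset Inr M) =
    (\<Sum>k\<le>sum_mset N. \<Sum>A | A \<subseteq># N. \<Sum>B | B \<subseteq># M.
      ((- 2) ^ size A * mfps_coeff (h_poly k) A) * ((if B \<in> weight_msets (Suc k) then D_coeff B else 0) *
       mfps_coeff KP_exp (image_mset Inl (N - A) + image_mset Inr (M - B))))"
proof -
  let ?x = "\<lambda>k. mfps_subst (\<lambda>i. mfps_const (- 2) * mfps_var (Inl i)) (h_poly k) :: (nat + nat) mfps"
  let ?D = "\<lambda>k. mfps_subst (\<lambda>i. mfps_const (of_nat i) * mfps_var (Inr i)) (h_poly (k + 1)) :: (nat + nat) mfps"
  let ?K = "image_mset Inl N + image_mset Inr M :: (nat + nat) multiset"
  have x: "mfps_coeff (?x k) (image_mset Inl A) = (- 2) ^ size A * mfps_coeff (h_poly k) A" for k A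
    using coeff_subst_scaled[of Inl "\<lambda>_. -2" "h_poly k" A] by (simp add: image_mset_const_eq mult.commute)
  have D: "mfps_coeff (?D k) (image_mset Inr B) = (if B \<in> weight_msets (Suc k) then D_coeff B else 0)" for k B
  proof -
    have "(\<Prod>i\<in>#B. of_nat i :: complex) = of_nat (prod_mset B)" by (induction B) auto
    then show ?thesis
      using coeff_subst_scaled[of Inr of_nat "h_poly (k + 1)" B] D_coeff_nonzero[of B]
      by (auto simp: coeff_h_poly D_coeff_def weight_msets_def)
  qed
  have "mfps_coeff (?x k * (?D k * KP_exp)) ?K =
      (\<Sum>A | A \<subseteq># N. \<Sum>B | B \<subseteq># M. ((- 2) ^ size A * mfps_coeff (h_poly k) A) *
       ((if B \<in> weight_msets (Suc k) then D_coeff B else 0) *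
        mfps_coeff KP_exp (image_mset Inl (N - A) + image_mset Inr (M - B))))" for k
  proof -
    have "mfps_coeff (?x k * (?D k * KP_exp)) ?K = (\<Sum>A | A \<subseteq># N. mfps_coeff (?x k) (image_mset Inl A) *
        mfps_coeff (?D k * KP_exp) (image_mset Inl (N - A) + image_mset Inr M))"
      by (rule coeff_mult_supported[OF _ _ subst_scaled_support]) auto
    also have "\<dots> = (\<Sum>A | A \<subseteq># N. mfps_coeff (?x k) (image_mset Inl A) *
        (\<Sum>B | B \<subseteq># M. mfps_coeff (?D k) (image_mset Inr B) *
          mfps_coeff KP_exp (image_mset Inr (M - B) + image_mset Inl (N - A))))"
      by (intro sum.cong refl arg_cong2[of _ _ _ _ "(*)"], subst add.commute, rule coeff_mult_supported[OF _ _ subst_scaled_support]) auto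
    finally show ?thesis unfolding x D by (simp add: sum_distrib_left add.commute)
  qed
  moreover have "mfps_coeff KP_operator ?K = (\<Sum>k\<le>sum_mset N. mfps_coeff (?x k * (?D k * KP_exp)) ?K)"
  proof -
    have "x_weight ?K = sum_mset N"
      by (simp add: x_weight_def image_mset.compositionality o_def)
    then have "{k. mfps_coeff (?x k * ?D k * KP_exp) ?K \<noteq> 0} \<subseteq> {..sum_mset N}"
      using KP_term_nonzero by fastforce
    then have "Sum_any (\<lambda>k. mfps_coeff (?x k * ?D k * KP_exp) ?K) = (\<Sum>k\<le>sum_mset N. mfps_coeff (?x k * ?D k * KP_exp) ?K)"
      by (intro Sum_any.expand_superset) auto
    then show ?thesis
      unfolding KP_operator_def KP_exp_def[symmetric] mfps_coeff_Sum by (simp only: mult.assoc)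
  qed
  ultimately show ?thesis by simp
qed

section \<open>The Hirota equations as a generating function identity\<close>

text \<open>
  The operator \<open>h\<^sub>k(\<partial>\<^sub>1, 2\<partial>\<^sub>2, \<dots>)\<close> in the variables \<open>y\<close>.  Summed against \<open>w\<^sup>k\<close> these operators form the translation
  \<open>y\<^sub>i \<mapsto> y\<^sub>i + w\<^sup>i\<close>, so they are jointly multiplicative; the Newton recursion below characterises them.
\<close>

definition translation_coeff :: "nat \<Rightarrow> (nat + nat) mfps \<Rightarrow> (nat + nat) mfps" where
  "translation_coeff k f = (\<Sum>M\<in>weight_msets k. mfps_const (D_coeff M) * mfps_derivs Inr M f)"

lemma weight_msets_0: "weight_msets 0 = {{#}}"
proof -
  have "M = {#}" if "sum_mset M = 0" "0 \<notin># M" for M :: "nat multiset"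
    using that by (cases M) auto
  then show ?thesis by (auto simp: weight_msets_def)
qed

lemma translation_coeff_0 [simp]: "translation_coeff 0 f = f"
  by (simp add: translation_coeff_def weight_msets_0 D_coeff_empty)

lemma sum_count_mult:
  assumes "finite A" "set_mset M \<subseteq> A"
  shows "(\<Sum>i\<in>A. i * count M i) = sum_mset (M :: nat multiset)"
  using assms(2)
proof (induction M)
  case (add x M)
  have "(\<Sum>i\<in>A. i * count (add_mset x M) i) = (\<Sum>i\<in>A. i * count M i + (if i = x then i else 0))"
    by (intro sum.cong) auto
  then show ?case using add assms(1) by (simp add: sum.distrib)
qed simp

text \<open>Newton's identity \<open>k h\<^sub>k = \<Sum>\<^sub>i p\<^sub>i h\<^sub>k\<^sub>-\<^sub>i\<close> for the power sums \<open>p\<^sub>i = i \<partial>\<^sub>i\<close>.\<close>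

lemma translation_coeff_newton:
  "of_nat k * translation_coeff k f = (\<Sum>i=1..k. of_nat i * mfps_deriv (Inr i) (translation_coeff (k - i) f))"
proof -
  let ?c = "\<lambda>i M. of_nat i * (of_nat (count M i) * D_coeff M)"
  have c: "?c i (add_mset i M) = of_nat i * D_coeff M" for i M
    using D_coeff_add_mset[of i M] by (simp only: count_add_mset if_True simp_thms Suc_eq_plus1)
  have "(\<Sum>i=1..k. of_nat i * mfps_deriv (Inr i) (translation_coeff (k - i) f)) =
      (\<Sum>i=1..k. \<Sum>M\<in>weight_msets (k - i). mfps_const (?c i (add_mset i M)) * mfps_derivs Inr (add_mset i M) f)"
    unfolding translation_coeff_def mfps_deriv_sum mfps_deriv_const_mult sum_distrib_left mfps_const_of_nat[symmetric] c
    by (simp add: mfps_const_mult mult.assoc)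
  also have "\<dots> = (\<Sum>i=1..k. \<Sum>M\<in>weight_msets k. mfps_const (?c i M) * mfps_derivs Inr M f)"
  proof (rule sum.cong[OF refl])
    fix i assume i: "i \<in> {1..k}"
    have "(\<Sum>M\<in>weight_msets k. mfps_const (?c i M) * mfps_derivs Inr M f) =
        (\<Sum>M\<in>{M \<in> weight_msets k. i \<in># M}. mfps_const (?c i M) * mfps_derivs Inr M f)"
      by (rule sum.mono_neutral_right) (auto simp: finite_weight_msets not_in_iff)
    also have "\<dots> = (\<Sum>M\<in>weight_msets (k - i). mfps_const (?c i (add_mset i M)) * mfps_derivs Inr (add_mset i M) f)"
      by (rule sum.reindex_bij_witness[where i = "add_mset i" and j = "\<lambda>M. M - {#i#}"])
         (use i in \<open>auto simp: weight_msets_def dest!: multi_member_split\<close>)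
    finally show "(\<Sum>M\<in>weight_msets (k - i). mfps_const (?c i (add_mset i M)) * mfps_derivs Inr (add_mset i M) f) =
        (\<Sum>M\<in>weight_msets k. mfps_const (?c i M) * mfps_derivs Inr M f)" ..
  qed
  also have "\<dots> = (\<Sum>M\<in>weight_msets k. (\<Sum>i=1..k. mfps_const (?c i M)) * mfps_derivs Inr M f)"
    by (subst sum.swap) (simp only: sum_distrib_right)
  also have "\<dots> = (\<Sum>M\<in>weight_msets k. mfps_const (of_nat k * D_coeff M) * mfps_derivs Inr M f)"
  proof (intro sum.cong refl arg_cong2[of _ _ _ _ "(*)"])
    fix M assume M: "M \<in> weight_msets k"
    have sub: "set_mset M \<subseteq> {1..k}"
    proof
      fix x assume "x \<in># M"
      then obtain M' where "M = add_mset x M'" by (rule mset_add)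
      with M show "x \<in> {1..k}" by (auto simp: weight_msets_def)
    qed
    have "(\<Sum>i=1..k. mfps_const (?c i M)) = of_nat (\<Sum>i=1..k. i * count M i) * mfps_const (D_coeff M)"
      by (simp add: sum_distrib_right mfps_const_mult mfps_const_of_nat mult.assoc)
    also have "(\<Sum>i=1..k. i * count M i) = k"
      using sum_count_mult[OF _ sub] M by (simp add: weight_msets_def)
    finally show "(\<Sum>i=1..k. mfps_const (?c i M)) = mfps_const (of_nat k * D_coeff M)"
      by (simp add: mfps_const_mult mfps_const_of_nat)
  qed
  also have "\<dots> = of_nat k * translation_coeff k f"
    by (simp add: translation_coeff_def sum_distrib_left mfps_const_mult mfps_const_of_nat mult.assoc)
  finally show ?thesis ..
qed

lemma translation_coeff_unique:
  assumes "g 0 = f"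
    and "\<And>k. of_nat k * g k = (\<Sum>i=1..k. of_nat i * mfps_deriv (Inr i) (g (k - i)))"
  shows "translation_coeff k f = g k"
proof (induction k rule: less_induct)
  case (less k)
  show ?case
  proof (cases "k = 0")
    case False
    have "of_nat k * translation_coeff k f = (\<Sum>i=1..k. of_nat i * mfps_deriv (Inr i) (g (k - i)))"
      unfolding translation_coeff_newton by (intro sum.cong refl) (use less.IH in auto)
    with assms(2)[of k] have "of_nat k * translation_coeff k f = of_nat k * g k" by simp
    then show ?thesis by (rule mfps_of_nat_mult_cancel) (use False in simp)
  qed (simp add: assms(1))
qed

lemma translation_coeff_mult:
  "translation_coeff k (f * g) = (\<Sum>a\<le>k. translation_coeff a f * translation_coeff (k - a) g)"
proof (rule translation_coeff_unique)
  fix k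
  let ?f = "\<lambda>k. translation_coeff k f" and ?g = "\<lambda>k. translation_coeff k g"
  let ?d = "\<lambda>i. mfps_deriv (Inr i)"
  have "of_nat k * (\<Sum>a\<le>k. ?f a * ?g (k - a)) =
      (\<Sum>a\<le>k. (of_nat a * ?f a) * ?g (k - a)) + (\<Sum>a\<le>k. ?f a * (of_nat (k - a) * ?g (k - a)))"
    unfolding sum_distrib_left sum.distrib[symmetric]
  proof (intro sum.cong refl)
    fix a assume "a \<in> {..k}"
    then have "of_nat k = (of_nat a + of_nat (k - a) :: (nat + nat) mfps)" by (simp flip: of_nat_add)
    then show "of_nat k * (?f a * ?g (k - a)) = (of_nat a * ?f a) * ?g (k - a) + ?f a * (of_nat (k - a) * ?g (k - a))"
      by (simp only: algebra_simps)
  qed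
  also have "(\<Sum>a\<le>k. (of_nat a * ?f a) * ?g (k - a)) = (\<Sum>a\<le>k. \<Sum>i=1..a. of_nat i * ?d i (?f (a - i)) * ?g (k - a))"
    unfolding translation_coeff_newton by (simp only: sum_distrib_right)
  also have "\<dots> = (\<Sum>i=1..k. \<Sum>a\<le>k - i. of_nat i * ?d i (?f a) * ?g (k - i - a))"
    unfolding sum.Sigma[OF finite_atMost ballI[OF finite_atLeastAtMost]] sum.Sigma[OF finite_atLeastAtMost ballI[OF finite_atMost]]
    by (rule sum.reindex_bij_witness[where i = "\<lambda>(i, a). (a + i, i)" and j = "\<lambda>(a, i). (i, a - i)"]) auto
  also have "(\<Sum>a\<le>k. ?f a * (of_nat (k - a) * ?g (k - a))) = (\<Sum>a\<le>k. \<Sum>i=1..k - a. of_nat i * (?f a * ?d i (?g (k - a - i))))"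
    unfolding translation_coeff_newton by (simp only: sum_distrib_left mult.left_commute)
  also have "\<dots> = (\<Sum>i=1..k. \<Sum>a\<le>k - i. of_nat i * (?f a * ?d i (?g (k - i - a))))"
    unfolding sum.Sigma[OF finite_atMost ballI[OF finite_atLeastAtMost]] sum.Sigma[OF finite_atLeastAtMost ballI[OF finite_atMost]]
    by (rule sum.reindex_bij_witness[where i = "\<lambda>(i, a). (a, i)" and j = "\<lambda>(a, i). (i, a)"]) (auto simp: add.commute)
  finally show "of_nat k * (\<Sum>a\<le>k. ?f a * ?g (k - a)) = (\<Sum>i=1..k. of_nat i * ?d i (\<Sum>a\<le>k - i. ?f a * ?g (k - i - a)))"
    by (simp add: mfps_deriv_sum mfps_deriv_mult sum_distrib_left sum.distrib distrib_left mult.assoc)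
qed simp

definition translation :: "(nat + nat) mfps \<Rightarrow> (nat + nat) mfps fps" where
  "translation f = Abs_fps (\<lambda>k. translation_coeff k f)"

lemma comm_ring_hom_translation: "comm_ring_hom translation"
proof
  show "translation (f + g) = translation f + translation g" for f g
    by (rule fps_ext) (simp add: translation_def, rule translation_coeff_unique,
      simp_all add: mfps_deriv_add distrib_left sum.distrib translation_coeff_newton)
  show "translation 0 = 0"
    by (rule fps_ext) (simp add: translation_def, rule translation_coeff_unique, simp_all)
  have "translation_coeff k 1 = (if k = 0 then 1 else 0)" for k
    by (rule translation_coeff_unique[of "\<lambda>k. if k = 0 then 1 else 0"]) (auto intro!: sum.neutral simp: if_distrib[of "mfps_deriv _"])
  then show "translation 1 = 1"
    by (auto intro!: fps_ext simp: translation_def)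
  show "translation (f * g) = translation f * translation g" for f g
    by (rule fps_ext) (simp add: translation_def translation_coeff_mult fps_mult_nth atMost_atLeast0)
qed

text \<open>The series \<open>\<Sum>\<^sub>k h\<^sub>k(-2y) g\<^sub>k\<close>, in which \<open>y\<close> plays the role of the auxiliary variables \<open>x\<close> of the Hirota equations.\<close>

definition h_minus_2y :: "nat \<Rightarrow> (nat + nat) mfps" where
  "h_minus_2y k = mfps_subst (\<lambda>i. mfps_const (- 2) * mfps_var (Inr i)) (h_poly k)"

definition bracket :: "(nat \<Rightarrow> (nat + nat) mfps) \<Rightarrow> (nat + nat) mfps" where
  "bracket g = mfps_Sum (\<lambda>k. h_minus_2y k * g k)"

lemma coeff_h_minus_2y: "mfps_coeff (h_minus_2y k) (image_mset Inr M) = (- 2) ^ size M * mfps_coeff (h_poly k) M"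
  unfolding h_minus_2y_def using coeff_subst_scaled[of Inr "\<lambda>_. -2" "h_poly k" M]
  by (simp add: image_mset_const_eq mult.commute)

lemma h_minus_2y_mult_nonzero:
  assumes "mfps_coeff (h_minus_2y k * g) N \<noteq> 0"
  shows "k \<le> D_weight N"
proof -
  obtain A B where N: "N = A + B" and A: "mfps_coeff (h_minus_2y k) A \<noteq> 0"
    using assms by (rule mfps_mult_nonzero)
  from A obtain M where "A = image_mset Inr M" "mfps_coeff (h_poly k) M \<noteq> 0"
    unfolding h_minus_2y_def by (rule mfps_subst_scaled_nonzero)
  then have "D_weight A = k"
    using h_poly_nonzero(1) by (simp add: D_weight_def image_mset.compositionality o_def)
  then show ?thesis by (simp add: N D_weight_def)
qed

lemma coeff_bracket:
  assumes "D_weight N \<le> K"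
  shows "mfps_coeff (bracket g) N = mfps_coeff (\<Sum>k\<le>K. h_minus_2y k * g k) N"
proof -
  have "Sum_any (\<lambda>k. mfps_coeff (h_minus_2y k * g k) N) = (\<Sum>k\<le>K. mfps_coeff (h_minus_2y k * g k) N)"
    by (rule Sum_any.expand_superset) (use h_minus_2y_mult_nonzero assms in \<open>auto intro: order_trans\<close>)
  then show ?thesis by (simp add: bracket_def mfps_coeff_Sum mfps_coeff_sum)
qed

lemma bracket_add: "bracket (\<lambda>k. f k + g k) = bracket f + bracket g"
  by (rule mfps_eqI) (simp add: coeff_bracket[OF order_refl] mfps_coeff_add distrib_left sum.distrib)

lemma bracket_uminus: "bracket (\<lambda>k. - f k) = - bracket f"
  by (rule mfps_eqI) (simp add: coeff_bracket[OF order_refl] mfps_coeff_uminus mfps_coeff_sum sum_negf)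

lemma bracket_diff: "bracket (\<lambda>k. f k - g k) = bracket f - bracket g"
  using bracket_add[of f "\<lambda>k. - g k"] by (simp add: bracket_uminus)

lemma bracket_mult: "bracket (\<lambda>k. c * g k) = c * bracket g"
proof (rule mfps_eqI)
  fix N :: "(nat + nat) multiset"
  let ?S = "\<Sum>k\<le>D_weight N. h_minus_2y k * g k"
  have "mfps_coeff (c * bracket g) N = mfps_coeff (c * ?S) N"
    unfolding mfps_coeff_mult
  proof (intro sum.cong refl arg_cong2[of _ _ _ _ "(*)"] coeff_bracket)
    fix A assume "A \<in> {A. A \<subseteq># N}"
    then have "N = A + (N - A)" by simp
    then have "D_weight N = D_weight A + D_weight (N - A)" unfolding D_weight_def
      by (metis image_mset_union sum_mset.union)
    then show "D_weight (N - A) \<le> D_weight N" by simp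
  qed
  also have "c * ?S = (\<Sum>k\<le>D_weight N. h_minus_2y k * (c * g k))"
    by (simp add: sum_distrib_left mult.left_commute)
  finally show "mfps_coeff (bracket (\<lambda>k. c * g k)) N = mfps_coeff (c * bracket g) N"
    by (simp add: coeff_bracket[OF order_refl])
qed

lemma bracket_0: "bracket (\<lambda>k. 0) = 0"
  using bracket_mult[of 0] by simp

lemma bracket_sum: "bracket (\<lambda>k. \<Sum>x\<in>A. g x k) = (\<Sum>x\<in>A. bracket (g x))"
  by (induction A rule: infinite_finite_induct) (auto simp: bracket_add bracket_0)

lemma h_poly_0: "h_poly 0 = 1"
proof (rule mfps_eqI)
  fix M
  have "M = {#}" if "sum_mset M = 0" "h_coeff M \<noteq> 0"
  proof -
    have "0 \<notin># M" using that(2) h_poly_nonzero(2) unfolding h_coeff_def by blast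
    with that(1) show ?thesis by (cases M) auto
  qed
  then show "mfps_coeff (h_poly 0) M = mfps_coeff 1 M"
    by (auto simp: coeff_h_poly mfps_coeff_one h_coeff_empty)
qed

lemma mfps_deriv_h_poly:
  "mfps_deriv i (h_poly k) = (if i \<le> k then mfps_const (1 / of_nat i) * h_poly (k - i) else 0)"
proof (rule mfps_eqI)
  fix M
  show "mfps_coeff (mfps_deriv i (h_poly k)) M = mfps_coeff (if i \<le> k then mfps_const (1 / of_nat i) * h_poly (k - i) else 0) M"
    using h_coeff_add_mset[of M i] by (auto simp: mfps_coeff_deriv coeff_h_poly)
qed

lemma linear_subst_h_minus_2y:
  "linear_subst (\<lambda>i. mfps_const (- 2) * mfps_var (Inr i) :: (nat + nat) mfps) (case_sum id id)"
  by (rule linear_subst_scaled) simp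

lemma h_minus_2y_0: "h_minus_2y 0 = 1"
  using linear_subst.subst_const[OF linear_subst_h_minus_2y, of 1] by (simp add: h_minus_2y_def h_poly_0)

lemma mfps_deriv_h_minus_2y:
  "mfps_deriv (Inr i) (h_minus_2y k) = (if i \<le> k then mfps_const (- 2 / of_nat i) * h_minus_2y (k - i) else 0)"
proof -
  have "mfps_deriv (Inr i) (h_minus_2y k) = mfps_const (- 2) *
      mfps_subst (\<lambda>i. mfps_const (- 2) * mfps_var (Inr i)) (mfps_deriv i (h_poly k))"
    unfolding h_minus_2y_def
    by (subst linear_subst.subst_deriv[OF linear_subst_h_minus_2y]) (auto simp: mfps_deriv_const_mult mfps_deriv_var)
  also have "\<dots> = (if i \<le> k then mfps_const (- 2) * (mfps_const (1 / of_nat i) * h_minus_2y (k - i)) else 0)"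
    using linear_subst.subst_const[OF linear_subst_h_minus_2y, of 0]
    by (simp add: mfps_deriv_h_poly h_minus_2y_def linear_subst.subst_mult[OF linear_subst_h_minus_2y]
        linear_subst.subst_const[OF linear_subst_h_minus_2y])
  also have "mfps_const (- 2) * (mfps_const (1 / of_nat i) * h_minus_2y (k - i)) = mfps_const (- 2 / of_nat i) * h_minus_2y (k - i)"
    by (simp flip: mult.assoc mfps_const_mult)
  finally show ?thesis .
qed

text \<open>The generating function of the \<open>h\<^sub>k(-2y)\<close> is \<open>exp(-2 \<Sum>\<^sub>i y\<^sub>i z\<^sup>i / i)\<close>, so that its derivative by \<open>y\<^sub>i\<close> moves the index
  by \<open>i\<close> and contributes the factor \<open>-2 / i\<close>.\<close>

lemma mfps_deriv_bracket:
  "mfps_deriv (Inr i) (bracket g) = bracket (\<lambda>k. mfps_deriv (Inr i) (g k)) - mfps_const (2 / of_nat i) * bracket (\<lambda>k. g (k + i))"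
proof (rule mfps_eqI)
  fix N :: "(nat + nat) multiset"
  let ?n = "D_weight N" and ?H = h_minus_2y
  have b: "mfps_coeff (bracket (\<lambda>k. mfps_deriv (Inr i) (g k))) N =
      mfps_coeff (\<Sum>k\<le>?n + i. ?H k * mfps_deriv (Inr i) (g k)) N"
    by (rule coeff_bracket) simp
  have "mfps_coeff (mfps_deriv (Inr i) (bracket g)) N = mfps_coeff (mfps_deriv (Inr i) (\<Sum>k\<le>?n + i. ?H k * g k)) N"
    unfolding mfps_coeff_deriv by (subst coeff_bracket[of _ "?n + i"]) (simp_all add: D_weight_def)
  also have "mfps_deriv (Inr i) (\<Sum>k\<le>?n + i. ?H k * g k) =
      (\<Sum>k\<le>?n + i. ?H k * mfps_deriv (Inr i) (g k)) + (\<Sum>k\<le>?n + i. mfps_deriv (Inr i) (?H k) * g k)"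
    by (simp add: mfps_deriv_sum mfps_deriv_mult sum.distrib)
  also have "(\<Sum>k\<le>?n + i. mfps_deriv (Inr i) (?H k) * g k) = (\<Sum>k=i..?n + i. mfps_const (- 2 / of_nat i) * ?H (k - i) * g k)"
    by (rule sum.mono_neutral_cong_right) (auto simp: mfps_deriv_h_minus_2y)
  also have "\<dots> = (\<Sum>k\<le>?n. mfps_const (- 2 / of_nat i) * ?H k * g (k + i))"
    by (rule sum.reindex_bij_witness[where i = "\<lambda>k. k + i" and j = "\<lambda>k. k - i"]) auto
  also have "\<dots> = - (mfps_const (2 / of_nat i) * (\<Sum>k\<le>?n. ?H k * g (k + i)))"
    by (simp add: sum_distrib_left mfps_const_uminus mult.assoc sum_negf)
  finally show "mfps_coeff (mfps_deriv (Inr i) (bracket g)) N =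
      mfps_coeff (bracket (\<lambda>k. mfps_deriv (Inr i) (g k)) - mfps_const (2 / of_nat i) * bracket (\<lambda>k. g (k + i))) N"
    by (simp only: mfps_coeff_diff mfps_coeff_add mfps_coeff_uminus mfps_coeff_const_mult b
        coeff_bracket[OF order_refl[of "D_weight N"], of "\<lambda>k. g (k + i)"] diff_conv_add_uminus)
qed

lemma bracket_initial: "mfps_coeff (bracket g) (image_mset Inl T) = mfps_coeff (g 0) (image_mset Inl T)"
  by (subst coeff_bracket[of _ 0]) (simp_all add: D_weight_def image_mset.compositionality o_def h_minus_2y_0)

lemma coeff_prod_vars: "mfps_coeff (\<Prod>v\<in>#T. mfps_var v) T = 1"
  by (induction T) (simp_all add: mfps_coeff_one mfps_coeff_var_mult)

lemma coeff_hirota: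
  "mfps_coeff (hirota P f g) T =
    Sum_any (\<lambda>M. mfps_coeff P M * mfps_coeff (mfps_derivs Inr M (hirota_shift f g)) (image_mset Inl T))"
proof -
  interpret linear_subst "case_sum mfps_var (\<lambda>_. 0)" Inl
    by unfold_locales (rule hirota_subst_zero)
  show ?thesis unfolding hirota_def coeff_subst
    by (simp add: image_mset.compositionality o_def coeff_prod_vars mfps_coeff_Sum)
qed

text \<open>
  The auxiliary variables can be identified with the variables \<open>y\<close> of the Hirota derivatives, because
  \<open>exp(\<Sum> x\<^sub>i D\<^sub>i)\<close> evaluates at \<open>y = x\<close> whatever the other factors have differentiated.
\<close>

lemma coeff_hirota_KP:
  assumes "0 \<notin># N"
  shows "mfps_coeff (hirota (KP_operator_coeff N) f g) T =
    mfps_coeff (bracket (\<lambda>k. translation_coeff (Suc k) (hirota_shift f g))) (image_mset Inl T + image_mset Inr N)"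
proof -
  let ?F = "hirota_shift f g"
  let ?n = "sum_mset N"
  let ?W = "\<lambda>k. weight_msets (Suc k)"
  let ?x = "\<lambda>k A. (- 2) ^ size A * mfps_coeff (h_poly k) A"
  let ?E = "\<lambda>A B. mfps_coeff KP_exp (image_mset Inl A + image_mset Inr B)"
  let ?c = "\<lambda>M. mfps_coeff (mfps_derivs Inr M ?F) (image_mset Inl T)"
  let ?a = "\<lambda>k A B. ?x k A * (D_coeff B * ?E (N - A) (N - A))"
  define S where "S = (\<Union>k\<in>{..?n}. \<Union>A\<in>{A. A \<subseteq># N}. (\<lambda>B. B + (N - A)) ` ?W k)"
  have finS: "finite S" unfolding S_def by (auto simp: finite_submsets finite_weight_msets)
  have inner: "(\<Sum>B | B \<subseteq># M. ?x k A * ((if B \<in> ?W k then D_coeff B else 0) * ?E (N - A) (M - B))) =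
      (\<Sum>B\<in>?W k. if M = B + (N - A) then ?a k A B else 0)" for k A M
  proof -
    have "(\<Sum>B | B \<subseteq># M. ?x k A * ((if B \<in> ?W k then D_coeff B else 0) * ?E (N - A) (M - B))) =
        (\<Sum>B\<in>{B. B \<subseteq># M \<and> B \<in> ?W k}. ?x k A * (D_coeff B * ?E (N - A) (M - B)))"
      by (rule sum.mono_neutral_cong_right) (auto simp: finite_submsets)
    also have "\<dots> = (\<Sum>B\<in>?W k. if M = B + (N - A) then ?a k A B else 0)"
    proof (rule sum.mono_neutral_cong_left)
      fix B assume "B \<in> {B. B \<subseteq># M \<and> B \<in> ?W k}"
      then have M: "M = B + (M - B)" by simp
      show "?x k A * (D_coeff B * ?E (N - A) (M - B)) = (if M = B + (N - A) then ?a k A B else 0)"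
      proof (cases "M - B = N - A")
        case False
        then have "M \<noteq> B + (N - A)" by auto
        moreover have "?E (N - A) (M - B) = 0" using KP_exp_support False by metis
        ultimately show ?thesis by simp
      qed (use M in simp)
    qed (auto simp: finite_weight_msets)
    finally show ?thesis .
  qed
  have P: "mfps_coeff (KP_operator_coeff N) M =
      (\<Sum>k\<le>?n. \<Sum>A | A \<subseteq># N. \<Sum>B\<in>?W k. if M = B + (N - A) then ?a k A B else 0)" for M
    unfolding KP_operator_coeff_def mfps_coeff_Abs coeff_KP_operator inner ..
  have "mfps_coeff (hirota (KP_operator_coeff N) f g) T = (\<Sum>M\<in>S. mfps_coeff (KP_operator_coeff N) M * ?c M)"
    unfolding coeff_hirota
  proof (rule Sum_any.expand_superset[OF finS], rule subsetI, rule ccontr)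
    fix M assume "M \<in> {M. mfps_coeff (KP_operator_coeff N) M * ?c M \<noteq> 0}" and M: "M \<notin> S"
    moreover have "mfps_coeff (KP_operator_coeff N) M = 0"
      unfolding P by (intro sum.neutral ballI) (use M in \<open>auto simp: S_def\<close>)
    ultimately show False by simp
  qed
  also have "\<dots> = (\<Sum>k\<le>?n. \<Sum>A | A \<subseteq># N. \<Sum>B\<in>?W k. \<Sum>M\<in>S. if M = B + (N - A) then ?a k A B * ?c M else 0)"
    unfolding P sum_distrib_right
    by (rule trans[OF sum.swap], rule sum.cong[OF refl], rule trans[OF sum.swap], rule sum.cong[OF refl],
        rule trans[OF sum.swap]) (auto intro!: sum.cong)
  also have "\<dots> = (\<Sum>k\<le>?n. \<Sum>A | A \<subseteq># N. \<Sum>B\<in>?W k. ?a k A B * ?c (B + (N - A)))"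
  proof (intro sum.cong refl)
    fix k A B assume "k \<in> {..?n}" "A \<in> {A. A \<subseteq># N}" "B \<in> ?W k"
    then have "B + (N - A) \<in> S" by (auto simp: S_def)
    then show "(\<Sum>M\<in>S. if M = B + (N - A) then ?a k A B * ?c M else 0) = ?a k A B * ?c (B + (N - A))"
      by (simp add: finS)
  qed
  also have "\<dots> = (\<Sum>k\<le>?n. \<Sum>A | A \<subseteq># N. \<Sum>B\<in>?W k. ?x k A *
      (D_coeff B * mfps_coeff (mfps_derivs Inr B ?F) (image_mset Inl T + image_mset Inr (N - A))))"
  proof (intro sum.cong refl)
    fix k A B
    have "0 \<notin># N - A" using assms by (meson in_diffD)
    from KP_exp_taylor[OF this, of "mfps_derivs Inr B ?F" T]
    show "?a k A B * ?c (B + (N - A)) = ?x k A *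
      (D_coeff B * mfps_coeff (mfps_derivs Inr B ?F) (image_mset Inl T + image_mset Inr (N - A)))"
      by (simp add: mult.assoc)
  qed
  also have "\<dots> = (\<Sum>k\<le>?n. \<Sum>A | A \<subseteq># N. mfps_coeff (h_minus_2y k) (image_mset Inr A) *
      mfps_coeff (translation_coeff (Suc k) ?F) (image_mset Inr (N - A) + image_mset Inl T))"
    by (simp add: coeff_h_minus_2y translation_coeff_def mfps_coeff_sum sum_distrib_left add.commute)
  also have "\<dots> = (\<Sum>k\<le>?n. mfps_coeff (h_minus_2y k * translation_coeff (Suc k) ?F) (image_mset Inr N + image_mset Inl T))"
    by (intro sum.cong refl coeff_mult_supported[symmetric])
       (auto simp: h_minus_2y_def dest: subst_scaled_support[THEN subsetD])
  also have "\<dots> = mfps_coeff (bracket (\<lambda>k. translation_coeff (Suc k) ?F)) (image_mset Inl T + image_mset Inr N)"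
    by (subst coeff_bracket[of _ ?n])
       (simp_all add: D_weight_def image_mset.compositionality o_def mfps_coeff_sum add.commute)
  finally show ?thesis .
qed

text \<open>The whole hierarchy is thus one identity of power series in \<open>t\<close> and \<open>y\<close>.  Monomials that contain the spurious variable
  \<open>x\<^sub>0\<close> have the zero operator as coefficient.\<close>

lemma KP_tau_functionI:
  assumes "bracket (\<lambda>k. translation_coeff (Suc k) (hirota_shift \<tau> \<tau>)) = 0"
  shows "KP_tau_function \<tau>"
  unfolding KP_tau_function_def
proof (intro allI mfps_eqI)
  fix N T
  show "mfps_coeff (hirota (KP_operator_coeff N) \<tau> \<tau>) T = mfps_coeff 0 T"
  proof (cases "0 \<in># N")
    case True
    have "mfps_coeff (KP_operator_coeff N) M = 0" for M
      unfolding KP_operator_coeff_def mfps_coeff_Abs coeff_KP_operator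
    proof (intro sum.neutral ballI)
      fix k A B assume "A \<in> {A. A \<subseteq># N}"
      then have "0 \<in># A \<or> 0 \<in># N - A"
        using True by (metis in_diff_count mem_Collect_eq mset_subset_eq_count not_in_iff not_gr_zero in_multiset_in_set count_greater_zero_iff)
      then have "mfps_coeff (h_poly k) A = 0 \<or> mfps_coeff KP_exp (image_mset Inl (N - A) + image_mset Inr (M - B)) = 0"
        using h_poly_nonzero(2) KP_exp_support by metis
      then show "(- 2) ^ size A * mfps_coeff (h_poly k) A * ((if B \<in> weight_msets (Suc k) then D_coeff B else 0) *
          mfps_coeff KP_exp (image_mset Inl (N - A) + image_mset Inr (M - B))) = 0" by auto
    qed
    then show ?thesis by (simp add: coeff_hirota)
  qed (use assms in \<open>simp add: coeff_hirota_KP\<close>)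
qed

section \<open>Determinants under rank one perturbations\<close>

abbreviation fun_mat :: "nat \<Rightarrow> (nat \<Rightarrow> nat \<Rightarrow> 'a) \<Rightarrow> 'a mat" where
  "fun_mat n F \<equiv> mat n n (\<lambda>(i, j). F i j)"

lemma cofactor_cong:
  assumes "dim_row A = dim_row B" "dim_col A = dim_col B" "i < dim_row A"
    and "\<And>a b. a < dim_row A \<Longrightarrow> b < dim_col A \<Longrightarrow> a \<noteq> i \<Longrightarrow> A $$ (a, b) = B $$ (a, b)"
  shows "cofactor A i j = cofactor B i j"
proof -
  have "mat_delete A i j = mat_delete B i j"
    unfolding mat_delete_def by (rule eq_matI) (use assms in auto)
  then show ?thesis by (simp add: cofactor_def)
qed

text \<open>Multiples of the row \<open>y\<close> may be added to the other rows.\<close>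

lemma det_row_absorbs:
  fixes G :: "nat \<Rightarrow> nat \<Rightarrow> 'a :: comm_ring_1"
  assumes "m < n" "l \<le> m"
  shows "det (fun_mat n (\<lambda>i j. if i = m then y j else G i j + (if i < l then x i * y j else 0))) =
    det (fun_mat n (\<lambda>i j. if i = m then y j else G i j))"
  using assms(2)
proof (induction l)
  case 0
  show ?case by (rule arg_cong[of _ _ det], rule eq_matI) auto
next
  case (Suc l)
  let ?B = "\<lambda>l. fun_mat n (\<lambda>i j. if i = m then y j else G i j + (if i < l then x i * y j else 0))"
  have "?B (Suc l) = addrow (x l) l m (?B l)"
    by (rule eq_matI) (use Suc.prems assms(1) in \<open>auto simp: less_Suc_eq algebra_simps\<close>)
  then have "det (?B (Suc l)) = det (?B l)"
    using det_addrow[of m n l "?B l" "x l"] Suc.prems assms(1) by simp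
  with Suc show ?case by simp
qed

text \<open>The rows are updated one after the other.  The expansion along the row that is being updated produces the new summand, in
  whose determinant the earlier updates are absorbed.\<close>

lemma det_rank_one_update:
  fixes G :: "nat \<Rightarrow> nat \<Rightarrow> 'a :: comm_ring_1"
  shows "det (fun_mat n (\<lambda>i j. G i j + x i * y j)) =
    det (fun_mat n G) + (\<Sum>i<n. \<Sum>j<n. x i * y j * cofactor (fun_mat n G) i j)"
proof -
  let ?A = "\<lambda>m. fun_mat n (\<lambda>i j. G i j + (if i < m then x i * y j else 0))"
  have "det (?A m) = det (fun_mat n G) + (\<Sum>i<m. \<Sum>j<n. x i * y j * cofactor (fun_mat n G) i j)" if "m \<le> n" for m
    using that
  proof (induction m)
    case 0
    have "?A 0 = fun_mat n G" by (rule eq_matI) auto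
    then show ?case by simp
  next
    case (Suc m)
    then have m: "m < n" by simp
    let ?B = "\<lambda>l. fun_mat n (\<lambda>i j. if i = m then y j else G i j + (if i < l then x i * y j else 0))"
    let ?G = "fun_mat n (\<lambda>i j. if i = m then y j else G i j)"
    have "(\<Sum>j<n. y j * cofactor (?A m) m j) = (\<Sum>j<n. ?B m $$ (m, j) * cofactor (?B m) m j)"
      by (intro sum.cong arg_cong2[of _ _ _ _ "(*)"] cofactor_cong) (use m in auto)
    also have "\<dots> = det (?B m)"
      by (rule laplace_expansion_row[symmetric]) (use m in auto)
    also have "\<dots> = det ?G"
      by (rule det_row_absorbs) (use m in auto)
    also have "\<dots> = (\<Sum>j<n. ?G $$ (m, j) * cofactor ?G m j)"
      by (rule laplace_expansion_row) (use m in auto)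
    also have "\<dots> = (\<Sum>j<n. y j * cofactor (fun_mat n G) m j)"
      by (intro sum.cong arg_cong2[of _ _ _ _ "(*)"] cofactor_cong) (use m in auto)
    finally have y: "(\<Sum>j<n. y j * cofactor (?A m) m j) = (\<Sum>j<n. y j * cofactor (fun_mat n G) m j)" .
    have "det (?A (Suc m)) = (\<Sum>j<n. ?A (Suc m) $$ (m, j) * cofactor (?A (Suc m)) m j)"
      by (rule laplace_expansion_row) (use m in auto)
    also have "\<dots> = (\<Sum>j<n. (G m j + x m * y j) * cofactor (?A m) m j)"
      by (intro sum.cong arg_cong2[of _ _ _ _ "(*)"] cofactor_cong) (use m in auto)
    also have "\<dots> = (\<Sum>j<n. ?A m $$ (m, j) * cofactor (?A m) m j) + x m * (\<Sum>j<n. y j * cofactor (?A m) m j)"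
      using m by (simp add: sum_distrib_left sum.distrib algebra_simps)
    also have "(\<Sum>j<n. ?A m $$ (m, j) * cofactor (?A m) m j) = det (?A m)"
      by (rule laplace_expansion_row[symmetric]) (use m in auto)
    finally show ?case
      using Suc y by (simp add: sum_distrib_left mult.assoc)
  qed
  from this[of n] have "det (?A n) = det (fun_mat n G) + (\<Sum>i<n. \<Sum>j<n. x i * y j * cofactor (fun_mat n G) i j)" by simp
  moreover have "?A n = fun_mat n (\<lambda>i j. G i j + x i * y j)" by (rule eq_matI) auto
  ultimately show ?thesis by simp
qed

lemma sum_row_cofactor:
  fixes G :: "nat \<Rightarrow> nat \<Rightarrow> 'a :: comm_ring_1"
  assumes "i < n" "i' < n"
  shows "(\<Sum>j<n. G i' j * cofactor (fun_mat n G) i j) = (if i = i' then det (fun_mat n G) else 0)"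
proof -
  let ?A = "fun_mat n G"
  have A: "?A \<in> carrier_mat n n" by simp
  have "(?A * adj_mat ?A) $$ (i', i) = (\<Sum>j<n. G i' j * cofactor ?A i j)"
    using assms by (simp add: adj_mat_def scalar_prod_def atLeast0LessThan)
  then show ?thesis using assms unfolding adj_mat(2)[OF A] by auto
qed

lemma sum_col_cofactor:
  fixes G :: "nat \<Rightarrow> nat \<Rightarrow> 'a :: comm_ring_1"
  assumes "j < n" "j' < n"
  shows "(\<Sum>i<n. G i j * cofactor (fun_mat n G) i j') = (if j = j' then det (fun_mat n G) else 0)"
proof -
  let ?A = "fun_mat n G"
  have A: "?A \<in> carrier_mat n n" by simp
  have "(adj_mat ?A * ?A) $$ (j', j) = (\<Sum>i<n. G i j * cofactor ?A i j')"
    using assms by (simp add: adj_mat_def scalar_prod_def atLeast0LessThan mult.commute)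
  then show ?thesis using assms unfolding adj_mat(3)[OF A] by auto
qed

lemma (in comm_ring_hom) hom_det_fun_mat: "hom (det (fun_mat n F)) = det (fun_mat n (\<lambda>i j. hom (F i j)))"
proof -
  have "map_mat hom (fun_mat n F) = fun_mat n (\<lambda>i j. hom (F i j))" by (rule eq_matI) auto
  then show ?thesis using hom_det[of "fun_mat n F"] by simp
qed

lemma (in comm_ring_hom) hom_cofactor:
  assumes "i < n" "j < n"
  shows "hom (cofactor (fun_mat n F) i j) = cofactor (fun_mat n (\<lambda>i j. hom (F i j))) i j"
proof -
  have "map_mat hom (mat_delete (fun_mat n F) i j) = mat_delete (fun_mat n (\<lambda>i j. hom (F i j))) i j"
    unfolding mat_delete_def by (rule eq_matI) (use assms in auto)
  then show ?thesis by (simp add: cofactor_def hom_mult hom_power hom_uminus flip: hom_det)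
qed

lemma comm_ring_hom_fps_const: "comm_ring_hom (fps_const :: 'a :: comm_ring_1 \<Rightarrow> 'a fps)"
  by unfold_locales (simp_all flip: fps_const_add fps_const_mult)

text \<open>Over the ring of power series in \<open>w\<close>, a translation that perturbs a matrix by rank one changes its determinant by a
  bilinear expression in the cofactors of the original matrix.\<close>

lemma translation_det:
  assumes "\<And>i j. i < n \<Longrightarrow> j < n \<Longrightarrow> translation (F i j) = fps_const (F i j) + X i * Y j"
  shows "translation (det (fun_mat n F)) = fps_const (det (fun_mat n F)) +
    (\<Sum>i<n. \<Sum>j<n. X i * Y j * fps_const (cofactor (fun_mat n F) i j))"
proof -
  interpret t: comm_ring_hom translation by (rule comm_ring_hom_translation)
  interpret c: comm_ring_hom "fps_const :: (nat + nat) mfps \<Rightarrow> _" by (rule comm_ring_hom_fps_const)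
  have "fun_mat n (\<lambda>i j. translation (F i j)) = fun_mat n (\<lambda>i j. fps_const (F i j) + X i * Y j)"
    by (rule eq_matI) (use assms in auto)
  then show ?thesis
    unfolding t.hom_det_fun_mat by (simp add: det_rank_one_update c.hom_det_fun_mat c.hom_cofactor)
qed


section \<open>Determinantal tau functions\<close>

definition shift_plus :: "nat mfps \<Rightarrow> (nat + nat) mfps" where
  "shift_plus = mfps_subst (\<lambda>k. mfps_var (Inl k) + mfps_var (Inr k))"

definition shift_minus :: "nat mfps \<Rightarrow> (nat + nat) mfps" where
  "shift_minus = mfps_subst (\<lambda>k. mfps_var (Inl k) - mfps_var (Inr k))"

lemma hirota_shift_eq: "hirota_shift f g = shift_plus f * shift_minus g"
  by (simp add: hirota_shift_def shift_plus_def shift_minus_def)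

lemma linear_subst_shift:
  "linear_subst (\<lambda>k. mfps_var (Inl k) + mfps_var (Inr k)) (case_sum id id)"
  "linear_subst (\<lambda>k. mfps_var (Inl k) - mfps_var (Inr k)) (case_sum id id)"
  by unfold_locales (rule hirota_subst_plus hirota_subst_minus; assumption)+

lemma comm_ring_hom_shift: "comm_ring_hom shift_plus" "comm_ring_hom shift_minus"
  unfolding shift_plus_def shift_minus_def by (rule linear_subst.comm_ring_hom_subst[OF linear_subst_shift(1)] linear_subst.comm_ring_hom_subst[OF linear_subst_shift(2)])+

lemma shift_const: "shift_plus (mfps_const c) = mfps_const c" "shift_minus (mfps_const c) = mfps_const c"
  unfolding shift_plus_def shift_minus_def
  by (rule linear_subst.subst_const[OF linear_subst_shift(1)] linear_subst.subst_const[OF linear_subst_shift(2)])+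

lemma mfps_deriv_shift_plus: "mfps_deriv (Inr i) (shift_plus f) = shift_plus (mfps_deriv i f)"
  using linear_subst.subst_deriv[OF linear_subst_shift(1), of "Inr i" 1 f]
  by (simp add: shift_plus_def mfps_deriv_add mfps_deriv_var)

lemma mfps_deriv_shift_minus: "mfps_deriv (Inr i) (shift_minus f) = - shift_minus (mfps_deriv i f)"
  using linear_subst.subst_deriv[OF linear_subst_shift(2), of "Inr i" "-1" f]
  by (simp add: shift_minus_def mfps_deriv_diff mfps_deriv_var mfps_const_uminus)

lemma shift_initial:
  "mfps_coeff (shift_plus f) (image_mset Inl T) = mfps_coeff f T"
  "mfps_coeff (shift_minus f) (image_mset Inl T) = mfps_coeff f T"
  using linear_subst.coeff_subst_image[OF linear_subst_shift(1), of Inl f T]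
    linear_subst.coeff_subst_image[OF linear_subst_shift(2), of Inl f T]
  by (simp_all add: shift_plus_def shift_minus_def mfps_coeff_add mfps_coeff_diff mfps_var_def)

lemma mfps_const_2_div: "mfps_const (2 / of_nat i) = mfps_const (1 / of_nat i) + mfps_const (1 / of_nat i)"
  by (simp flip: mfps_const_add)

text \<open>Both sides satisfy the linear system \<open>\<partial>f\<^sub>q/\<partial>y\<^sub>i = - f\<^sub>q\<^sub>+\<^sub>i / i\<close>, because \<open>-2 + 1 = -1\<close>, and have the same initial values.  The
  model is \<open>A\<^sub>q = a\<^sup>q exp(\<Sum> y\<^sub>i a\<^sup>i / i)\<close> and \<open>B\<^sub>q = a\<^sup>q exp(-\<Sum> y\<^sub>i a\<^sup>i / i)\<close>.\<close>

lemma bracket_exponential: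
  assumes A: "\<And>q i. mfps_deriv (Inr i) (A q) = mfps_const (1 / of_nat i) * A (q + i)"
    and B: "\<And>q i. mfps_deriv (Inr i) (B q) = - (mfps_const (1 / of_nat i) * B (q + i))"
    and initial: "\<And>q T. mfps_coeff (A q) (image_mset Inl T) = mfps_coeff (B q) (image_mset Inl T)"
  shows "bracket (\<lambda>k. A (q + k)) = B q"
proof -
  let ?D = "\<lambda>q. bracket (\<lambda>k. A (q + k)) - B q"
  have D: "mfps_deriv (Inr i) (?D q) = - mfps_const (1 / of_nat i) * ?D (q + i)" for q i
    unfolding mfps_deriv_diff mfps_deriv_bracket A B bracket_mult mfps_const_2_div by (simp add: algebra_simps)
  have "?D q = 0"
  proof (rule coeff_zero_by_derivatives[where \<F> = "range ?D"])
    show "mfps_coeff f (image_mset Inl T) = 0" if "f \<in> range ?D" for f T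
      using that by (auto simp: mfps_coeff_diff bracket_initial initial)
    show "mfps_coeff (mfps_deriv (Inr i) f) N = 0"
      if f: "f \<in> range ?D" and N: "\<And>g. g \<in> range ?D \<Longrightarrow> mfps_coeff g N = 0" for f i N
    proof -
      from f obtain q where q: "f = ?D q" by (rule rangeE)
      have "mfps_coeff (?D (q + i)) N = 0" by (rule N) (rule rangeI)
      then show ?thesis unfolding q D by (simp flip: mfps_const_uminus)
    qed
  qed simp
  then show ?thesis by simp
qed

text \<open>The coefficientwise form of \<open>K(t + [w]) - K(t) = \<phi>\<^sub>0 \<Sum>\<^sub>k w\<^sup>k\<^sup>+\<^sup>1 \<psi>\<^sub>k\<close> for the solutions of the equations in the locale below:
  the right hand side satisfies the Newton recursion, where the sum over \<open>p\<close> in the derivative of \<open>F\<close> cancels against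
  the derivatives of \<open>P 0\<close> except for one term.\<close>

lemma translation_coeff_rank_one:
  assumes F: "\<And>i. mfps_deriv (Inr i) F = mfps_const (1 / of_nat i) * (\<Sum>p<i. P p * Q (i - 1 - p))"
    and P: "\<And>p i. mfps_deriv (Inr i) (P p) = - (mfps_const (1 / of_nat i) * P (p + i))"
    and Q: "\<And>q i. mfps_deriv (Inr i) (Q q) = mfps_const (1 / of_nat i) * Q (q + i)"
  shows "translation_coeff (Suc k) F = P 0 * Q k"
proof -
  let ?g = "\<lambda>k. case k of 0 \<Rightarrow> F | Suc k \<Rightarrow> P 0 * Q k"
  have i: "of_nat i * (mfps_const (1 / of_nat i) * f) = f" if "i \<ge> 1" for i and f :: "(nat + nat) mfps"
    using that by (simp flip: mfps_const_of_nat mfps_const_mult mult.assoc)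
  have "translation_coeff (Suc k) F = ?g (Suc k)"
  proof (rule translation_coeff_unique)
    fix k
    show "of_nat k * ?g k = (\<Sum>i=1..k. of_nat i * mfps_deriv (Inr i) (?g (k - i)))"
    proof (cases k)
      case (Suc m)
      have "(\<Sum>i=1..k. of_nat i * mfps_deriv (Inr i) (?g (k - i))) =
          (\<Sum>i=1..m. of_nat i * mfps_deriv (Inr i) (?g (k - i))) + of_nat k * mfps_deriv (Inr k) (?g (k - k))"
        by (simp add: Suc)
      also have "of_nat k * mfps_deriv (Inr k) (?g (k - k)) = (\<Sum>p<k. P p * Q (m - p))"
        by (simp add: F Suc i del: of_nat_Suc)
      also have "(\<Sum>i=1..m. of_nat i * mfps_deriv (Inr i) (?g (k - i))) = (\<Sum>i=1..m. P 0 * Q m - P i * Q (m - i))"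
      proof (rule sum.cong[OF refl])
        fix j assume j: "j \<in> {1..m}"
        then have "k - j = Suc (m - j)" by (simp add: Suc Suc_diff_le)
        moreover have "mfps_deriv (Inr j) (P 0 * Q (m - j)) = mfps_const (1 / of_nat j) * (P 0 * Q m - P j * Q (m - j))"
          using j by (simp add: mfps_deriv_mult P Q right_diff_distrib mult.left_commute mult.assoc)
        ultimately show "of_nat j * mfps_deriv (Inr j) (?g (k - j)) = P 0 * Q m - P j * Q (m - j)"
          using j i[of j] by simp
      qed
      also have "\<dots> = of_nat m * (P 0 * Q m) - (\<Sum>i=1..m. P i * Q (m - i))"
        by (simp add: sum_subtractf)
      also have "(\<Sum>p<k. P p * Q (m - p)) = P 0 * Q m + (\<Sum>i=1..m. P i * Q (m - i))"
        unfolding Suc lessThan_Suc_atMost by (simp add: sum.atMost_shift sum.atLeast1_atMost_eq)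
      finally show ?thesis by (simp add: Suc algebra_simps)
    qed simp
  qed simp
  then show ?thesis by simp
qed

text \<open>
  The differential equations of \<open>K = exp(-X\<^sub>1\<^sub>1) (e\<^sup>X)\<^sub>1\<^sub>*\<close>, \<open>\<phi> p = exp(-X\<^sub>1\<^sub>1) A\<^sub>1\<^sub>1\<^sup>p u\<close> and \<open>\<psi> q = v A\<^sub>2\<^sub>2\<^sup>q (e\<^sup>X)\<^sub>2\<^sub>*\<close>, where
  \<open>X = \<Sum>\<^sub>k t\<^sub>k A\<^sup>k / k\<close> for a block triangular matrix \<open>A\<close> with \<open>A\<^sub>1\<^sub>2 = u v\<close> of rank one.  The coefficient \<open>1 / k\<close> is \<open>0\<close> for
  \<open>k = 0\<close>, so nothing depends on \<open>t\<^sub>0\<close>.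
\<close>

locale rank_one_flow =
  fixes K :: "nat \<Rightarrow> nat \<Rightarrow> nat mfps" and \<phi> \<psi> :: "nat \<Rightarrow> nat \<Rightarrow> nat mfps"
  assumes deriv_K: "mfps_deriv k (K i j) = mfps_const (1 / of_nat k) * (\<Sum>p<k. \<phi> p i * \<psi> (k - 1 - p) j)"
    and deriv_\<phi>: "mfps_deriv k (\<phi> p i) = - (mfps_const (1 / of_nat k) * \<phi> (p + k) i)"
    and deriv_\<psi>: "mfps_deriv k (\<psi> q j) = mfps_const (1 / of_nat k) * \<psi> (q + k) j"
begin

sublocale plus: comm_ring_hom shift_plus by (rule comm_ring_hom_shift)
sublocale minus: comm_ring_hom shift_minus by (rule comm_ring_hom_shift)

abbreviation "\<phi>p q i \<equiv> shift_plus (\<phi> q i)"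
abbreviation "\<phi>m q i \<equiv> shift_minus (\<phi> q i)"
abbreviation "\<psi>p q j \<equiv> shift_plus (\<psi> q j)"
abbreviation "\<psi>m q j \<equiv> shift_minus (\<psi> q j)"

lemma deriv_plus:
  "mfps_deriv (Inr k) (\<phi>p p i) = - (mfps_const (1 / of_nat k) * \<phi>p (p + k) i)"
  "mfps_deriv (Inr k) (\<psi>p q j) = mfps_const (1 / of_nat k) * \<psi>p (q + k) j"
  "mfps_deriv (Inr k) (shift_plus (K i j)) = mfps_const (1 / of_nat k) * (\<Sum>p<k. \<phi>p p i * \<psi>p (k - 1 - p) j)"
  by (simp_all add: mfps_deriv_shift_plus deriv_\<phi> deriv_\<psi> deriv_K plus.hom_uminus plus.hom_mult plus.hom_sum shift_const)

lemma deriv_minus: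
  "mfps_deriv (Inr k) (\<phi>m p i) = mfps_const (1 / of_nat k) * \<phi>m (p + k) i"
  "mfps_deriv (Inr k) (\<psi>m q j) = - (mfps_const (1 / of_nat k) * \<psi>m (q + k) j)"
  "mfps_deriv (Inr k) (shift_minus (K i j)) = - (mfps_const (1 / of_nat k) * (\<Sum>p<k. \<phi>m p i * \<psi>m (k - 1 - p) j))"
  by (simp_all add: mfps_deriv_shift_minus deriv_\<phi> deriv_\<psi> deriv_K minus.hom_uminus minus.hom_mult minus.hom_sum shift_const)

lemma translation_K_plus: "translation_coeff (Suc k) (shift_plus (K i j)) = \<phi>p 0 i * \<psi>p k j"
  using translation_coeff_rank_one[of "shift_plus (K i j)" "\<lambda>p. \<phi>p p i" "\<lambda>q. \<psi>p q j"] deriv_plus by blast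

text \<open>Reversing the sign of \<open>y\<close> exchanges the roles of \<open>\<phi>\<close> and \<open>\<psi>\<close>, up to the sign of \<open>K\<close>.\<close>

lemma translation_K_minus: "translation_coeff (Suc k) (shift_minus (K i j)) = - (\<phi>m k i * \<psi>m 0 j)"
proof -
  interpret t: comm_ring_hom translation by (rule comm_ring_hom_translation)
  have "mfps_deriv (Inr k) (- shift_minus (K i j)) = mfps_const (1 / of_nat k) * (\<Sum>q<k. \<psi>m q j * \<phi>m (k - 1 - q) i)" for k
  proof -
    have "(\<Sum>p<k. \<phi>m p i * \<psi>m (k - 1 - p) j) = (\<Sum>q<k. \<psi>m q j * \<phi>m (k - 1 - q) i)"
      by (rule sum.reindex_bij_witness[where i = "\<lambda>q. k - 1 - q" and j = "\<lambda>p. k - 1 - p"]) (auto simp: mult.commute)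
    then show ?thesis by (simp add: mfps_deriv_uminus deriv_minus)
  qed
  then have "translation_coeff (Suc k) (- shift_minus (K i j)) = \<psi>m 0 j * \<phi>m k i"
    using translation_coeff_rank_one[of "- shift_minus (K i j)" "\<lambda>p. \<psi>m p j" "\<lambda>q. \<phi>m q i"] deriv_minus by blast
  moreover have "translation_coeff (Suc k) (- shift_minus (K i j)) = - translation_coeff (Suc k) (shift_minus (K i j))"
    using t.hom_uminus[of "shift_minus (K i j)"] unfolding translation_def
    by (metis fps_nth_Abs_fps fps_neg_nth)
  ultimately show ?thesis by (metis minus_minus mult.commute)
qed

lemma bracket_\<psi>: "bracket (\<lambda>k. \<psi>p (q + k) j) = \<psi>m q j"
  by (rule bracket_exponential[where A = "\<lambda>q. \<psi>p q j" and B = "\<lambda>q. \<psi>m q j"])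
     (simp_all add: deriv_plus deriv_minus shift_initial)

lemma bracket_\<phi>: "bracket (\<lambda>k. \<phi>m (p + k) i) = \<phi>p p i"
  by (rule bracket_exponential[where A = "\<lambda>q. \<phi>m q i" and B = "\<lambda>q. \<phi>p q i"])
     (simp_all add: deriv_plus deriv_minus shift_initial)

text \<open>Both sides have the same derivatives by the \<open>y\<^sub>i\<close>.  Differentiating a factor of the convolution raises its index by \<open>i\<close>, which
  gives the convolution of order \<open>k + i\<close> except for \<open>i\<close> terms at one end.  The full convolutions cancel against
  the derivative of \<open>h\<^sub>k(-2y)\<close>, and the bracket evaluates the missing terms to the derivative of the right hand side.\<close>

lemma bracket_cross:
  "bracket (\<lambda>k. \<Sum>p<k. \<phi>m p i * \<psi>p (k - 1 - p) j) = shift_minus (K i j) - shift_plus (K i j)"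
proof -
  define C where "C k = (\<Sum>p<k. \<phi>m p i * \<psi>p (k - 1 - p) j)" for k
  let ?r = "\<lambda>n. mfps_const (1 / of_nat n) :: (nat + nat) mfps"
  let ?D = "bracket C - (shift_minus (K i j) - shift_plus (K i j))"
  have split: "(\<Sum>p<k + n. g p) = (\<Sum>p<k. g p) + (\<Sum>p<n. g (k + p))" for k n and g :: "nat \<Rightarrow> (nat + nat) mfps"
    by (induction n) (simp_all add: add.assoc)
  have C: "mfps_deriv (Inr n) (C k) = ?r n * (C (k + n) + C (k + n) -
      ((\<Sum>p<n. \<phi>m p i * \<psi>p (n - 1 - p + k) j) + (\<Sum>p<n. \<phi>m (p + k) i * \<psi>p (n - 1 - p) j)))" for n k
  proof -
    have "mfps_deriv (Inr n) (C k) = ?r n * ((\<Sum>p<k. \<phi>m (p + n) i * \<psi>p (k - 1 - p) j) + (\<Sum>p<k. \<phi>m p i * \<psi>p (k - 1 - p + n) j))"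
      by (simp add: C_def mfps_deriv_sum mfps_deriv_mult deriv_plus deriv_minus sum_distrib_left sum.distrib distrib_left mult_ac)
    also have "(\<Sum>p<k. \<phi>m p i * \<psi>p (k - 1 - p + n) j) = (\<Sum>p<k. \<phi>m p i * \<psi>p (k + n - 1 - p) j)"
      by (rule sum.cong) auto
    also have "\<dots> = C (k + n) - (\<Sum>p<n. \<phi>m (p + k) i * \<psi>p (n - 1 - p) j)"
      unfolding C_def split[of _ k n] by (simp add: add.commute)
    also have "(\<Sum>p<k. \<phi>m (p + n) i * \<psi>p (k - 1 - p) j) = C (k + n) - (\<Sum>p<n. \<phi>m p i * \<psi>p (n + k - 1 - p) j)"
      unfolding C_def add.commute[of k n] split[of _ n k] by (simp add: add.commute)
    also have "(\<Sum>p<n. \<phi>m p i * \<psi>p (n + k - 1 - p) j) = (\<Sum>p<n. \<phi>m p i * \<psi>p (n - 1 - p + k) j)"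
      by (rule sum.cong) auto
    finally show ?thesis by (simp add: algebra_simps)
  qed
  have b: "bracket (\<lambda>k. mfps_deriv (Inr n) (C k)) = ?r n * (bracket (\<lambda>k. C (k + n)) + bracket (\<lambda>k. C (k + n)) -
      ((\<Sum>p<n. \<phi>m p i * \<psi>m (n - 1 - p) j) + (\<Sum>p<n. \<phi>p p i * \<psi>p (n - 1 - p) j)))" for n
  proof -
    have "bracket (\<lambda>k. \<phi>m (p + k) i * \<psi>p (n - 1 - p) j) = \<phi>p p i * \<psi>p (n - 1 - p) j" for p
      using bracket_mult[of "\<psi>p (n - 1 - p) j" "\<lambda>k. \<phi>m (p + k) i"] by (simp add: bracket_\<phi> mult.commute)
    then show ?thesis
      unfolding C by (simp only: bracket_mult bracket_add bracket_diff bracket_sum bracket_\<psi>)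
  qed
  have D: "mfps_deriv (Inr n) ?D = 0" for n
    unfolding mfps_deriv_diff mfps_deriv_bracket b deriv_plus deriv_minus mfps_const_2_div by (simp add: algebra_simps)
  have "?D = 0"
  proof (rule coeff_zero_by_derivatives[where \<F> = "{?D}"])
    show "mfps_coeff f (image_mset Inl T) = 0" if "f \<in> {?D}" for f T
      using that by (simp add: mfps_coeff_diff bracket_initial shift_initial C_def)
  qed (simp_all add: D)
  then show ?thesis by (simp add: C_def[abs_def])
qed

text \<open>Here \<open>u\<close> and \<open>v\<close> are the changes of \<open>\<tau>(t + y)\<close> and of \<open>-\<tau>(t - y)\<close> under the translation.  Of the three terms of the product the mixed one
  involves \<open>K(t - y) - K(t + y)\<close> between two cofactor matrices, and each of the two \<open>K\<close> cancels the cofactors of its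
  own matrix, leaving the other two terms with the opposite sign.\<close>

theorem KP_tau_function_det: "KP_tau_function (det (fun_mat n K))"
proof (rule KP_tau_functionI)
  let ?\<tau> = "det (fun_mat n K)"
  let ?f = "shift_plus ?\<tau>" and ?g = "shift_minus ?\<tau>"
  let ?Kp = "\<lambda>i j. shift_plus (K i j)" and ?Km = "\<lambda>i j. shift_minus (K i j)"
  define c where "c i j = cofactor (fun_mat n ?Kp) i j" for i j
  define d where "d i j = cofactor (fun_mat n ?Km) i j" for i j
  define u where "u k = (\<Sum>i<n. \<Sum>j<n. \<phi>p 0 i * \<psi>p k j * c i j)" for k
  define v where "v k = (\<Sum>i<n. \<Sum>j<n. \<phi>m k i * \<psi>m 0 j * d i j)" for k
  have f: "?f = det (fun_mat n ?Kp)" and g: "?g = det (fun_mat n ?Km)"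
    by (rule plus.hom_det_fun_mat minus.hom_det_fun_mat)+
  have tf: "translation_coeff (Suc k) ?f = u k" for k
  proof -
    let ?Y = "\<lambda>j. Abs_fps (\<lambda>m. case m of 0 \<Rightarrow> 0 | Suc k \<Rightarrow> \<psi>p k j)"
    have "translation ?f = fps_const ?f + (\<Sum>i<n. \<Sum>j<n. fps_const (\<phi>p 0 i) * ?Y j * fps_const (c i j))"
      unfolding f c_def
    proof (rule translation_det)
      show "translation (?Kp i j) = fps_const (?Kp i j) + fps_const (\<phi>p 0 i) * ?Y j" for i j
        by (rule fps_ext) (auto simp: translation_def translation_K_plus split: nat.splits)
    qed
    from arg_cong[OF this, of "\<lambda>F. fps_nth F (Suc k)"] show ?thesis
      by (simp add: translation_def fps_sum_nth u_def)
  qed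
  have tg: "translation_coeff (Suc k) ?g = - v k" for k
  proof -
    let ?X = "\<lambda>i. Abs_fps (\<lambda>m. case m of 0 \<Rightarrow> 0 | Suc k \<Rightarrow> \<phi>m k i)"
    have "translation ?g = fps_const ?g + (\<Sum>i<n. \<Sum>j<n. ?X i * fps_const (- \<psi>m 0 j) * fps_const (d i j))"
      unfolding g d_def
    proof (rule translation_det)
      show "translation (?Km i j) = fps_const (?Km i j) + ?X i * fps_const (- \<psi>m 0 j)" for i j
        by (rule fps_ext) (auto simp: translation_def translation_K_minus split: nat.splits)
    qed
    from arg_cong[OF this, of "\<lambda>F. fps_nth F (Suc k)"] show ?thesis
      by (simp add: translation_def fps_sum_nth v_def sum_negf)
  qed
  have "translation_coeff (Suc k) (?f * ?g) = ?g * u k - ?f * v k - (\<Sum>a<k. u a * v (k - 1 - a))" for k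
  proof -
    have "translation_coeff (Suc k) (?f * ?g) =
        (\<Sum>a<Suc (Suc k). translation_coeff a ?f * translation_coeff (Suc k - a) ?g)"
      by (simp only: translation_coeff_mult lessThan_Suc_atMost)
    also have "\<dots> = ?f * translation_coeff (Suc k) ?g + (\<Sum>a<k. translation_coeff (Suc a) ?f * translation_coeff (k - a) ?g)
        + translation_coeff (Suc k) ?f * ?g"
      by (subst sum.lessThan_Suc_shift) simp
    also have "(\<Sum>a<k. translation_coeff (Suc a) ?f * translation_coeff (k - a) ?g) = (\<Sum>a<k. - (u a * v (k - 1 - a)))"
    proof (rule sum.cong[OF refl])
      fix a assume "a \<in> {..<k}"
      then have "k - a = Suc (k - 1 - a)" by auto
      then show "translation_coeff (Suc a) ?f * translation_coeff (k - a) ?g = - (u a * v (k - 1 - a))"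
        by (simp only: tf tg mult_minus_right)
    qed
    finally show ?thesis by (simp add: tf tg sum_negf mult.commute)
  qed
  then have "bracket (\<lambda>k. translation_coeff (Suc k) (hirota_shift ?\<tau> ?\<tau>)) =
      ?g * bracket u - ?f * bracket v - bracket (\<lambda>k. \<Sum>a<k. u a * v (k - 1 - a))"
    by (simp add: hirota_shift_eq bracket_diff bracket_mult)
  also have "bracket u = (\<Sum>i<n. \<Sum>j<n. \<phi>p 0 i * \<psi>m 0 j * c i j)"
  proof -
    have "bracket (\<lambda>k. \<phi>p 0 i * \<psi>p k j * c i j) = \<phi>p 0 i * \<psi>m 0 j * c i j" for i j
      using bracket_mult[of "\<phi>p 0 i * c i j" "\<lambda>k. \<psi>p k j"] bracket_\<psi>[of 0 j] by (simp add: mult_ac)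
    then show ?thesis unfolding u_def[abs_def] by (simp add: bracket_sum)
  qed
  also have "bracket v = (\<Sum>i<n. \<Sum>j<n. \<phi>p 0 i * \<psi>m 0 j * d i j)"
  proof -
    have "bracket (\<lambda>k. \<phi>m k i * \<psi>m 0 j * d i j) = \<phi>p 0 i * \<psi>m 0 j * d i j" for i j
      using bracket_mult[of "\<psi>m 0 j * d i j" "\<lambda>k. \<phi>m k i"] bracket_\<phi>[of 0 i] by (simp add: mult_ac)
    then show ?thesis unfolding v_def[abs_def] by (simp add: bracket_sum)
  qed
  also have "bracket (\<lambda>k. \<Sum>a<k. u a * v (k - 1 - a)) =
      (\<Sum>i<n. \<Sum>l<n. \<phi>p 0 i * \<psi>m 0 l * (c i l * ?g - d i l * ?f))"
  proof -
    have "(\<Sum>a<k. u a * v (k - 1 - a)) = (\<Sum>i<n. \<Sum>j<n. \<Sum>m<n. \<Sum>l<n.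
        (\<phi>p 0 i * \<psi>m 0 l * c i j * d m l) * (\<Sum>a<k. \<phi>m a m * \<psi>p (k - 1 - a) j))" for k
    proof -
      have "(\<Sum>a<k. u a * v (k - 1 - a)) = (\<Sum>a<k. \<Sum>i<n. \<Sum>j<n. \<Sum>m<n. \<Sum>l<n.
          (\<phi>p 0 i * \<psi>m 0 l * c i j * d m l) * (\<phi>m (k - 1 - a) m * \<psi>p a j))"
        unfolding u_def v_def sum_distrib_right unfolding sum_distrib_left by (simp only: mult_ac)
      also have "\<dots> = (\<Sum>i<n. \<Sum>j<n. \<Sum>m<n. \<Sum>l<n. \<Sum>a<k.
          (\<phi>p 0 i * \<psi>m 0 l * c i j * d m l) * (\<phi>m (k - 1 - a) m * \<psi>p a j))"
        by (rule trans[OF sum.swap], rule sum.cong[OF refl], rule trans[OF sum.swap], rule sum.cong[OF refl],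
            rule trans[OF sum.swap], rule sum.cong[OF refl], rule sum.swap)
      also have "\<dots> = (\<Sum>i<n. \<Sum>j<n. \<Sum>m<n. \<Sum>l<n.
          (\<phi>p 0 i * \<psi>m 0 l * c i j * d m l) * (\<Sum>a<k. \<phi>m a m * \<psi>p (k - 1 - a) j))"
      proof -
        have "(\<Sum>a<k. \<phi>m (k - 1 - a) m * \<psi>p a j) = (\<Sum>a<k. \<phi>m a m * \<psi>p (k - 1 - a) j)" for j m
          by (rule sum.reindex_bij_witness[where i = "\<lambda>q. k - 1 - q" and j = "\<lambda>p. k - 1 - p"]) auto
        then show ?thesis by (simp only: flip: sum_distrib_left)
      qed
      finally show ?thesis .
    qed
    then have "bracket (\<lambda>k. \<Sum>a<k. u a * v (k - 1 - a)) = (\<Sum>i<n. \<Sum>j<n. \<Sum>m<n. \<Sum>l<n.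
        (\<phi>p 0 i * \<psi>m 0 l * c i j * d m l) * (?Km m j - ?Kp m j))"
      by (simp only: bracket_sum bracket_mult bracket_cross)
    also have "\<dots> = (\<Sum>i<n. \<Sum>l<n. \<Sum>j<n. \<Sum>m<n.
        (\<phi>p 0 i * \<psi>m 0 l * c i j * d m l) * (?Km m j - ?Kp m j))"
      by (rule sum.cong[OF refl], rule trans[OF sum.cong[OF refl sum.swap]], rule sum.swap)
    also have "\<dots> = (\<Sum>i<n. \<Sum>l<n. \<phi>p 0 i * \<psi>m 0 l * (c i l * ?g - d i l * ?f))"
    proof (rule sum.cong[OF refl], rule sum.cong[OF refl])
      fix i l assume il: "i \<in> {..<n}" "l \<in> {..<n}"
      have "(\<Sum>j<n. \<Sum>m<n. (\<phi>p 0 i * \<psi>m 0 l * c i j * d m l) * (?Km m j - ?Kp m j)) =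
          \<phi>p 0 i * \<psi>m 0 l * ((\<Sum>j<n. \<Sum>m<n. c i j * (?Km m j * d m l)) - (\<Sum>j<n. \<Sum>m<n. d m l * (?Kp m j * c i j)))"
        by (simp add: sum_distrib_left right_diff_distrib sum_subtractf mult_ac)
      also have "(\<Sum>j<n. \<Sum>m<n. d m l * (?Kp m j * c i j)) = (\<Sum>m<n. \<Sum>j<n. d m l * (?Kp m j * c i j))"
        by (rule sum.swap)
      also have "\<dots> = (\<Sum>m<n. d m l * (if i = m then ?f else 0))"
        unfolding sum_distrib_left[symmetric] f c_def
        by (intro sum.cong refl arg_cong2[of _ _ _ _ "(*)"] sum_row_cofactor) (use il in auto)
      also have "\<dots> = d i l * ?f"
        using il by (simp add: if_distrib[of "\<lambda>x. _ * x"] cong: if_cong)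
      also have "(\<Sum>j<n. \<Sum>m<n. c i j * (?Km m j * d m l)) = (\<Sum>j<n. c i j * (if j = l then ?g else 0))"
        unfolding sum_distrib_left[symmetric] g d_def
        by (intro sum.cong refl arg_cong2[of _ _ _ _ "(*)"] sum_col_cofactor) (use il in auto)
      also have "\<dots> = c i l * ?g"
        using il by (simp add: if_distrib[of "\<lambda>x. _ * x"] cong: if_cong)
      finally show "(\<Sum>j<n. \<Sum>m<n. (\<phi>p 0 i * \<psi>m 0 l * c i j * d m l) * (?Km m j - ?Kp m j)) =
          \<phi>p 0 i * \<psi>m 0 l * (c i l * ?g - d i l * ?f)" .
    qed
    finally show ?thesis .
  qed
  also have "?g * (\<Sum>i<n. \<Sum>j<n. \<phi>p 0 i * \<psi>m 0 j * c i j) - ?f * (\<Sum>i<n. \<Sum>j<n. \<phi>p 0 i * \<psi>m 0 j * d i j) -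
      (\<Sum>i<n. \<Sum>l<n. \<phi>p 0 i * \<psi>m 0 l * (c i l * ?g - d i l * ?f)) = 0"
    by (simp add: sum_distrib_left right_diff_distrib sum_subtractf mult_ac)
  finally show "bracket (\<lambda>k. translation_coeff (Suc k) (hirota_shift ?\<tau> ?\<tau>)) = 0" .
qed

end

section \<open>The matrices of the deformed currents\<close>

lemma elementary_sym_insert:
  assumes "finite I" "a \<notin> I"
  shows "elementary_sym (Suc r) x (insert a I) = elementary_sym (Suc r) x I + x a * elementary_sym r x I"
proof -
  have fin: "finite {S. S \<subseteq> I \<and> card S = k}" for k
    using assms(1) by (auto intro: finite_subset[of _ "Pow I"])
  have split: "{S. S \<subseteq> insert a I \<and> card S = Suc r} =
      {S. S \<subseteq> I \<and> card S = Suc r} \<union> insert a ` {S. S \<subseteq> I \<and> card S = r}" (is "?A = ?B \<union> ?C")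
  proof (intro equalityI subsetI)
    fix S assume S: "S \<in> ?A"
    show "S \<in> ?B \<union> ?C"
    proof (cases "a \<in> S")
      case True
      have "finite S" using S assms(1) finite_subset[of S "insert a I"] by simp
      with True S have "S - {a} \<in> {S. S \<subseteq> I \<and> card S = r}" by auto
      moreover have "S = insert a (S - {a})" using True by blast
      ultimately show ?thesis by blast
    qed (use S in auto)
  next
    fix S assume "S \<in> ?B \<union> ?C"
    then show "S \<in> ?A"
    proof
      assume "S \<in> ?C"
      then obtain T where T: "S = insert a T" "T \<subseteq> I" "card T = r" by blast
      then have "finite T" "a \<notin> T" using assms finite_subset[of T I] by auto
      with T show ?thesis by auto
    qed auto
  qed
  have "(\<Sum>S\<in>?C. \<Prod>a\<in>S. x a) = (\<Sum>S | S \<subseteq> I \<and> card S = r. \<Prod>a\<in>insert a S. x a)"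
    by (rule sum.reindex_cong[of "insert a"]) (use assms in \<open>auto simp: inj_on_def insert_ident\<close>)
  also have "\<dots> = x a * elementary_sym r x I"
    unfolding elementary_sym_def sum_distrib_left
  proof (rule sum.cong[OF refl])
    fix S assume "S \<in> {S. S \<subseteq> I \<and> card S = r}"
    then have "finite S" "a \<notin> S" using assms finite_subset[of S I] by auto
    then show "(\<Prod>a\<in>insert a S. x a) = x a * (\<Prod>a\<in>S. x a)" by simp
  qed
  finally have "(\<Sum>S\<in>?C. \<Prod>a\<in>S. x a) = x a * elementary_sym r x I" .
  moreover have "elementary_sym (Suc r) x (insert a I) = (\<Sum>S\<in>?B. \<Prod>a\<in>S. x a) + (\<Sum>S\<in>?C. \<Prod>a\<in>S. x a)"
    unfolding elementary_sym_def split by (rule sum.union_disjoint) (use fin assms(2) in auto)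
  ultimately show ?thesis by (simp add: elementary_sym_def)
qed

lemma elementary_sym_0:
  assumes "finite I"
  shows "elementary_sym 0 x I = 1"
proof -
  have "{S. S \<subseteq> I \<and> card S = 0} = {{}}" by (auto simp: card_eq_0_iff dest: finite_subset[OF _ assms])
  then show ?thesis by (simp add: elementary_sym_def)
qed

lemma elementary_sym_eq_0:
  assumes "finite I" "card I < r"
  shows "elementary_sym r x I = 0"
proof -
  have "{S. S \<subseteq> I \<and> card S = r} = {}" using assms(2) by (auto dest!: card_mono[OF assms(1)])
  then show ?thesis unfolding elementary_sym_def by (simp only: sum.empty)
qed

lemma elementary_sym_card:
  assumes "finite I"
  shows "elementary_sym (card I) x I = (\<Prod>a\<in>I. x a)"
proof -
  have "{S. S \<subseteq> I \<and> card S = card I} = {I}" using card_subset_eq[OF assms] by blast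
  then show ?thesis by (simp add: elementary_sym_def)
qed

lemma finite_msets_size:
  assumes "finite I"
  shows "finite {M. set_mset M \<subseteq> I \<and> size M = s}"
proof (rule finite_subset)
  show "{M. set_mset M \<subseteq> I \<and> size M = s} \<subseteq> mset ` {xs. set xs \<subseteq> I \<and> length xs = s}"
  proof
    fix M assume "M \<in> {M. set_mset M \<subseteq> I \<and> size M = s}"
    moreover obtain xs where "mset xs = M" using ex_mset by blast
    ultimately show "M \<in> mset ` {xs. set xs \<subseteq> I \<and> length xs = s}" by (intro image_eqI[of _ _ xs]) auto
  qed
  show "finite (mset ` {xs. set xs \<subseteq> I \<and> length xs = s})"
    using assms by (intro finite_imageI finite_lists_length_eq)
qed

lemma complete_sym_insert:
  assumes "finite I" "a \<notin> I"
  shows "complete_sym (Suc s) x (insert a I) = complete_sym (Suc s) x I + x a * complete_sym s x (insert a I)"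
proof -
  have split: "{M. set_mset M \<subseteq> insert a I \<and> size M = Suc s} =
      {M. set_mset M \<subseteq> I \<and> size M = Suc s} \<union> add_mset a ` {M. set_mset M \<subseteq> insert a I \<and> size M = s}" (is "?A = ?B \<union> ?C")
  proof (intro equalityI subsetI)
    fix M assume M: "M \<in> ?A"
    show "M \<in> ?B \<union> ?C"
    proof (cases "a \<in># M")
      case True
      then obtain M' where "M = add_mset a M'" by (rule mset_add)
      with M show ?thesis by auto
    qed (use M in auto)
  qed auto
  have "(\<Sum>M\<in>?C. \<Prod>a\<in>#M. x a) = x a * complete_sym s x (insert a I)"
    unfolding complete_sym_def sum_distrib_left
    by (rule sum.reindex_cong[of "add_mset a"]) (auto simp: inj_on_def)
  moreover have "complete_sym (Suc s) x (insert a I) = (\<Sum>M\<in>?B. \<Prod>a\<in>#M. x a) + (\<Sum>M\<in>?C. \<Prod>a\<in>#M. x a)"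
    unfolding complete_sym_def split
    by (rule sum.union_disjoint) (use assms in \<open>auto intro!: finite_msets_size finite_imageI\<close>)
  ultimately show ?thesis by (simp add: complete_sym_def)
qed

lemma complete_sym_0: "complete_sym 0 x I = 1"
proof -
  have "{M. set_mset M \<subseteq> I \<and> size M = 0} = {{#}}" by auto
  then show ?thesis by (simp add: complete_sym_def)
qed

lemma complete_sym_singleton: "complete_sym s x {a} = x a ^ s"
proof -
  have "set_mset M \<subseteq> {a} \<and> size M = s \<longleftrightarrow> M = replicate_mset s a" for M
    using set_mset_subset_singletonD[of M a] by (auto split: if_splits)
  then show ?thesis by (simp add: complete_sym_def)
qed

text \<open>Elementary symmetric polynomials of integer degree, so that the Pascal recursion holds in every degree.\<close>

definition elementary_sym_int :: "int \<Rightarrow> ('a \<Rightarrow> complex) \<Rightarrow> 'a set \<Rightarrow> complex" where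
  "elementary_sym_int d x I = (if d < 0 then 0 else elementary_sym (nat d) x I)"

lemma elementary_sym_int_insert:
  assumes "finite I" "a \<notin> I"
  shows "elementary_sym_int d x (insert a I) = elementary_sym_int d x I + x a * elementary_sym_int (d - 1) x I"
proof (cases "d > 0")
  case True
  then obtain n where "d = int n + 1" using zero_less_imp_eq_int[of d] by (metis Suc_eq_plus1 gr0_implies_Suc of_nat_1 of_nat_add)
  then show ?thesis by (simp add: elementary_sym_int_def nat_add_distrib elementary_sym_insert[OF assms])
next
  case False
  then show ?thesis using assms by (simp add: elementary_sym_int_def elementary_sym_0)
qed

lemma elementary_sym_int_eq_0: "finite I \<Longrightarrow> int (card I) < d \<Longrightarrow> elementary_sym_int d x I = 0"
  by (simp add: elementary_sym_int_def elementary_sym_eq_0)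

context
  fixes \<alpha> \<beta> :: "int \<Rightarrow> complex"
begin

abbreviation cur :: "nat \<Rightarrow> int \<Rightarrow> int \<Rightarrow> complex" where
  "cur \<equiv> current_coeff \<alpha> \<beta>"

definition cur_sum :: "nat \<Rightarrow> int \<Rightarrow> int \<Rightarrow> complex" where
  "cur_sum k i j = (\<Sum>s\<le>k. elementary_sym_int (j - i - int k + int s) (\<lambda>a. - \<alpha> a) {i + 1..j - 1} * complete_sym s \<beta> {i..j})"

lemma cur_off_diagonal:
  assumes "i < j"
  shows "cur k i j = (1 - \<alpha> j * \<beta> j) * cur_sum k i j"
proof -
  let ?d = "\<lambda>s. j - i - int k + int s"
  let ?S = "{s \<in> {..k}. 0 \<le> ?d s \<and> ?d s \<le> j - i - 1}"
  let ?e = "\<lambda>r. elementary_sym r (\<lambda>a. - \<alpha> a) {i + 1..j - 1}" and ?h = "\<lambda>s. complete_sym s \<beta> {i..j}"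
  have "(\<Sum>(r, s) \<in> {(r, s) \<in> {..nat (j - i - 1)} \<times> {..k}. int r - int s = j - i - int k}. ?e r * ?h s) =
      (\<Sum>s\<in>?S. ?e (nat (?d s)) * ?h s)"
  proof (rule sum.reindex_bij_witness[where i = "\<lambda>s. (nat (?d s), s)" and j = snd])
    fix p assume "p \<in> {(r, s) \<in> {..nat (j - i - 1)} \<times> {..k}. int r - int s = j - i - int k}"
    moreover obtain r s where "p = (r, s)" by (rule prod.exhaust)
    ultimately have p: "p = (r, s)" "r \<le> nat (j - i - 1)" "s \<le> k" "?d s = int r" by auto
    then show "(nat (?d (snd p)), snd p) = p" "snd p \<in> ?S" using assms by auto
    show "?e (nat (?d (snd p))) * ?h (snd p) = (case p of (r, s) \<Rightarrow> ?e r * ?h s)" using p by simp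
  qed (use assms in auto)
  also have "\<dots> = cur_sum k i j"
    unfolding cur_sum_def
  proof (rule sum.mono_neutral_cong_left)
    show "\<forall>s \<in> {..k} - ?S. elementary_sym_int (?d s) (\<lambda>a. - \<alpha> a) {i + 1..j - 1} * ?h s = 0"
    proof
      fix s assume "s \<in> {..k} - ?S"
      then have "?d s < 0 \<or> ?d s > j - i - 1" by auto
      then have "elementary_sym_int (?d s) (\<lambda>a. - \<alpha> a) {i + 1..j - 1} = 0"
      proof
        assume "?d s < 0"
        then show ?thesis by (simp add: elementary_sym_int_def)
      next
        assume "?d s > j - i - 1"
        then show ?thesis by (intro elementary_sym_int_eq_0) (use assms in auto)
      qed
      then show "elementary_sym_int (?d s) (\<lambda>a. - \<alpha> a) {i + 1..j - 1} * ?h s = 0" by simp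
    qed
  qed (auto simp: elementary_sym_int_def)
  finally show ?thesis using assms by (simp add: current_coeff_def)
qed

lemma cur_below: "j < i \<Longrightarrow> cur k i j = 0"
  by (simp add: current_coeff_def)

lemma cur_diagonal: "cur k i i = \<beta> i ^ k"
  by (simp add: current_coeff_def)

lemma cur_0: "cur 0 i j = (if i = j then 1 else 0)"
proof -
  have "cur_sum 0 i j = 0" if "i < j"
    unfolding cur_sum_def by (simp, intro disjI1 elementary_sym_int_eq_0) (use that in auto)
  then show ?thesis
    by (cases i j rule: linorder_cases) (simp_all add: cur_below cur_diagonal cur_off_diagonal)
qed

lemma cur_superdiagonal: "cur (Suc k) (j - 1) j = (1 - \<alpha> j * \<beta> j) * complete_sym k \<beta> {j - 1..j}"
proof -
  have "elementary_sym_int r (\<lambda>a. - \<alpha> a) {j..j - 1} = (if r = 0 then 1 else 0)" for r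
    using elementary_sym_int_eq_0[of "{}" r] by (auto simp: elementary_sym_int_def elementary_sym_0 not_less)
  then have "cur_sum (Suc k) (j - 1) j = (\<Sum>s\<le>Suc k. if s = k then complete_sym k \<beta> {j - 1..j} else 0)"
    unfolding cur_sum_def by (intro sum.cong) auto
  then show ?thesis by (simp add: cur_off_diagonal)
qed

text \<open>
  The functions \<open>u\<^sub>i = z (z|\<beta>)\<^sup>i\<^sup>-\<^sup>1 / (z;\<alpha>)\<^sup>i\<close> satisfy \<open>(z - \<beta>\<^sub>i) u\<^sub>i = (1 - \<alpha>\<^sub>i\<^sub>+\<^sub>1 z) u\<^sub>i\<^sub>+\<^sub>1\<close>, and row \<open>i\<close> of the \<open>k\<close>-th
  current matrix expands \<open>z\<^sup>k u\<^sub>i\<close>; hence this recursion between consecutive rows.  The proof avoids the expansions and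
  uses the Pascal recursions of the symmetric polynomials instead.
\<close>

lemma cur_recursion: "cur (Suc k) i j + \<alpha> (i + 1) * cur (Suc k) (i + 1) j = \<beta> i * cur k i j + cur k (i + 1) j"
proof -
  consider "j < i" | "j = i" | "j = i + 1" | "i + 1 < j" by linarith
  then show ?thesis
  proof cases
    case 3
    then have i: "i = j - 1" and i1: "i + 1 = j" by simp_all
    have ins: "{i..j} = insert i {j}" using i by auto
    have sd: "cur (Suc k) i j = (1 - \<alpha> j * \<beta> j) * complete_sym k \<beta> {i..j}" for k
      unfolding i by (rule cur_superdiagonal)
    show ?thesis
    proof (cases k)
      case 0
      then show ?thesis unfolding i1 sd by (simp add: i cur_diagonal cur_0 complete_sym_0)
    next
      case (Suc m)
      have "complete_sym k \<beta> {i..j} = \<beta> j ^ k + \<beta> i * complete_sym m \<beta> {i..j}"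
        unfolding Suc ins using complete_sym_insert[of "{j}" i m \<beta>] i by (simp add: complete_sym_singleton)
      then show ?thesis unfolding i1 sd by (simp add: Suc sd cur_diagonal algebra_simps)
    qed
  next
    case 4
    let ?x = "\<lambda>a. - \<alpha> a" and ?d = "j - i"
    let ?I' = "{i + 2..j - 1}" and ?I = "{i + 1..j - 1}" and ?B' = "{i + 1..j}" and ?B = "{i..j}"
    let ?e = "\<lambda>d. elementary_sym_int d ?x" and ?h = "\<lambda>s. complete_sym s \<beta>"
    have I: "?I = insert (i + 1) ?I'" and B: "?B = insert i ?B'" using 4 by auto
    have e: "?e d ?I = ?e d ?I' - \<alpha> (i + 1) * ?e (d - 1) ?I'" for d
      unfolding I by (subst elementary_sym_int_insert) auto
    have h: "?h (Suc s) ?B = ?h (Suc s) ?B' + \<beta> i * ?h s ?B" for s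
      unfolding B by (rule complete_sym_insert) auto
    have "cur_sum (Suc k) i j = ?e (?d - int (Suc k)) ?I * ?h 0 ?B + (\<Sum>s\<le>k. ?e (?d - int k + int s) ?I * ?h (Suc s) ?B)"
      unfolding cur_sum_def by (subst sum.atMost_Suc_shift) (simp add: algebra_simps)
    also have "\<dots> = ?e (?d - int (Suc k)) ?I * ?h 0 ?B' + (\<Sum>s\<le>k. ?e (?d - int k + int s) ?I * ?h (Suc s) ?B') + \<beta> i * cur_sum k i j"
      by (simp add: h complete_sym_0 distrib_left sum.distrib cur_sum_def sum_distrib_left mult.left_commute)
    also have "?e (?d - int (Suc k)) ?I * ?h 0 ?B' + (\<Sum>s\<le>k. ?e (?d - int k + int s) ?I * ?h (Suc s) ?B') =
        (\<Sum>s\<le>Suc k. ?e (?d - int (Suc k) + int s) ?I * ?h s ?B')"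
      by (subst sum.atMost_Suc_shift) (simp add: algebra_simps)
    also have "\<dots> = (\<Sum>s\<le>Suc k. ?e (?d - int (Suc k) + int s) ?I' * ?h s ?B') - \<alpha> (i + 1) * cur_sum (Suc k) (i + 1) j"
      unfolding e by (simp add: cur_sum_def left_diff_distrib sum_subtractf sum_distrib_left algebra_simps)
    also have "(\<Sum>s\<le>Suc k. ?e (?d - int (Suc k) + int s) ?I' * ?h s ?B') = (\<Sum>s\<le>k. ?e (?d - int (Suc k) + int s) ?I' * ?h s ?B')"
    proof -
      have "?e ?d ?I' = 0" by (rule elementary_sym_int_eq_0) (use 4 in auto)
      then show ?thesis by simp
    qed
    also have "\<dots> = cur_sum k (i + 1) j"
      unfolding cur_sum_def by (simp add: algebra_simps)
    finally have sum_rec: "cur_sum (Suc k) i j = cur_sum k (i + 1) j - \<alpha> (i + 1) * cur_sum (Suc k) (i + 1) j + \<beta> i * cur_sum k i j" .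
    show ?thesis using 4 by (simp add: cur_off_diagonal sum_rec algebra_simps)
  qed (simp_all add: cur_below cur_diagonal)
qed

text \<open>The current matrices are the powers of the first one.  By the recursion the difference \<open>D\<^sub>i\<close> of the two sides in row \<open>i\<close>
  satisfies \<open>D\<^sub>i = - \<alpha>\<^sub>i\<^sub>+\<^sub>1 D\<^sub>i\<^sub>+\<^sub>1\<close>, and it vanishes for \<open>i > j\<close> by triangularity.\<close>

lemma cur_add:
  assumes "c \<le> i" "j \<le> d"
  shows "cur (k + l) i j = (\<Sum>m=c..d. cur k i m * cur l m j)"
  using assms(1)
proof (induction k arbitrary: i)
  case 0
  have "(\<Sum>m=c..d. cur 0 i m * cur l m j) = (if i \<in> {c..d} then cur l i j else 0)"
    by (simp add: cur_0 if_distrib[of "\<lambda>x. x * _"] cong: if_cong)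
  then show ?case using 0 assms(2) by (auto simp: cur_below)
next
  case (Suc k)
  define D where "D i = cur (Suc k + l) i j - (\<Sum>m=c..d. cur (Suc k) i m * cur l m j)" for i
  have step: "D i = - \<alpha> (i + 1) * D (i + 1)" if "c \<le> i" for i
  proof -
    have "D i + \<alpha> (i + 1) * D (i + 1) =
        (cur (Suc (k + l)) i j + \<alpha> (i + 1) * cur (Suc (k + l)) (i + 1) j) -
        (\<Sum>m=c..d. (cur (Suc k) i m + \<alpha> (i + 1) * cur (Suc k) (i + 1) m) * cur l m j)"
      by (simp add: D_def distrib_right sum.distrib sum_distrib_left algebra_simps)
    also have "\<dots> = \<beta> i * (cur (k + l) i j - (\<Sum>m=c..d. cur k i m * cur l m j)) +
        (cur (k + l) (i + 1) j - (\<Sum>m=c..d. cur k (i + 1) m * cur l m j))"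
      unfolding cur_recursion by (simp add: distrib_right sum.distrib sum_distrib_left algebra_simps)
    also have "\<dots> = 0" using Suc.IH that by simp
    finally show ?thesis by (simp add: eq_neg_iff_add_eq_0)
  qed
  have "D i = 0" if "c \<le> i" for i
    using that
  proof (induction "nat (j + 1 - i)" arbitrary: i rule: less_induct)
    case less
    show ?case
    proof (cases "j < i")
      case True
      have "cur (Suc k) i m * cur l m j = 0" for m
        using True by (cases "m < i") (simp_all add: cur_below)
      then have "(\<Sum>m=c..d. cur (Suc k) i m * cur l m j) = 0" by (intro sum.neutral) blast
      then show ?thesis using True by (simp add: D_def cur_below)
    next
      case False
      have "D (i + 1) = 0" by (rule less.hyps) (use False less.prems in auto)
      then show ?thesis using step[OF less.prems] by simp
    qed
  qed
  from this[OF Suc.prems] show ?case by (simp add: D_def)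
qed

text \<open>For \<open>k = 1\<close> only the elementary symmetric polynomial of top degree occurs, a product that can be cut at 0.\<close>

lemma cur_rank_one:
  assumes "i \<le> 0" "0 < j"
  shows "cur 1 i j = (\<Prod>a=i + 1..0. - \<alpha> a) * ((1 - \<alpha> j * \<beta> j) * (\<Prod>a=1..j - 1. - \<alpha> a))"
proof -
  let ?I = "{i + 1..j - 1}"
  have "elementary_sym_int (j - i) (\<lambda>a. - \<alpha> a) ?I = 0"
    by (rule elementary_sym_int_eq_0) (use assms in auto)
  moreover have "elementary_sym_int (j - i - 1) (\<lambda>a. - \<alpha> a) ?I = (\<Prod>a\<in>?I. - \<alpha> a)"
    using elementary_sym_card[of ?I "\<lambda>a. - \<alpha> a"] assms by (simp add: elementary_sym_int_def)
  ultimately have "cur_sum 1 i j = (\<Prod>a\<in>?I. - \<alpha> a)"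
    by (simp add: cur_sum_def complete_sym_0)
  also have "\<dots> = (\<Prod>a=i + 1..0. - \<alpha> a) * (\<Prod>a=1..j - 1. - \<alpha> a)"
  proof -
    have "?I = {i + 1..0} \<union> {1..j - 1}" using assms by auto
    moreover have "(\<Prod>a\<in>{i + 1..0} \<union> {1..j - 1}. - \<alpha> a) = (\<Prod>a=i + 1..0. - \<alpha> a) * (\<Prod>a=1..j - 1. - \<alpha> a)"
      by (rule prod.union_disjoint) auto
    ultimately show ?thesis by simp
  qed
  finally show ?thesis using assms by (simp add: cur_off_diagonal)
qed

end

section \<open>Exponentials of the current matrices\<close>

text \<open>\<open>h_series s\<close> is \<open>\<Sum>\<^sub>m s\<^sub>m h\<^sub>m(t)\<close> and \<open>h_series_inv s\<close> is \<open>\<Sum>\<^sub>m s\<^sub>m h\<^sub>m(-t)\<close>.  For \<open>s\<^sub>m = a\<^sup>m\<close> they are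
  \<open>exp(\<Sum>\<^sub>k t\<^sub>k a\<^sup>k / k)\<close> and its inverse.\<close>

definition h_series :: "(nat \<Rightarrow> complex) \<Rightarrow> nat mfps" where
  "h_series s = Abs_mfps (\<lambda>M. h_coeff M * s (sum_mset M))"

definition h_series_inv :: "(nat \<Rightarrow> complex) \<Rightarrow> nat mfps" where
  "h_series_inv s = Abs_mfps (\<lambda>M. (- 1) ^ size M * h_coeff M * s (sum_mset M))"

lemma mfps_deriv_h_series: "mfps_deriv k (h_series s) = mfps_const (1 / of_nat k) * h_series (\<lambda>m. s (m + k))"
proof (rule mfps_eqI)
  fix M
  have "mfps_coeff (mfps_deriv k (h_series s)) M = (of_nat (count M k + 1) * h_coeff (add_mset k M)) * s (k + sum_mset M)"
    by (simp only: mfps_coeff_deriv h_series_def mfps_coeff_Abs sum_mset.add_mset mult.assoc)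
  then show "mfps_coeff (mfps_deriv k (h_series s)) M = mfps_coeff (mfps_const (1 / of_nat k) * h_series (\<lambda>m. s (m + k))) M"
    unfolding h_coeff_add_mset by (simp add: h_series_def add.commute)
qed

lemma mfps_deriv_h_series_inv:
  "mfps_deriv k (h_series_inv s) = - (mfps_const (1 / of_nat k) * h_series_inv (\<lambda>m. s (m + k)))"
proof (rule mfps_eqI)
  fix M
  have "mfps_coeff (mfps_deriv k (h_series_inv s)) M =
      - ((of_nat (count M k + 1) * h_coeff (add_mset k M)) * ((- 1) ^ size M * s (k + sum_mset M)))"
    by (simp add: mfps_coeff_deriv h_series_inv_def)
  then show "mfps_coeff (mfps_deriv k (h_series_inv s)) M = mfps_coeff (- (mfps_const (1 / of_nat k) * h_series_inv (\<lambda>m. s (m + k)))) M"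
    unfolding h_coeff_add_mset by (simp add: h_series_inv_def mfps_coeff_uminus add.commute mult_ac)
qed

lemma h_series_sum: "h_series (\<lambda>m. \<Sum>x\<in>A. c x * s x m) = (\<Sum>x\<in>A. mfps_const (c x) * h_series (s x))"
  by (rule mfps_eqI) (simp add: h_series_def mfps_coeff_sum sum_distrib_left mult_ac)

lemma h_series_inv_sum: "h_series_inv (\<lambda>m. \<Sum>x\<in>A. c x * s x m) = (\<Sum>x\<in>A. mfps_const (c x) * h_series_inv (s x))"
  by (rule mfps_eqI) (simp add: h_series_inv_def mfps_coeff_sum sum_distrib_left mult_ac)

lemma sum_split_at_0:
  assumes "c \<le> (0::int)" "0 \<le> d"
  shows "(\<Sum>m=c..d. f m) = (\<Sum>m=c..0. f m) + (\<Sum>m=1..d. f m :: 'a :: comm_monoid_add)"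
proof -
  have "{c..d} = {c..0} \<union> {1..d}" using assms by auto
  then show ?thesis by (simp only:) (rule sum.union_disjoint, auto)
qed

text \<open>
  The window \<open>c..d\<close> of indices splits at 0 into the two blocks.  \<open>row_vec\<close> and \<open>col_vec\<close> are the factors of the
  off-diagonal block of the first current matrix, multiplied by powers of the diagonal blocks.
\<close>

locale current_window =
  fixes \<alpha> \<beta> :: "int \<Rightarrow> complex" and c d :: int
  assumes window: "c \<le> 0" "0 \<le> d"
begin

abbreviation A :: "nat \<Rightarrow> int \<Rightarrow> int \<Rightarrow> complex" where
  "A \<equiv> current_coeff \<alpha> \<beta>"

definition col_vec :: "nat \<Rightarrow> int \<Rightarrow> complex" where
  "col_vec p i = (\<Sum>l=c..0. A p i l * (\<Prod>a=l + 1..0. - \<alpha> a))"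

definition row_vec :: "nat \<Rightarrow> int \<Rightarrow> complex" where
  "row_vec q j = (\<Sum>s=1..d. ((1 - \<alpha> s * \<beta> s) * (\<Prod>a=1..s - 1. - \<alpha> a)) * A q s j)"

lemma col_vec_add:
  assumes "c \<le> i"
  shows "col_vec (m + p) i = (\<Sum>l=c..0. A m i l * col_vec p l)"
proof -
  have "col_vec (m + p) i = (\<Sum>l=c..0. \<Sum>r=c..0. A m i r * A p r l * (\<Prod>a=l + 1..0. - \<alpha> a))"
    unfolding col_vec_def
    by (intro sum.cong refl) (use cur_add[of c i _ 0 \<alpha> \<beta> m p] assms in \<open>simp add: sum_distrib_right\<close>)
  also have "\<dots> = (\<Sum>r=c..0. \<Sum>l=c..0. A m i r * A p r l * (\<Prod>a=l + 1..0. - \<alpha> a))"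
    by (rule sum.swap)
  finally show ?thesis by (simp add: col_vec_def sum_distrib_left mult.assoc)
qed

lemma row_vec_add:
  assumes "j \<le> d"
  shows "row_vec (q + m) j = (\<Sum>r=1..d. row_vec q r * A m r j)"
proof -
  have "row_vec (q + m) j = (\<Sum>s=1..d. \<Sum>r=1..d. ((1 - \<alpha> s * \<beta> s) * (\<Prod>a=1..s - 1. - \<alpha> a)) * (A q s r * A m r j))"
    unfolding row_vec_def
    by (intro sum.cong refl) (use cur_add[of 1 _ j d \<alpha> \<beta> q m] assms in \<open>simp add: sum_distrib_left\<close>)
  also have "\<dots> = (\<Sum>r=1..d. \<Sum>s=1..d. ((1 - \<alpha> s * \<beta> s) * (\<Prod>a=1..s - 1. - \<alpha> a)) * (A q s r * A m r j))"
    by (rule sum.swap)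
  finally show ?thesis by (simp add: row_vec_def sum_distrib_right mult.assoc)
qed

text \<open>The off-diagonal block of a power of a block triangular matrix is \<open>\<Sum>\<^sub>p A\<^sub>1\<^sub>1\<^sup>p A\<^sub>1\<^sub>2 A\<^sub>2\<^sub>2\<^sup>k\<^sup>-\<^sup>1\<^sup>-\<^sup>p\<close>.\<close>

lemma current_off_diagonal_block:
  assumes "i \<in> {c..0}" "j \<in> {1..d}"
  shows "A k i j = (\<Sum>p<k. col_vec p i * row_vec (k - 1 - p) j)"
  using assms(1)
proof (induction k arbitrary: i)
  case 0
  then show ?case using assms(2) by (simp add: cur_0)
next
  case (Suc k)
  let ?u = "\<lambda>i. \<Prod>a=i + 1..0. - \<alpha> a" and ?v = "\<lambda>s. (1 - \<alpha> s * \<beta> s) * (\<Prod>a=1..s - 1. - \<alpha> a)"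
  have u: "?u i = col_vec 0 i"
    using Suc.prems by (simp add: col_vec_def cur_0 if_distrib[of "\<lambda>x. x * _"] cong: if_cong)
  have "A (Suc k) i j = (\<Sum>m=c..d. A 1 i m * A k m j)"
    using cur_add[of c i j d \<alpha> \<beta> 1 k] Suc.prems assms(2) by simp
  also have "\<dots> = (\<Sum>m=c..0. A 1 i m * A k m j) + (\<Sum>m=1..d. A 1 i m * A k m j)"
    by (rule sum_split_at_0[OF window])
  also have "(\<Sum>m=1..d. A 1 i m * A k m j) = (\<Sum>m=1..d. ?u i * ?v m * A k m j)"
    by (intro sum.cong refl) (use Suc.prems cur_rank_one[of i _ \<alpha> \<beta>] in simp)
  also have "\<dots> = col_vec 0 i * row_vec k j"
    unfolding u by (simp add: row_vec_def sum_distrib_left mult.assoc)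
  also have "(\<Sum>m=c..0. A 1 i m * A k m j) = (\<Sum>m=c..0. \<Sum>p<k. A 1 i m * (col_vec p m * row_vec (k - 1 - p) j))"
    using Suc.IH by (simp add: sum_distrib_left)
  also have "\<dots> = (\<Sum>p<k. \<Sum>m=c..0. A 1 i m * (col_vec p m * row_vec (k - 1 - p) j))"
    by (rule sum.swap)
  also have "\<dots> = (\<Sum>p<k. col_vec (Suc p) i * row_vec (k - 1 - p) j)"
    using col_vec_add[of i 1] Suc.prems by (simp add: sum_distrib_right mult.assoc)
  finally show ?case by (simp add: sum.lessThan_Suc_shift del: sum.lessThan_Suc)
qed

abbreviation E :: "int \<Rightarrow> int \<Rightarrow> nat mfps" where
  "E i j \<equiv> h_series (\<lambda>m. A m i j)"

abbreviation E_inv :: "int \<Rightarrow> int \<Rightarrow> nat mfps" where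
  "E_inv i j \<equiv> h_series_inv (\<lambda>m. A m i j)"

definition K :: "int \<Rightarrow> int \<Rightarrow> nat mfps" where
  "K i j = (\<Sum>l=c..0. E_inv i l * E l j)"

definition \<phi> :: "nat \<Rightarrow> int \<Rightarrow> nat mfps" where
  "\<phi> p i = h_series_inv (\<lambda>m. col_vec (m + p) i)"

definition \<psi> :: "nat \<Rightarrow> int \<Rightarrow> nat mfps" where
  "\<psi> q j = h_series (\<lambda>m. row_vec (q + m) j)"

lemma deriv_E:
  assumes "c \<le> i" "j \<le> d"
  shows "mfps_deriv k (E i j) = mfps_const (1 / of_nat k) * (\<Sum>r=c..d. mfps_const (A k i r) * E r j)"
proof -
  have "(\<lambda>m. A (m + k) i j) = (\<lambda>m. \<Sum>r=c..d. A k i r * A m r j)"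
    using cur_add[OF assms, of \<alpha> \<beta> k] by (simp add: add.commute[of _ k])
  then show ?thesis by (simp add: mfps_deriv_h_series h_series_sum)
qed

lemma deriv_E_inv:
  assumes "c \<le> i" "l \<le> 0"
  shows "mfps_deriv k (E_inv i l) = - (mfps_const (1 / of_nat k) * (\<Sum>r=c..0. mfps_const (A k r l) * E_inv i r))"
proof -
  have "(\<lambda>m. A (m + k) i l) = (\<lambda>m. \<Sum>r=c..0. A k r l * A m i r)"
    using cur_add[OF assms, of \<alpha> \<beta> _ k] by (simp add: mult.commute)
  then show ?thesis by (simp add: mfps_deriv_h_series_inv h_series_inv_sum)
qed

lemma deriv_\<phi>: "mfps_deriv k (\<phi> p i) = - (mfps_const (1 / of_nat k) * \<phi> (p + k) i)"
  by (simp add: \<phi>_def mfps_deriv_h_series_inv add_ac)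

lemma deriv_\<psi>: "mfps_deriv k (\<psi> q j) = mfps_const (1 / of_nat k) * \<psi> (q + k) j"
  by (simp add: \<psi>_def mfps_deriv_h_series add_ac)

text \<open>The derivative of \<open>exp(-X\<^sub>1\<^sub>1)\<close> cancels the contribution of the diagonal block to the derivative of \<open>(e\<^sup>X)\<^sub>1\<^sub>*\<close>; the
  off-diagonal block of \<open>A\<^sub>k\<close> remains.\<close>

lemma deriv_K:
  assumes i: "i \<in> {c..0}" and j: "j \<in> {c..d}"
  shows "mfps_deriv k (K i j) = mfps_const (1 / of_nat k) * (\<Sum>p<k. \<phi> p i * \<psi> (k - 1 - p) j)"
proof -
  let ?r = "mfps_const (1 / of_nat k) :: nat mfps"
  have E: "mfps_deriv k (E l j) = ?r * ((\<Sum>r=c..0. mfps_const (A k l r) * E r j) + (\<Sum>r=1..d. mfps_const (A k l r) * E r j))"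
    if "l \<in> {c..0}" for l
    using deriv_E[of l j k] that j unfolding sum_split_at_0[OF window] by simp
  have "mfps_deriv k (K i j) = (\<Sum>l=c..0. mfps_deriv k (E_inv i l) * E l j + E_inv i l * mfps_deriv k (E l j))"
    by (simp add: K_def mfps_deriv_sum mfps_deriv_mult)
  also have "\<dots> = ?r * ((\<Sum>l=c..0. \<Sum>r=c..0. E_inv i l * mfps_const (A k l r) * E r j) -
      (\<Sum>l=c..0. \<Sum>r=c..0. E_inv i r * mfps_const (A k r l) * E l j) +
      (\<Sum>l=c..0. \<Sum>r=1..d. E_inv i l * mfps_const (A k l r) * E r j))"
    using i by (simp add: E deriv_E_inv sum_distrib_left sum_distrib_right distrib_left sum.distrib sum_subtractf
        right_diff_distrib mult_ac sum_negf)
  also have "(\<Sum>l=c..0. \<Sum>r=c..0. E_inv i l * mfps_const (A k l r) * E r j) =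
      (\<Sum>l=c..0. \<Sum>r=c..0. E_inv i r * mfps_const (A k r l) * E l j)"
    by (rule sum.swap)
  also have "(\<Sum>l=c..0. \<Sum>r=1..d. E_inv i l * mfps_const (A k l r) * E r j) =
      (\<Sum>l=c..0. \<Sum>r=1..d. \<Sum>p<k. (mfps_const (col_vec p l) * E_inv i l) * (mfps_const (row_vec (k - 1 - p) r) * E r j))"
  proof (intro sum.cong refl)
    fix l r assume "l \<in> {c..0}" "r \<in> {1..d}"
    have const_sum: "mfps_const (\<Sum>p<k. f p) = (\<Sum>p<k. mfps_const (f p) :: nat mfps)" for f
      by (rule mfps_eqI) (simp add: mfps_coeff_const mfps_coeff_sum)
    have "E_inv i l * mfps_const (A k l r) * E r j =
        E_inv i l * (\<Sum>p<k. mfps_const (col_vec p l) * mfps_const (row_vec (k - 1 - p) r)) * E r j"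
      unfolding current_off_diagonal_block[OF \<open>l \<in> {c..0}\<close> \<open>r \<in> {1..d}\<close>] const_sum mfps_const_mult ..
    also have "\<dots> = (\<Sum>p<k. (mfps_const (col_vec p l) * E_inv i l) * (mfps_const (row_vec (k - 1 - p) r) * E r j))"
      unfolding sum_distrib_left sum_distrib_right by (intro sum.cong refl) (simp only: mult_ac)
    finally show "E_inv i l * mfps_const (A k l r) * E r j =
        (\<Sum>p<k. (mfps_const (col_vec p l) * E_inv i l) * (mfps_const (row_vec (k - 1 - p) r) * E r j))" .
  qed
  also have "\<dots> = (\<Sum>p<k. (\<Sum>l=c..0. mfps_const (col_vec p l) * E_inv i l) * (\<Sum>r=1..d. mfps_const (row_vec (k - 1 - p) r) * E r j))"
    unfolding sum_product
    by (rule trans[OF sum.cong[OF refl sum.swap]], rule sum.swap)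
  also have "\<dots> = (\<Sum>p<k. \<phi> p i * \<psi> (k - 1 - p) j)"
  proof (intro sum.cong refl arg_cong2[of _ _ _ _ "(*)"])
    show "(\<Sum>l=c..0. mfps_const (col_vec p l) * E_inv i l) = \<phi> p i" for p
      unfolding \<phi>_def using col_vec_add[of i _ p] i by (simp add: h_series_inv_sum[symmetric] mult.commute)
    show "(\<Sum>r=1..d. mfps_const (row_vec q r) * E r j) = \<psi> q j" for q
      unfolding \<psi>_def using row_vec_add[of j q] j by (simp add: h_series_sum[symmetric])
  qed
  finally show ?thesis by simp
qed

lemma KP_tau_function_minor:
  assumes C: "\<And>b. b < n \<Longrightarrow> C b \<in> {c..d}" and n: "1 - int n \<ge> c"
  shows "KP_tau_function (det (fun_mat n (\<lambda>a b. K (- int a) (C b))))"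
proof -
  \<comment> \<open>Outside the minor the equations of \<open>rank_one_flow\<close> hold for zero functions.\<close>
  let ?K = "\<lambda>a b. if a < n \<and> b < n then K (- int a) (C b) else 0"
  let ?\<phi> = "\<lambda>p a. if a < n then \<phi> p (- int a) else 0"
  let ?\<psi> = "\<lambda>q b. if b < n then \<psi> q (C b) else 0"
  interpret rank_one_flow ?K ?\<phi> ?\<psi>
  proof
    show "mfps_deriv k (?K a b) = mfps_const (1 / of_nat k) * (\<Sum>p<k. ?\<phi> p a * ?\<psi> (k - 1 - p) b)" for k a b
      using deriv_K[of "- int a" "C b" k] C[of b] n by auto
    show "mfps_deriv k (?\<phi> p a) = - (mfps_const (1 / of_nat k) * ?\<phi> (p + k) a)" for k p a
      by (simp add: deriv_\<phi>)
    show "mfps_deriv k (?\<psi> q b) = mfps_const (1 / of_nat k) * ?\<psi> (q + k) b" for k q b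
      by (simp add: deriv_\<psi>)
  qed
  have "fun_mat n ?K = fun_mat n (\<lambda>a b. K (- int a) (C b))" by (rule eq_matI) auto
  then show ?thesis using KP_tau_function_det[of n] by simp
qed

text \<open>\<open>K\<close> is a product of matrices, and its factor \<open>exp(-X\<^sub>1\<^sub>1)\<close> is triangular with the diagonal entries \<open>exp(-\<Sum>\<^sub>k t\<^sub>k \<beta>\<^sub>i\<^sup>k / k)\<close>.\<close>

lemma det_K:
  assumes n: "1 - int n = c"
  shows "det (fun_mat n (\<lambda>a b. K (- int a) (C b))) =
    (\<Prod>a<n. h_series_inv (\<lambda>m. \<beta> (- int a) ^ m)) * det (fun_mat n (\<lambda>a b. E (- int a) (C b)))"
proof -
  let ?L = "fun_mat n (\<lambda>a b. E_inv (- int a) (- int b))" and ?E = "fun_mat n (\<lambda>a b. E (- int a) (C b))"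
  have L: "E_inv i j = 0" if "j < i" for i j
    by (rule mfps_eqI) (simp add: h_series_inv_def cur_below[OF that])
  have "fun_mat n (\<lambda>a b. K (- int a) (C b)) = ?L * ?E"
  proof (rule eq_matI)
    fix a b assume "a < dim_row (?L * ?E)" "b < dim_col (?L * ?E)"
    then have ab: "a < n" "b < n" by simp_all
    have "K (- int a) (C b) = (\<Sum>l<n. E_inv (- int a) (- int l) * E (- int l) (C b))"
      unfolding K_def
      by (rule sum.reindex_bij_witness[where i = "\<lambda>l. - int l" and j = "\<lambda>l. nat (- l)"]) (use n in auto)
    then show "fun_mat n (\<lambda>a b. K (- int a) (C b)) $$ (a, b) = (?L * ?E) $$ (a, b)"
      using ab by (simp add: scalar_prod_def atLeast0LessThan)
  qed simp_all
  moreover have "det ?L = (\<Prod>a<n. h_series_inv (\<lambda>m. \<beta> (- int a) ^ m))"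
  proof -
    have "det ?L = prod_list (diag_mat ?L)"
      by (rule det_lower_triangular[of n]) (auto simp: L)
    also have "\<dots> = (\<Prod>a<n. h_series_inv (\<lambda>m. \<beta> (- int a) ^ m))"
      unfolding prod_list_diag_prod by (simp add: cur_diagonal atLeast0LessThan)
    finally show ?thesis .
  qed
  ultimately show ?thesis
    using det_mult[of ?L n ?E] by simp
qed

end

section \<open>Fermions on the Fock space\<close>

lemma maya_eqI: "occupied S = occupied T \<Longrightarrow> S = T"
  by (simp add: occupied_inject)

lemma occupied_insert [simp]: "occupied (maya_insert j S) = insert j (occupied S)"
  by (rule maya_insert.rep_eq)

lemma occupied_remove [simp]: "occupied (maya_remove j S) = occupied S - {j}"
  by (rule maya_remove.rep_eq)

lemma maya_sign_remove:
  "maya_sign j (maya_remove i S) = (if i \<in> occupied S \<and> j < i then - maya_sign j S else maya_sign j S)"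
proof (cases "i \<in> occupied S \<and> j < i")
  case True
  have "finite {k \<in> occupied S. k > j}"
    by (rule finite_subset[OF _ finite_occupied_atLeast[of S j]]) auto
  moreover have "{k \<in> occupied S. k > j} = insert i {k \<in> occupied S - {i}. k > j}" using True by auto
  ultimately have "card {k \<in> occupied S. k > j} = Suc (card {k \<in> occupied S - {i}. k > j})"
    by (metis (no_types, lifting) card_insert_disjoint finite_insert Diff_iff insertI1 mem_Collect_eq)
  then show ?thesis using True by (simp add: maya_sign_def)
next
  case False
  then have "{k \<in> occupied S. k > j} = {k \<in> occupied S - {i}. k > j}" by auto
  then show ?thesis unfolding maya_sign_def occupied_remove using False by simp
qed

lemma maya_insert_remove: "i \<in> occupied S \<Longrightarrow> maya_insert i (maya_remove i S) = S"
  by (rule maya_eqI) auto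

lemma maya_remove_insert: "i \<notin> occupied S \<Longrightarrow> maya_remove i (maya_insert i S) = S"
  by (rule maya_eqI) auto

lemma maya_sign_insert:
  "maya_sign j (maya_insert i S) = (if i \<notin> occupied S \<and> j < i then - maya_sign j S else maya_sign j S)"
proof (cases "i \<in> occupied S")
  case True
  then have "maya_insert i S = S" by (intro maya_eqI) auto
  then show ?thesis using True by simp
next
  case False
  then show ?thesis using maya_sign_remove[of j i "maya_insert i S"] by (auto simp: maya_remove_insert)
qed

lemma maya_sign_square: "maya_sign j S * maya_sign j S = 1"
  by (simp add: maya_sign_def flip: power_add)

lemma lookup_scale [simp]: "Poly_Mapping.lookup (c *\<^sub>F v) S = c * Poly_Mapping.lookup v S" for v :: fock
  by (simp add: Poly_Mapping.map.rep_eq when_def)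

lemma lookup_psi:
  "Poly_Mapping.lookup (psi j v) S =
    (if j \<in> occupied S then maya_sign j S * Poly_Mapping.lookup v (maya_remove j S) else 0)"
proof -
  let ?K = "{T \<in> Poly_Mapping.keys v. j \<notin> occupied T}"
  have "Poly_Mapping.lookup (psi j v) S =
      (\<Sum>T\<in>?K. if maya_insert j T = S then maya_sign j T * Poly_Mapping.lookup v T else 0)"
    unfolding psi_def lookup_sum by (intro sum.cong refl) (simp add: lookup_single when_def)
  also have "\<dots> = (if j \<in> occupied S then maya_sign j S * Poly_Mapping.lookup v (maya_remove j S) else 0)"
  proof (cases "j \<in> occupied S")
    case True
    have "(\<Sum>T\<in>?K. if maya_insert j T = S then maya_sign j T * Poly_Mapping.lookup v T else 0) =
        (\<Sum>T\<in>?K. if T = maya_remove j S then maya_sign j T * Poly_Mapping.lookup v T else 0)"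
      by (intro sum.cong refl if_cong) (use True in \<open>auto simp: maya_insert_remove maya_remove_insert\<close>)
    then show ?thesis using True by (simp add: maya_sign_remove in_keys_iff)
  qed (auto intro!: sum.neutral)
  finally show ?thesis .
qed

lemma lookup_psi_star:
  "Poly_Mapping.lookup (psi_star j v) S =
    (if j \<notin> occupied S then maya_sign j S * Poly_Mapping.lookup v (maya_insert j S) else 0)"
proof -
  let ?K = "{T \<in> Poly_Mapping.keys v. j \<in> occupied T}"
  have "Poly_Mapping.lookup (psi_star j v) S =
      (\<Sum>T\<in>?K. if maya_remove j T = S then maya_sign j T * Poly_Mapping.lookup v T else 0)"
    unfolding psi_star_def lookup_sum by (intro sum.cong refl) (simp add: lookup_single when_def)
  also have "\<dots> = (if j \<notin> occupied S then maya_sign j S * Poly_Mapping.lookup v (maya_insert j S) else 0)"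
  proof (cases "j \<notin> occupied S")
    case True
    have "(\<Sum>T\<in>?K. if maya_remove j T = S then maya_sign j T * Poly_Mapping.lookup v T else 0) =
        (\<Sum>T\<in>?K. if T = maya_insert j S then maya_sign j T * Poly_Mapping.lookup v T else 0)"
      by (intro sum.cong refl if_cong) (use True in \<open>auto simp: maya_insert_remove maya_remove_insert\<close>)
    then show ?thesis using True by (simp add: maya_sign_insert in_keys_iff)
  qed (auto intro!: sum.neutral)
  finally show ?thesis .
qed

lemma psi_add: "psi j (u + v) = psi j u + psi j v"
  by (rule poly_mapping_eqI) (simp add: lookup_psi lookup_add distrib_left)

lemma psi_uminus: "psi j (- v) = - psi j v"
  by (rule poly_mapping_eqI) (simp add: lookup_psi)

lemma psi_scale: "psi j (c *\<^sub>F v) = c *\<^sub>F psi j v"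
  by (rule poly_mapping_eqI) (simp add: lookup_psi)

lemma psi_sum: "psi j (sum f A) = (\<Sum>x\<in>A. psi j (f x))"
  by (induction A rule: infinite_finite_induct) (auto simp: psi_add)

lemma scale_add: "c *\<^sub>F (u + v) = c *\<^sub>F u + c *\<^sub>F v" for u v :: fock
  by (rule poly_mapping_eqI) (simp add: lookup_add distrib_left)

lemma psi_anticommute: "psi i (psi j v) = - psi j (psi i v)"
proof (rule poly_mapping_eqI)
  fix S
  have "maya_remove i (maya_remove j S) = maya_remove j (maya_remove i S)" by (rule maya_eqI) auto
  then show "Poly_Mapping.lookup (psi i (psi j v)) S = Poly_Mapping.lookup (- psi j (psi i v)) S"
    by (auto simp: lookup_psi maya_sign_remove)
qed

lemma psi_star_psi: "psi_star j (psi c v) = (if j = c then v else 0) - psi c (psi_star j v)"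
proof (rule poly_mapping_eqI)
  fix S
  have "maya_remove c (maya_insert j S) = maya_insert j (maya_remove c S)" if "j \<noteq> c"
    by (rule maya_eqI) (use that in auto)
  then show "Poly_Mapping.lookup (psi_star j (psi c v)) S =
      Poly_Mapping.lookup ((if j = c then v else 0) - psi c (psi_star j v)) S"
    using maya_sign_square[of c S]
    by (auto simp: lookup_psi lookup_psi_star lookup_minus maya_sign_remove maya_sign_insert maya_remove_insert
        maya_insert_remove simp flip: mult.assoc)
qed

lemma normal_ordered_add: "normal_ordered i j (u + v) = normal_ordered i j u + normal_ordered i j v"
  by (rule poly_mapping_eqI) (simp add: normal_ordered_def lookup_psi lookup_psi_star lookup_add distrib_left)

lemma normal_ordered_scale: "normal_ordered i j (c *\<^sub>F v) = c *\<^sub>F normal_ordered i j v"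
  by (rule poly_mapping_eqI) (simp add: normal_ordered_def lookup_psi lookup_psi_star)

text \<open>Normal ordering changes \<open>\<psi>\<^sub>i \<psi>\<^sub>j\<^sup>*\<close> by a scalar, so the commutator with \<open>\<psi>\<^sub>c\<close> does not depend on it.\<close>

lemma normal_ordered_psi: "normal_ordered i j (psi c v) = psi c (normal_ordered i j v) + (if j = c then psi i v else 0)"
proof (cases "i > 0")
  case True
  have "psi i (psi_star j (psi c v)) = psi i (if j = c then v else 0) + psi c (psi i (psi_star j v))"
    unfolding psi_star_psi using psi_add[of i "if j = c then v else 0" "- psi c (psi_star j v)"] psi_anticommute[of i c]
    by (simp add: psi_uminus)
  then show ?thesis using True by (simp add: normal_ordered_def)
next
  case False
  have "psi_star j (psi i (psi c v)) = - psi_star j (psi c (psi i v))"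
    unfolding psi_anticommute[of i c] by (rule poly_mapping_eqI) (simp add: lookup_psi_star)
  then show ?thesis using False by (simp add: normal_ordered_def psi_star_psi[of j c] psi_uminus)
qed

lemma Sum_any_hom:
  assumes "finite {x. g x \<noteq> 0}" "f 0 = 0" "\<And>x y. f (x + y) = f x + f y"
  shows "f (Sum_any g) = Sum_any (\<lambda>x. f (g x))"
proof -
  have "f (sum g A) = (\<Sum>x\<in>A. f (g x))" for A
    by (induction A rule: infinite_finite_induct) (simp_all add: assms(2,3))
  then have "f (Sum_any g) = (\<Sum>x | g x \<noteq> 0. f (g x))" by (simp add: Sum_any.expand_set)
  also have "\<dots> = Sum_any (\<lambda>x. f (g x))"
    by (rule Sum_any.expand_superset[symmetric, OF assms(1)]) (auto simp: assms(2))
  finally show ?thesis .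
qed

lemma current_add: "current \<alpha> \<beta> k (u + v) = current \<alpha> \<beta> k u + current \<alpha> \<beta> k v"
  unfolding current_def
  by (subst Sum_any.distrib[symmetric, OF finite_current_terms finite_current_terms])
     (simp add: case_prod_unfold normal_ordered_add scale_add)

lemma current_scale: "current \<alpha> \<beta> k (c *\<^sub>F v) = c *\<^sub>F current \<alpha> \<beta> k v"
proof -
  have "c *\<^sub>F current \<alpha> \<beta> k v = Sum_any (\<lambda>x. c *\<^sub>F (case x of (i, j) \<Rightarrow> current_coeff \<alpha> \<beta> k i j *\<^sub>F normal_ordered i j v))"
    unfolding current_def by (rule Sum_any_hom[OF finite_current_terms]) (simp_all add: scale_add)
  also have "\<dots> = current \<alpha> \<beta> k (c *\<^sub>F v)"
    unfolding current_def normal_ordered_scale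
    by (rule arg_cong[of _ _ Sum_any], rule ext) (auto intro!: poly_mapping_eqI)
  finally show ?thesis ..
qed

lemma current_sum: "current \<alpha> \<beta> k (sum f A) = (\<Sum>x\<in>A. current \<alpha> \<beta> k (f x))"
  by (induction A rule: infinite_finite_induct) (auto simp: current_add current_zero)

text \<open>The commutator of \<open>J\<^sub>k\<close> with \<open>\<psi>\<^sub>e\<close> is column \<open>e\<close> of the current matrix.  It is finite on vectors in which
  every sufficiently low site is occupied.\<close>

lemma current_psi:
  assumes v: "\<And>S. S \<in> Poly_Mapping.keys v \<Longrightarrow> {..<c} \<subseteq> occupied S" and e: "e \<le> d"
  shows "current \<alpha> \<beta> k (psi e v) = psi e (current \<alpha> \<beta> k v) + (\<Sum>i=c..d. current_coeff \<alpha> \<beta> k i e *\<^sub>F psi i v)"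
proof -
  let ?A = "current_coeff \<alpha> \<beta> k"
  let ?F = "\<lambda>(i, j). ?A i j *\<^sub>F normal_ordered i j v"
  let ?G = "\<lambda>(i, j). ?A i j *\<^sub>F (if j = e then psi i v else 0)"
  have zero: "?A i e *\<^sub>F psi i v = 0" if "i \<notin> {c..d}" for i
  proof (cases "i < c")
    case True
    then have "psi i v = 0" using psi_nonzero v by blast
    then show ?thesis by simp
  next
    case False
    with that e have "?A i e = 0" by (simp add: cur_below)
    then show ?thesis by simp
  qed
  have supp: "{x. ?G x \<noteq> 0} \<subseteq> (\<lambda>i. (i, e)) ` {c..d}"
  proof
    fix x assume x: "x \<in> {x. ?G x \<noteq> 0}"
    obtain i j where ij: "x = (i, j)" by (rule prod.exhaust)
    with x have "j = e" by (auto split: if_splits)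
    moreover from this x ij zero[of i] have "i \<in> {c..d}" by auto
    ultimately show "x \<in> (\<lambda>i. (i, e)) ` {c..d}" using ij by blast
  qed
  have finG: "finite {x. ?G x \<noteq> 0}" by (rule finite_subset[OF supp]) simp
  have psiF: "psi e (Sum_any ?F) = Sum_any (\<lambda>x. psi e (?F x))"
    by (rule Sum_any_hom[OF finite_current_terms]) (simp_all add: psi_add)
  have "finite {x. psi e (?F x) \<noteq> 0}"
    by (rule finite_subset[OF _ finite_current_terms[of \<alpha> \<beta> k v]]) auto
  then have "Sum_any (\<lambda>x. psi e (?F x) + ?G x) = psi e (Sum_any ?F) + Sum_any ?G"
    using finG by (simp only: Sum_any.distrib psiF)
  moreover have "Sum_any ?G = (\<Sum>i=c..d. ?A i e *\<^sub>F psi i v)"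
  proof -
    have "Sum_any ?G = (\<Sum>x\<in>(\<lambda>i. (i, e)) ` {c..d}. ?G x)"
      by (rule Sum_any.expand_superset[OF _ supp]) simp
    also have "\<dots> = (\<Sum>i=c..d. ?A i e *\<^sub>F psi i v)"
      by (subst sum.reindex) (auto simp: inj_on_def)
    finally show ?thesis .
  qed
  moreover have "current \<alpha> \<beta> k (psi e v) = Sum_any (\<lambda>x. psi e (?F x) + ?G x)"
    unfolding current_def
    by (rule arg_cong[of _ _ Sum_any], rule ext) (simp add: case_prod_unfold normal_ordered_psi scale_add psi_scale)
  ultimately show ?thesis by (simp add: current_def)
qed

text \<open>The shifted vacua \<open>|-n\<rangle>\<close>, and the vectors \<open>v\<^bsub>l1\<^esub> \<and> v\<^bsub>l2\<^esub> \<and> \<dots> \<and> |-n\<rangle>\<close>.\<close>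

definition shifted_vacuum_maya :: "nat \<Rightarrow> maya" where
  "shifted_vacuum_maya n = Abs_maya {..- int n}"

definition wedge :: "nat \<Rightarrow> int list \<Rightarrow> fock" where
  "wedge n l = foldr psi l (Poly_Mapping.single (shifted_vacuum_maya n) 1)"

lemma wedge_Nil: "wedge n [] = Poly_Mapping.single (shifted_vacuum_maya n) 1"
  by (simp add: wedge_def)

lemma wedge_Cons: "wedge n (x # l) = psi x (wedge n l)"
  by (simp add: wedge_def)

lemma occupied_shifted_vacuum [simp]: "occupied (shifted_vacuum_maya n) = {..- int n}"
proof -
  have "{..0} - {..- int n} = {- int n + 1..0}" "{..- int n} \<inter> {1..} = {}" by auto
  then have "{..- int n} \<in> {S. finite (S \<inter> {1..}) \<and> finite ({..0} - S)}"
    by (simp only: mem_Collect_eq finite.emptyI finite_atLeastAtMost_int simp_thms)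
  then show ?thesis unfolding shifted_vacuum_maya_def by (rule Abs_maya_inverse)
qed

lemma keys_psi:
  assumes "S \<in> Poly_Mapping.keys (psi j v)"
  shows "j \<in> occupied S" "maya_remove j S \<in> Poly_Mapping.keys v"
  using assms by (auto simp: in_keys_iff lookup_psi split: if_splits)

lemma keys_wedge: "S \<in> Poly_Mapping.keys (wedge n l) \<Longrightarrow> occupied S = set l \<union> {..- int n}"
proof (induction l arbitrary: S)
  case (Cons x l)
  then have x: "x \<in> occupied S" and "maya_remove x S \<in> Poly_Mapping.keys (wedge n l)"
    using keys_psi[OF Cons.prems[unfolded wedge_Cons]] by simp_all
  from Cons.IH[OF this(2)] have "occupied S - {x} = set l \<union> {..- int n}" by simp
  with x show ?case by auto
qed (simp add: wedge_Nil)

text \<open>Among the normally ordered products only \<open>- \<psi>\<^sub>i\<^sup>* \<psi>\<^sub>i\<close> for the \<open>n\<close> sites that are empty in \<open>|-n\<rangle>\<close> but occupied in the vacuum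
  contribute.\<close>

lemma current_shifted_vacuum:
  "current \<alpha> \<beta> k (wedge n []) = (- (\<Sum>a<n. \<beta> (- int a) ^ k)) *\<^sub>F wedge n []"
proof -
  let ?v = "wedge n []"
  let ?F = "\<lambda>(i, j). current_coeff \<alpha> \<beta> k i j *\<^sub>F normal_ordered i j ?v"
  have star: "psi_star j ?v = 0" if "j > - int n" for j
    using psi_star_nonzero[of j ?v] that by (auto simp: wedge_Nil)
  have F: "?F (i, j) = (if i = j \<and> i \<in> {1 - int n..0} then - (\<beta> i ^ k) *\<^sub>F ?v else 0)" for i j
  proof (cases "j < i")
    case False
    consider "i > 0" | "i \<le> - int n" | "i \<in> {1 - int n..0}" by force
    then show ?thesis
    proof cases
      case 1
      with False star[of j] show ?thesis by (simp add: normal_ordered_def)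
    next
      case 2
      then have "psi i ?v = 0" using psi_nonzero[of i ?v] by (auto simp: wedge_Nil)
      with 2 show ?thesis by (simp add: normal_ordered_def)
    next
      case 3
      with False star[of j] have "normal_ordered i j ?v = (if i = j then - ?v else 0)"
        by (simp add: normal_ordered_def psi_star_psi)
      then show ?thesis using 3 by (auto simp: cur_diagonal intro!: poly_mapping_eqI)
    qed
  qed (simp add: cur_below)
  have "current \<alpha> \<beta> k ?v = (\<Sum>x\<in>(\<lambda>a. (- int a, - int a)) ` {..<n}. ?F x)"
    unfolding current_def
  proof (rule Sum_any.expand_superset)
    show "{x. ?F x \<noteq> 0} \<subseteq> (\<lambda>a. (- int a, - int a)) ` {..<n}"
    proof
      fix x assume "x \<in> {x. ?F x \<noteq> 0}"
      then obtain i where "x = (i, i)" "i \<in> {1 - int n..0}"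
        using F by (cases x) (simp split: if_splits)
      then show "x \<in> (\<lambda>a. (- int a, - int a)) ` {..<n}" by (intro image_eqI[of _ _ "nat (- i)"]) auto
    qed
  qed simp
  also have "\<dots> = (\<Sum>a<n. ?F (- int a, - int a))"
    by (subst sum.reindex) (auto simp: inj_on_def)
  also have "\<dots> = (\<Sum>a<n. - (\<beta> (- int a) ^ k) *\<^sub>F ?v)"
    unfolding F by (intro sum.cong) auto
  also have "\<dots> = (- (\<Sum>a<n. \<beta> (- int a) ^ k)) *\<^sub>F ?v"
    by (rule poly_mapping_eqI) (simp add: lookup_sum sum_distrib_right sum_negf)
  finally show ?thesis .
qed

text \<open>A current acts as a derivation on wedge products, up to the scalar by which it acts on the shifted vacuum.\<close>

lemma current_wedge:
  assumes "set l \<subseteq> {..d}"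
  shows "current \<alpha> \<beta> k (wedge n l) =
    (\<Sum>q<length l. \<Sum>i=1 - int n..d. current_coeff \<alpha> \<beta> k i (l ! q) *\<^sub>F wedge n (l[q := i])) +
    (- (\<Sum>a<n. \<beta> (- int a) ^ k)) *\<^sub>F wedge n l"
proof -
  define b where "b = - (\<Sum>a<n. \<beta> (- int a) ^ k)"
  have "current \<alpha> \<beta> k (wedge n l) =
      (\<Sum>q<length l. \<Sum>i=1 - int n..d. current_coeff \<alpha> \<beta> k i (l ! q) *\<^sub>F wedge n (l[q := i])) + b *\<^sub>F wedge n l"
    using assms
  proof (induction l)
    case Nil
    have "current \<alpha> \<beta> k (wedge n []) = b *\<^sub>F wedge n []"
      unfolding b_def by (rule current_shifted_vacuum)
    then show ?case by simp
  next
    case (Cons x l)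
    have low: "{..<1 - int n} \<subseteq> occupied S" if "S \<in> Poly_Mapping.keys (wedge n l)" for S
    proof -
      have "{..<1 - int n} \<subseteq> {..- int n}" by auto
      then show ?thesis unfolding keys_wedge[OF that] by blast
    qed
    have "x \<le> d" using Cons.prems by simp
    have "current \<alpha> \<beta> k (wedge n (x # l)) = psi x (current \<alpha> \<beta> k (wedge n l)) +
        (\<Sum>i=1 - int n..d. current_coeff \<alpha> \<beta> k i x *\<^sub>F psi i (wedge n l))"
      unfolding wedge_Cons by (rule current_psi[OF low \<open>x \<le> d\<close>])
    also have "current \<alpha> \<beta> k (wedge n l) =
        (\<Sum>q<length l. \<Sum>i=1 - int n..d. current_coeff \<alpha> \<beta> k i (l ! q) *\<^sub>F wedge n (l[q := i])) + b *\<^sub>F wedge n l"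
      using Cons by simp
    also have "psi x \<dots> = (\<Sum>q<length l. \<Sum>i=1 - int n..d. current_coeff \<alpha> \<beta> k i (l ! q) *\<^sub>F wedge n (x # l[q := i])) +
        b *\<^sub>F wedge n (x # l)"
      by (simp only: psi_add psi_sum psi_scale wedge_Cons)
    finally show ?case
      unfolding list.size(4) sum.lessThan_Suc_shift add_Suc_right add_0_right nth_Cons_0 nth_Cons_Suc list_update.simps nat.case
      by (simp only: wedge_Cons add.assoc add.commute add.left_commute)
  qed
  then show ?thesis by (simp only: b_def)
qed

text \<open>Wedge products are alternating.\<close>

lemma psi_foldr_swap: "psi x (foldr psi l (psi y v)) = - psi y (foldr psi l (psi x v))"
proof (induction l)
  case Nil
  then show ?case by (simp add: psi_anticommute[of x y])
next
  case (Cons z l)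
  have "psi x (psi z (foldr psi l (psi y v))) = - psi z (psi x (foldr psi l (psi y v)))"
    by (rule psi_anticommute)
  also have "\<dots> = psi z (psi y (foldr psi l (psi x v)))"
    unfolding Cons by (simp add: psi_uminus)
  also have "\<dots> = - psi y (psi z (foldr psi l (psi x v)))"
    by (rule psi_anticommute)
  finally show ?case by simp
qed

lemma foldr_psi_uminus: "foldr psi l (- v) = - foldr psi l v"
  by (induction l) (simp_all add: psi_uminus)


lemma wedge_swap: "wedge n (k @ x # l @ y # m) = - wedge n (k @ y # l @ x # m)"
  unfolding wedge_def by (simp add: psi_foldr_swap[of x l y] foldr_psi_uminus)

lemma wedge_transpose:
  assumes "a < N" "b < N" "a \<noteq> b"
  shows "wedge n (map (f \<circ> Transposition.transpose a b) [0..<N]) = - wedge n (map f [0..<N])"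
proof -
  have *: "wedge n (map (f \<circ> Transposition.transpose a b) [0..<N]) = - wedge n (map f [0..<N])"
    if "a < b" "b < N" for a b
  proof -
    have "[0..<N] = [0..<a] @ [a..<N]" using that upt_add_eq_append[of 0 a "N - a"] by simp
    also have "[a..<N] = a # [Suc a..<N]" using that by (intro upt_conv_Cons) simp
    also have "[Suc a..<N] = [Suc a..<b] @ [b..<N]" using that upt_add_eq_append[of "Suc a" b "N - b"] by simp
    also have "[b..<N] = b # [Suc b..<N]" using that by (intro upt_conv_Cons) simp
    finally have l: "[0..<N] = [0..<a] @ a # [Suc a..<b] @ b # [Suc b..<N]" .
    have same: "map (f \<circ> Transposition.transpose a b) xs = map f xs" if "a \<notin> set xs" "b \<notin> set xs" for xs
      using that by (auto simp: Transposition.transpose_def)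
    have swapped: "map (f \<circ> Transposition.transpose a b) [0..<N] =
        map f [0..<a] @ f b # map f [Suc a..<b] @ f a # map f [Suc b..<N]"
      unfolding l map_append list.map using that by (simp add: same)
    have original: "map f [0..<N] = map f [0..<a] @ f a # map f [Suc a..<b] @ f b # map f [Suc b..<N]"
      unfolding l map_append list.map ..
    show ?thesis unfolding swapped original by (rule wedge_swap)
  qed
  show ?thesis
  proof (cases "a < b")
    case True
    then show ?thesis using assms(2) by (rule *)
  next
    case False
    then have "b < a" using assms(3) by simp
    then show ?thesis unfolding transpose_commute[of a b] using assms(1) by (rule *)
  qed
qed

text \<open>Inserting the sites in increasing order produces no signs.\<close>

lemma wedge_decreasing:
  assumes "sorted_wrt (>) l" "\<And>x. x \<in> set l \<Longrightarrow> x > - int n" "occupied S = set l \<union> {..- int n}"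
  shows "wedge n l = Poly_Mapping.single S 1"
  using assms
proof (induction l arbitrary: S)
  case Nil
  then have "S = shifted_vacuum_maya n" by (intro maya_eqI) simp
  then show ?case by (simp add: wedge_Nil)
next
  case (Cons x l)
  let ?T = "maya_remove x S"
  have x: "x \<notin> set l" "x > - int n" using Cons.prems by auto
  have occ: "occupied ?T = set l \<union> {..- int n}" using Cons.prems(3) x by auto
  have "wedge n l = Poly_Mapping.single ?T 1"
    by (rule Cons.IH) (use Cons.prems occ in auto)
  moreover have "psi x (Poly_Mapping.single ?T 1) = Poly_Mapping.single S 1"
  proof -
    have "{i \<in> occupied ?T. i > x} = {}" using Cons.prems occ by auto
    then have "maya_sign x ?T = 1" by (simp only: maya_sign_def card.empty power_0)
    moreover have "{R \<in> Poly_Mapping.keys (Poly_Mapping.single ?T (1::complex)). x \<notin> occupied R} = {?T}" by auto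
    moreover have "maya_insert x ?T = S" by (rule maya_insert_remove) (use Cons.prems in auto)
    ultimately show ?thesis by (simp add: psi_def)
  qed
  ultimately show ?case by (simp add: wedge_Cons)
qed

lemma wedge_permutation:
  assumes "p permutes {0..<n}"
  shows "Poly_Mapping.lookup (wedge n (map (\<lambda>q. - int (p q)) [0..<n])) (shifted_vacuum_maya 0) = of_int (sign p)"
proof -
  have "finite {0..<n}" by simp
  then show ?thesis using assms
  proof (induction rule: permutes_rev_induct)
    case id
    have "wedge n (map (\<lambda>q. - int (id q)) [0..<n]) = Poly_Mapping.single (shifted_vacuum_maya 0) 1"
    proof (rule wedge_decreasing)
      show "occupied (shifted_vacuum_maya 0) = set (map (\<lambda>q. - int (id q)) [0..<n]) \<union> {..- int n}"
      proof (intro equalityI subsetI)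
        fix x assume "x \<in> occupied (shifted_vacuum_maya 0)"
        then show "x \<in> set (map (\<lambda>q. - int (id q)) [0..<n]) \<union> {..- int n}"
          by (cases "x \<le> - int n") (auto intro!: rev_image_eqI[of "nat (- x)"])
      qed auto
      show "sorted_wrt (>) (map (\<lambda>q. - int (id q)) [0..<n])"
        by (simp add: sorted_wrt_iff_nth_less)
    qed auto
    then show ?case by simp
  next
    case (swap a b p)
    have "wedge n (map (\<lambda>q. - int ((p \<circ> Transposition.transpose a b) q)) [0..<n]) = - wedge n (map (\<lambda>q. - int (p q)) [0..<n])"
      using wedge_transpose[of a n b n "\<lambda>q. - int (p q)"] swap by (simp add: o_def)
    then have "Poly_Mapping.lookup (wedge n (map (\<lambda>q. - int ((p \<circ> Transposition.transpose a b) q)) [0..<n]))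
        (shifted_vacuum_maya 0) = of_int (- sign p)"
      using swap by simp
    moreover have "sign (p \<circ> Transposition.transpose a b) = - sign p"
      using swap permutes_imp_permutation[of "{0..<n}" p]
      by (simp only: sign_compose permutation_swap_id sign_swap_id finite_atLeastLessThan if_False)
    ultimately show ?case by (simp only:)
  qed
qed

section \<open>The determinant formula for double factorial Schur functions\<close>

text \<open>
  \<open>exp(H)\<close> is determined by the Euler equation \<open>\<Sum> t\<^sub>k \<partial>\<^sub>k exp(H) = H exp(H)\<close>, which unlike the separate equations for
  the \<open>\<partial>\<^sub>k\<close> does not presuppose that the currents commute.
\<close>

lemma exp_H_plus_euler:
  fixes \<alpha> \<beta> :: "int \<Rightarrow> complex" and v :: fock
  defines "F \<equiv> exp_H_plus \<alpha> \<beta> (\<lambda>M. if M = {#} then v else 0)"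
  shows "of_nat (size M) *\<^sub>F F M = (\<Sum>k\<in>set_mset M. (1 / of_nat k) *\<^sub>F current \<alpha> \<beta> k (F (M - {#k#})))"
proof (cases "size M")
  case 0
  then show ?thesis by (simp add: nonempty_has_size)
next
  case (Suc s)
  let ?I = "\<lambda>M. if M = {#} then v else (0 :: fock)"
  have F: "F N = (1 / fact (size N)) *\<^sub>F (H_plus \<alpha> \<beta> ^^ size N) ?I N" for N
    unfolding F_def by (rule exp_H_plus_homogeneous)
  have power: "(H_plus \<alpha> \<beta> ^^ s) ?I (M - {#k#}) = fact s *\<^sub>F F (M - {#k#})" if "k \<in># M" for k
  proof -
    have "size (M - {#k#}) = s" using that Suc by (simp add: size_Diff_singleton)
    then show ?thesis unfolding F by (intro poly_mapping_eqI) simp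
  qed
  have "of_nat (size M) *\<^sub>F F M = (1 / fact s) *\<^sub>F (H_plus \<alpha> \<beta> ^^ Suc s) ?I M"
  proof -
    have "of_nat (Suc s) * (1 / fact (Suc s)) = (1 / fact s :: complex)"
      using of_nat_neq_0[of s] by (simp only: fact_Suc of_nat_mult) (simp add: divide_simps del: of_nat_Suc)
    then show ?thesis unfolding F Suc by (intro poly_mapping_eqI) (simp only: lookup_scale mult.assoc[symmetric])
  qed
  also have "\<dots> = (1 / fact s) *\<^sub>F (\<Sum>k | k \<in># M \<and> k \<ge> 1. (1 / of_nat k) *\<^sub>F current \<alpha> \<beta> k (fact s *\<^sub>F F (M - {#k#})))"
    by (simp add: H_plus_def[of \<alpha> \<beta> "(H_plus \<alpha> \<beta> ^^ s) ?I"] power)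
  also have "\<dots> = (\<Sum>k | k \<in># M \<and> k \<ge> 1. (1 / of_nat k) *\<^sub>F current \<alpha> \<beta> k (F (M - {#k#})))"
    by (rule poly_mapping_eqI) (simp add: current_scale lookup_sum sum_distrib_left)
  also have "\<dots> = (\<Sum>k\<in>set_mset M. (1 / of_nat k) *\<^sub>F current \<alpha> \<beta> k (F (M - {#k#})))"
    by (rule sum.mono_neutral_left) (auto simp: Suc_le_eq intro!: gr0I)
  finally show ?thesis .
qed

lemma mfps_coeff_euler: "of_nat (size M) * mfps_coeff f M = (\<Sum>k\<in>set_mset M. mfps_coeff (mfps_deriv k f) (M - {#k#}))"
proof -
  have "of_nat (size M) * mfps_coeff f M = (\<Sum>k\<in>set_mset M. of_nat (count M k) * mfps_coeff f M)"
    by (simp add: size_multiset_overloaded_eq sum_distrib_right)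
  also have "\<dots> = (\<Sum>k\<in>set_mset M. mfps_coeff (mfps_deriv k f) (M - {#k#}))"
  proof (rule sum.cong[OF refl])
    fix k assume k: "k \<in># M"
    then have "count (M - {#k#}) k + 1 = count M k" by simp
    then show "of_nat (count M k) * mfps_coeff f M = mfps_coeff (mfps_deriv k f) (M - {#k#})"
      unfolding mfps_coeff_deriv using k by (simp only: insert_DiffM)
  qed
  finally show ?thesis .
qed

lemma mfps_deriv_prod:
  "finite A \<Longrightarrow> mfps_deriv k (\<Prod>x\<in>A. f x) = (\<Sum>x\<in>A. mfps_deriv k (f x) * (\<Prod>y\<in>A - {x}. f y))"
proof (induction A rule: finite_induct)
  case (insert a A)
  have "(\<Prod>y\<in>insert a A - {x}. f y) = f a * (\<Prod>y\<in>A - {x}. f y)" if "x \<in> A" for x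
  proof -
    have "insert a A - {x} = insert a (A - {x})" using that insert by auto
    then show ?thesis using insert by simp
  qed
  moreover have "insert a A - {a} = A" using insert by auto
  ultimately show ?case
    using insert by (simp add: mfps_deriv_mult sum_distrib_left mult_ac)
qed simp

context current_window
begin

definition index_lists :: "nat \<Rightarrow> int list set" where
  "index_lists n = {l. set l \<subseteq> {c..d} \<and> length l = n}"

lemma finite_index_lists: "finite (index_lists n)"
  unfolding index_lists_def by (intro finite_lists_length_eq) simp

text \<open>The factor that normal ordering contributes for the \<open>n\<close> highest sites of the vacuum.\<close>

definition vacuum_factor :: "nat \<Rightarrow> nat mfps" where
  "vacuum_factor n = (\<Prod>a<n. h_series_inv (\<lambda>m. \<beta> (- int a) ^ m))"

definition wedge_coeff :: "nat \<Rightarrow> int list \<Rightarrow> int list \<Rightarrow> nat mfps" where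
  "wedge_coeff n C l = vacuum_factor n * (\<Prod>q<n. E (l ! q) (C ! q))"

lemma deriv_vacuum_factor:
  "mfps_deriv k (vacuum_factor n) = - (mfps_const (1 / of_nat k) * (mfps_const (\<Sum>a<n. \<beta> (- int a) ^ k) * vacuum_factor n))"
proof -
  let ?h = "\<lambda>a. h_series_inv (\<lambda>m. \<beta> (- int a) ^ m)"
  have d: "mfps_deriv k (?h a) = - (mfps_const (1 / of_nat k) * (mfps_const (\<beta> (- int a) ^ k) * ?h a))" for a
    using h_series_inv_sum[of "\<lambda>_. \<beta> (- int a) ^ k" "\<lambda>_ m. \<beta> (- int a) ^ m" "{()}"]
    by (simp add: mfps_deriv_h_series_inv power_add mult.commute)
  have const_sum: "mfps_const (\<Sum>a<n. f a) = (\<Sum>a<n. mfps_const (f a) :: nat mfps)" for f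
    by (rule mfps_eqI) (simp add: mfps_coeff_const mfps_coeff_sum)
  have "mfps_deriv k (vacuum_factor n) =
      (\<Sum>a<n. - (mfps_const (1 / of_nat k) * (mfps_const (\<beta> (- int a) ^ k) * (?h a * (\<Prod>b\<in>{..<n} - {a}. ?h b)))))"
    unfolding vacuum_factor_def by (subst mfps_deriv_prod) (simp_all add: d mult.assoc)
  also have "\<dots> = (\<Sum>a<n. - (mfps_const (1 / of_nat k) * (mfps_const (\<beta> (- int a) ^ k) * vacuum_factor n)))"
    unfolding vacuum_factor_def by (intro sum.cong refl) (simp add: prod.remove)
  finally show ?thesis by (simp add: const_sum sum_negf sum_distrib_left sum_distrib_right)
qed

lemma deriv_wedge_coeff:
  assumes l: "l \<in> index_lists n" and C: "C \<in> index_lists n"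
  shows "mfps_deriv k (wedge_coeff n C l) = mfps_const (1 / of_nat k) *
    ((\<Sum>q<n. \<Sum>r=c..d. mfps_const (A k (l ! q) r) * wedge_coeff n C (l[q := r])) -
     mfps_const (\<Sum>a<n. \<beta> (- int a) ^ k) * wedge_coeff n C l)"
proof -
  let ?r = "mfps_const (1 / of_nat k) :: nat mfps"
  let ?P = "\<lambda>l. \<Prod>q<n. E (l ! q) (C ! q)"
  have nth: "l ! q \<in> {c..d}" "C ! q \<in> {c..d}" if "q < n" for q
    using l C that by (auto simp: index_lists_def subset_iff)
  have upd: "wedge_coeff n C (l[q := r]) = vacuum_factor n * (E r (C ! q) * (\<Prod>p\<in>{..<n} - {q}. E (l ! p) (C ! p)))"
    if "q < n" for q r
  proof -
    have "?P (l[q := r]) = E (l[q := r] ! q) (C ! q) * (\<Prod>p\<in>{..<n} - {q}. E (l[q := r] ! p) (C ! p))"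
      using that by (intro prod.remove) auto
    also have "(\<Prod>p\<in>{..<n} - {q}. E (l[q := r] ! p) (C ! p)) = (\<Prod>p\<in>{..<n} - {q}. E (l ! p) (C ! p))"
      by (rule prod.cong) auto
    also have "l[q := r] ! q = r" using l that by (simp add: index_lists_def)
    finally show ?thesis by (simp add: wedge_coeff_def)
  qed
  have "vacuum_factor n * mfps_deriv k (?P l) =
      (\<Sum>q<n. vacuum_factor n * (mfps_deriv k (E (l ! q) (C ! q)) * (\<Prod>p\<in>{..<n} - {q}. E (l ! p) (C ! p))))"
    by (subst mfps_deriv_prod) (simp_all add: sum_distrib_left)
  also have "\<dots> = (\<Sum>q<n. ?r * (\<Sum>r=c..d. mfps_const (A k (l ! q) r) * wedge_coeff n C (l[q := r])))"
  proof (rule sum.cong[OF refl])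
    fix q assume "q \<in> {..<n}"
    then have q: "q < n" by simp
    have "mfps_deriv k (E (l ! q) (C ! q)) = ?r * (\<Sum>r=c..d. mfps_const (A k (l ! q) r) * E r (C ! q))"
      by (rule deriv_E) (use nth[OF q] in auto)
    then show "vacuum_factor n * (mfps_deriv k (E (l ! q) (C ! q)) * (\<Prod>p\<in>{..<n} - {q}. E (l ! p) (C ! p))) =
        ?r * (\<Sum>r=c..d. mfps_const (A k (l ! q) r) * wedge_coeff n C (l[q := r]))"
      unfolding upd[OF q] by (simp add: sum_distrib_left sum_distrib_right mult_ac)
  qed
  finally have P: "vacuum_factor n * mfps_deriv k (?P l) =
      ?r * (\<Sum>q<n. \<Sum>r=c..d. mfps_const (A k (l ! q) r) * wedge_coeff n C (l[q := r]))"
    by (simp only: sum_distrib_left)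
  have "mfps_deriv k (wedge_coeff n C l) = vacuum_factor n * mfps_deriv k (?P l) + mfps_deriv k (vacuum_factor n) * ?P l"
    by (simp add: wedge_coeff_def mfps_deriv_mult add.commute)
  then show ?thesis unfolding P deriv_vacuum_factor wedge_coeff_def by (simp add: right_diff_distrib mult.assoc)
qed

text \<open>Exchanging an index with the entry at position \<open>q\<close> is an involution on pairs of a list and an index.\<close>

lemma sum_replace_entry:
  fixes f :: "int \<Rightarrow> int \<Rightarrow> complex"
  assumes "q < n"
  shows "(\<Sum>l\<in>index_lists n. \<Sum>r=c..d. f (l ! q) r * (x (l[q := r]) * W l)) =
    (\<Sum>l\<in>index_lists n. \<Sum>i=c..d. x l * (f i (l ! q) * W (l[q := i])))"
  unfolding sum.Sigma[OF finite_index_lists ballI[OF finite_atLeastAtMost_int]]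
  by (rule sum.reindex_bij_witness[where i = "\<lambda>(l, r). (l[q := r], l ! q)" and j = "\<lambda>(l, r). (l[q := r], l ! q)"])
     (use assms in \<open>auto simp: index_lists_def dest!: set_update_subset_insert[THEN subsetD]\<close>)

text \<open>The Wick expansion of \<open>exp(H)\<close> applied to a vector \<open>v\<^bsub>C1\<^esub> \<and> \<dots> \<and> v\<^bsub>Cn\<^esub> \<and> |-n\<rangle>\<close>: both sides solve the Euler equation.\<close>

lemma exp_H_plus_wedge:
  assumes C: "C \<in> index_lists n" and n: "c = 1 - int n"
  shows "exp_H_plus \<alpha> \<beta> (\<lambda>M. if M = {#} then wedge n C else 0) M =
    (\<Sum>l\<in>index_lists n. mfps_coeff (wedge_coeff n C l) M *\<^sub>F wedge n l)"
proof (induction "size M" arbitrary: M)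
  let ?F = "exp_H_plus \<alpha> \<beta> (\<lambda>M. if M = {#} then wedge n C else 0)"
  case 0
  then have M: "M = {#}" by simp
  have const: "mfps_coeff (f * g) {#} = mfps_coeff f {#} * mfps_coeff g {#}" for f g :: "nat mfps"
    by (simp add: mfps_coeff_mult)
  have prod: "mfps_coeff (prod f S) {#} = (\<Prod>x\<in>S. mfps_coeff (f x) {#})" if "finite S" for f :: "nat \<Rightarrow> nat mfps" and S
    using that by (induction S rule: finite_induct) (simp_all add: const mfps_coeff_one)
  have "mfps_coeff (wedge_coeff n C l) {#} = (if l = C then 1 else 0)" if "l \<in> index_lists n" for l
  proof -
    have "mfps_coeff (wedge_coeff n C l) {#} = (\<Prod>q<n. if l ! q = C ! q then 1 else 0)"
      by (simp add: wedge_coeff_def vacuum_factor_def const prod h_series_def h_series_inv_def h_coeff_empty cur_0)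
    also have "\<dots> = (if l = C then 1 else 0)"
    proof (cases "l = C")
      case False
      with that C obtain q where q: "q < n" "l ! q \<noteq> C ! q"
        unfolding index_lists_def by (metis (mono_tags, lifting) mem_Collect_eq nth_equalityI)
      then have "(\<Prod>q<n. if l ! q = C ! q then 1 else 0 :: complex) = 0"
        by (intro prod_zero) auto
      then show ?thesis using False by simp
    qed simp
    finally show ?thesis .
  qed
  then have "(\<Sum>l\<in>index_lists n. mfps_coeff (wedge_coeff n C l) M *\<^sub>F wedge n l) =
      (\<Sum>l\<in>index_lists n. if l = C then wedge n C else 0)"
    unfolding M by (intro sum.cong) (auto intro!: poly_mapping_eqI)
  also have "\<dots> = wedge n C" using C by (simp add: finite_index_lists)
  finally have "(\<Sum>l\<in>index_lists n. mfps_coeff (wedge_coeff n C l) M *\<^sub>F wedge n l) = wedge n C" .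
  moreover have "exp_H_plus \<alpha> \<beta> (\<lambda>M. if M = {#} then wedge n C else 0) M = wedge n C"
    unfolding exp_H_plus_homogeneous M by (rule poly_mapping_eqI) simp
  ultimately show ?case by simp
next
  let ?F = "exp_H_plus \<alpha> \<beta> (\<lambda>M. if M = {#} then wedge n C else 0)"
  case (Suc s)
  let ?g = "wedge_coeff n C" and ?b = "\<lambda>k. \<Sum>a<n. \<beta> (- int a) ^ k"
  let ?lk = "\<lambda>v S. Poly_Mapping.lookup v S"
  have step: "(1 / of_nat k) * ?lk (current \<alpha> \<beta> k (?F (M - {#k#}))) S =
      (\<Sum>l\<in>index_lists n. mfps_coeff (mfps_deriv k (?g l)) (M - {#k#}) * ?lk (wedge n l) S)"
    if k: "k \<in># M" for k S
  proof -
    let ?x = "\<lambda>l. mfps_coeff (?g l) (M - {#k#})" and ?W = "\<lambda>l. ?lk (wedge n l) S"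
    have "s = size (M - {#k#})" using k Suc.hyps(2) by (simp add: size_Diff_singleton)
    from Suc.hyps(1)[OF this]
    have "current \<alpha> \<beta> k (?F (M - {#k#})) = (\<Sum>l\<in>index_lists n. ?x l *\<^sub>F current \<alpha> \<beta> k (wedge n l))"
      by (simp only: current_sum current_scale)
    then have "?lk (current \<alpha> \<beta> k (?F (M - {#k#}))) S = (\<Sum>l\<in>index_lists n. ?x l * ?lk (current \<alpha> \<beta> k (wedge n l)) S)"
      by (simp add: lookup_sum)
    also have "\<dots> = (\<Sum>l\<in>index_lists n. ?x l * ((\<Sum>q<n. \<Sum>i=c..d. A k i (l ! q) * ?W (l[q := i])) - ?b k * ?W l))"
    proof (rule sum.cong[OF refl])
      fix l assume l: "l \<in> index_lists n"
      then have "set l \<subseteq> {..d}" "length l = n" by (auto simp: index_lists_def)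
      then have "?lk (current \<alpha> \<beta> k (wedge n l)) S = (\<Sum>q<n. \<Sum>i=c..d. A k i (l ! q) * ?W (l[q := i])) - ?b k * ?W l"
        unfolding n by (subst current_wedge[of l d]) (simp_all only: lookup_add lookup_sum lookup_scale mult_minus_left diff_conv_add_uminus)
      then show "?x l * ?lk (current \<alpha> \<beta> k (wedge n l)) S =
          ?x l * ((\<Sum>q<n. \<Sum>i=c..d. A k i (l ! q) * ?W (l[q := i])) - ?b k * ?W l)" by simp
    qed
    also have "\<dots> = (\<Sum>q<n. \<Sum>l\<in>index_lists n. \<Sum>i=c..d. ?x l * (A k i (l ! q) * ?W (l[q := i]))) -
        (\<Sum>l\<in>index_lists n. ?x l * (?b k * ?W l))"
      unfolding right_diff_distrib sum_subtractf sum_distrib_left by (subst sum.swap) (rule refl)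
    also have "(\<Sum>q<n. \<Sum>l\<in>index_lists n. \<Sum>i=c..d. ?x l * (A k i (l ! q) * ?W (l[q := i]))) =
        (\<Sum>q<n. \<Sum>l\<in>index_lists n. \<Sum>r=c..d. A k (l ! q) r * (?x (l[q := r]) * ?W l))"
      by (intro sum.cong[OF refl] sum_replace_entry[symmetric]) simp
    also have "\<dots> = (\<Sum>l\<in>index_lists n. (\<Sum>q<n. \<Sum>r=c..d. A k (l ! q) r * ?x (l[q := r])) * ?W l)"
      unfolding sum_distrib_right by (subst sum.swap) (simp only: mult.assoc)
    finally have "?lk (current \<alpha> \<beta> k (?F (M - {#k#}))) S =
        (\<Sum>l\<in>index_lists n. ((\<Sum>q<n. \<Sum>r=c..d. A k (l ! q) r * ?x (l[q := r])) - ?b k * ?x l) * ?W l)"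
      by (simp only: left_diff_distrib right_diff_distrib sum_subtractf mult_ac)
    then have "(1 / of_nat k) * ?lk (current \<alpha> \<beta> k (?F (M - {#k#}))) S =
        (\<Sum>l\<in>index_lists n. (1 / of_nat k * ((\<Sum>q<n. \<Sum>r=c..d. A k (l ! q) r * ?x (l[q := r])) - ?b k * ?x l)) * ?W l)"
      by (simp only: sum_distrib_left mult.assoc)
    also have "\<dots> = (\<Sum>l\<in>index_lists n. mfps_coeff (mfps_deriv k (?g l)) (M - {#k#}) * ?W l)"
      by (intro sum.cong refl arg_cong2[of _ _ _ _ "(*)"])
         (simp only: deriv_wedge_coeff[OF _ C] mfps_coeff_const_mult mfps_coeff_diff mfps_coeff_sum)
    finally show ?thesis .
  qed
  show ?case
  proof (rule poly_mapping_eqI)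
    fix S
    let ?R = "\<Sum>l\<in>index_lists n. mfps_coeff (?g l) M *\<^sub>F wedge n l"
    have "of_nat (size M) * ?lk (?F M) S = ?lk (of_nat (size M) *\<^sub>F ?F M) S" by (simp only: lookup_scale)
    also have "\<dots> = (\<Sum>k\<in>set_mset M. (1 / of_nat k) * ?lk (current \<alpha> \<beta> k (?F (M - {#k#}))) S)"
      unfolding exp_H_plus_euler by (simp only: lookup_sum lookup_scale)
    also have "\<dots> = (\<Sum>k\<in>set_mset M. \<Sum>l\<in>index_lists n. mfps_coeff (mfps_deriv k (?g l)) (M - {#k#}) * ?lk (wedge n l) S)"
      by (intro sum.cong[OF refl] step)
    also have "\<dots> = (\<Sum>l\<in>index_lists n. of_nat (size M) * mfps_coeff (?g l) M * ?lk (wedge n l) S)"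
      unfolding mfps_coeff_euler sum_distrib_right by (rule sum.swap)
    also have "\<dots> = of_nat (size M) * ?lk ?R S"
      by (simp only: lookup_sum lookup_scale sum_distrib_left mult.assoc)
    finally have "of_nat (size M) * ?lk (?F M) S = of_nat (size M) * ?lk ?R S" .
    moreover have "of_nat (size M) \<noteq> (0 :: complex)"
      unfolding Suc.hyps(2)[symmetric] by (rule of_nat_neq_0)
    ultimately show "?lk (?F M) S = ?lk ?R S"
      using mult_left_cancel by blast
  qed
qed

text \<open>Only permutations of the rows \<open>0, -1, \<dots>, 1 - n\<close> contribute to the vacuum component.\<close>

lemma vacuum_component:
  assumes C: "C \<in> index_lists n" and n: "c = 1 - int n"
  shows "(\<Sum>l\<in>index_lists n. mfps_const (Poly_Mapping.lookup (wedge n l) (shifted_vacuum_maya 0)) * wedge_coeff n C l) =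
    det (fun_mat n (\<lambda>a b. K (- int a) (C ! b)))"
proof -
  let ?e = "\<lambda>l. Poly_Mapping.lookup (wedge n l) (shifted_vacuum_maya 0)"
  let ?l = "\<lambda>p. map (\<lambda>q. - int (p q)) [0..<n]"
  let ?P = "{p. p permutes {0..<n}}"
  have sub: "?l ` ?P \<subseteq> index_lists n"
  proof
    fix l assume "l \<in> ?l ` ?P"
    then obtain p where p: "p permutes {0..<n}" "l = ?l p" by blast
    have "- int (p q) \<in> {c..d}" if "q < n" for q
      using permutes_in_image[OF p(1), of q] that window n by simp
    then show "l \<in> index_lists n" using p(2) by (auto simp: index_lists_def simp del: atLeastAtMost_iff)
  qed
  have zero: "?e l = 0" if l: "l \<in> index_lists n - ?l ` ?P" for l
  proof (rule ccontr)
    assume "?e l \<noteq> 0"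
    then have "shifted_vacuum_maya 0 \<in> Poly_Mapping.keys (wedge n l)" by (simp add: in_keys_iff)
    from keys_wedge[OF this] have occ: "{..0} = set l \<union> {..- int n}" by simp
    have len: "length l = n" and ge: "set l \<subseteq> {c..d}" using l by (auto simp: index_lists_def)
    have "set l = {1 - int n..0}"
    proof (intro equalityI subsetI)
      fix x assume "x \<in> set l"
      moreover have "x \<in> {..0}" unfolding occ using \<open>x \<in> set l\<close> by blast
      ultimately show "x \<in> {1 - int n..0}" using ge n by auto
    next
      fix x assume x: "x \<in> {1 - int n..0}"
      then have "x \<in> {..0}" by simp
      then have "x \<in> set l \<union> {..- int n}" unfolding occ .
      with x show "x \<in> set l" by auto
    qed
    moreover from this have dist: "distinct l"
      using len by (intro card_distinct) simp
    define p where "p q = (if q < n then nat (- (l ! q)) else q)" for q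
    have img: "l ! q \<in> {1 - int n..0}" if "q < n" for q
      using that len calculation by (metis nth_mem)
    have "p permutes {0..<n}"
    proof (rule bij_imp_permutes)
      have "inj_on p {0..<n}"
      proof (rule inj_onI)
        fix x y assume xy: "x \<in> {0..<n}" "y \<in> {0..<n}" "p x = p y"
        then have "nat (- (l ! x)) = nat (- (l ! y))" by (simp add: p_def)
        then have "l ! x = l ! y" using img[of x] img[of y] xy by auto
        then show "x = y" using dist len xy by (simp add: nth_eq_iff_index_eq)
      qed
      moreover have "p ` {0..<n} \<subseteq> {0..<n}"
      proof
        fix y assume "y \<in> p ` {0..<n}"
        then obtain q where "q < n" "y = nat (- (l ! q))" by (auto simp: p_def)
        then show "y \<in> {0..<n}" using img[of q] by auto
      qed
      ultimately show "bij_betw p {0..<n} {0..<n}"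
        by (simp add: bij_betw_def endo_inj_surj)
    qed (simp add: p_def)
    moreover have "l = ?l p"
      by (rule nth_equalityI) (use img len in \<open>auto simp: p_def\<close>)
    ultimately show False using l by blast
  qed
  have inj: "inj_on ?l ?P"
  proof (rule inj_onI)
    fix p p' assume p: "p \<in> ?P" "p' \<in> ?P" and eq: "?l p = ?l p'"
    show "p = p'"
    proof
      fix q
      show "p q = p' q"
      proof (cases "q < n")
        case True
        have "?l p ! q = ?l p' ! q" by (simp only: eq)
        then show ?thesis using True by simp
      next
        case False
        then show ?thesis using p permutes_not_in[of p "{0..<n}" q] permutes_not_in[of p' "{0..<n}" q] by simp
      qed
    qed
  qed
  have "(\<Sum>l\<in>index_lists n. mfps_const (?e l) * wedge_coeff n C l) = (\<Sum>l\<in>?l ` ?P. mfps_const (?e l) * wedge_coeff n C l)"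
    by (rule sum.mono_neutral_right[OF finite_index_lists sub]) (use zero in simp)
  also have "\<dots> = (\<Sum>p\<in>?P. mfps_const (?e (?l p)) * wedge_coeff n C (?l p))"
    by (simp add: sum.reindex[OF inj])
  also have "\<dots> = (\<Sum>p\<in>?P. vacuum_factor n * (of_int (sign p) * (\<Prod>q<n. E (- int (p q)) (C ! q))))"
  proof (rule sum.cong[OF refl])
    fix p assume "p \<in> ?P"
    then have e: "?e (?l p) = of_int (sign p)" by (intro wedge_permutation) simp
    have "mfps_const (of_int (sign p)) = (of_int (sign p) :: nat mfps)"
      by (simp add: sign_def mfps_const_uminus)
    moreover have "(\<Prod>q<n. E (?l p ! q) (C ! q)) = (\<Prod>q<n. E (- int (p q)) (C ! q))"
      by (rule prod.cong) auto
    ultimately show "mfps_const (?e (?l p)) * wedge_coeff n C (?l p) =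
        vacuum_factor n * (of_int (sign p) * (\<Prod>q<n. E (- int (p q)) (C ! q)))"
      unfolding e wedge_coeff_def by (simp only: mult.left_commute)
  qed
  also have "\<dots> = vacuum_factor n * det (fun_mat n (\<lambda>a b. E (- int a) (C ! b)))"
  proof -
    have "det (fun_mat n (\<lambda>a b. E (- int a) (C ! b))) = (\<Sum>p\<in>?P. of_int (sign p) * (\<Prod>q<n. E (- int (p q)) (C ! q)))"
      by (subst det_col[of _ n]) (auto intro!: sum.cong prod.cong arg_cong2[of _ _ _ _ "(*)"] dest: permutes_in_image)
    then show ?thesis by (simp add: sum_distrib_left)
  qed
  also have "\<dots> = det (fun_mat n (\<lambda>a b. K (- int a) (C ! b)))"
    unfolding vacuum_factor_def using det_K[of n "\<lambda>b. C ! b"] n by simp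
  finally show ?thesis .
qed

end

theorem corollary5p34:
  fixes \<alpha> \<beta> :: "int \<Rightarrow> complex" and \<mu> :: "nat \<Rightarrow> nat"
  assumes "is_partition \<mu>"
  shows "KP_tau_function (double_schur \<alpha> \<beta> \<mu>)"
proof -
  have mono: "antimono \<mu>" and "finite {i. \<mu> i \<noteq> 0}"
    using assms by (auto simp: is_partition_def)
  then obtain m where m: "\<forall>i\<in>{i. \<mu> i \<noteq> 0}. i < m"
    using finite_nat_set_iff_bounded by blast
  \<comment> \<open>All parts from the \<open>n\<close>-th on vanish.  The successor makes \<open>n\<close> positive, so that the window
    \<open>1 - n..\<mu> 0\<close> contains 0 even for the empty partition.\<close>
  define n where "n = Suc m"
  have large: "\<mu> i = 0" if "i \<ge> n" for i
    using m that by (force simp: n_def)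
  define C where "C = map (\<lambda>i. int (\<mu> i) - int i) [0..<n]"
  interpret current_window \<alpha> \<beta> "1 - int n" "int (\<mu> 0)"
    by unfold_locales (simp_all add: n_def)
  have \<mu>_le: "\<mu> i \<le> \<mu> j" if "j \<le> i" for i j
    using mono that by (rule antimonoD)
  have nth: "C ! b = int (\<mu> b) - int b" if "b < n" for b
    using that by (simp add: C_def)
  have "int (\<mu> q) - int q \<in> {1 - int n..int (\<mu> 0)}" if "q < n" for q
    using \<mu>_le[of 0 q] that by simp
  then have C: "C \<in> index_lists n"
    by (auto simp: index_lists_def C_def simp del: atLeastAtMost_iff)
  have ket: "wedge n C = ket \<mu>"
    unfolding ket_def
  proof (rule wedge_decreasing)
    show "sorted_wrt (>) C"
      unfolding sorted_wrt_iff_nth_less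
    proof (intro allI impI)
      fix i j assume "i < j" "j < length C"
      then show "C ! i > C ! j" using \<mu>_le[of i j] nth[of i] nth[of j] by (simp add: C_def)
    qed
    show "x > - int n" if "x \<in> set C" for x
      using that by (auto simp: C_def)
    show "occupied (partition_maya \<mu>) = set C \<union> {..- int n}"
      unfolding occupied_partition_maya[OF assms]
    proof (intro equalityI subsetI)
      fix x assume "x \<in> range (\<lambda>i. int (\<mu> i) - int i)"
      then obtain i where i: "x = int (\<mu> i) - int i" by blast
      show "x \<in> set C \<union> {..- int n}"
      proof (cases "i < n")
        case False
        then show ?thesis using i large[of i] by simp
      qed (use i in \<open>simp add: C_def\<close>)
    next
      fix x assume "x \<in> set C \<union> {..- int n}"
      then show "x \<in> range (\<lambda>i. int (\<mu> i) - int i)"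
      proof
        assume "x \<in> {..- int n}"
        then show ?thesis using large[of "nat (- x)"] by (intro range_eqI[of _ _ "nat (- x)"]) auto
      qed (auto simp: C_def)
    qed
  qed
  have vac: "partition_maya (\<lambda>_. 0) = shifted_vacuum_maya 0"
  proof (rule maya_eqI)
    have "is_partition (\<lambda>_. 0)" by (simp add: is_partition_def antimono_def)
    then have "occupied (partition_maya (\<lambda>_. 0)) = range (\<lambda>i. - int i)" by (simp add: occupied_partition_maya)
    also have "\<dots> = {..0}"
    proof (intro equalityI subsetI)
      fix x :: int assume "x \<in> {..0}"
      then show "x \<in> range (\<lambda>i. - int i)" by (intro range_eqI[of _ _ "nat (- x)"]) auto
    qed auto
    finally show "occupied (partition_maya (\<lambda>_. 0)) = occupied (shifted_vacuum_maya 0)" by simp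
  qed
  have exp_H: "exp_H_plus \<alpha> \<beta> (\<lambda>M. if M = {#} then ket \<mu> else 0) M =
      (\<Sum>l\<in>index_lists n. mfps_coeff (wedge_coeff n C l) M *\<^sub>F wedge n l)" for M
    unfolding ket[symmetric] by (rule exp_H_plus_wedge[OF C refl])
  have "double_schur \<alpha> \<beta> \<mu> =
      (\<Sum>l\<in>index_lists n. mfps_const (Poly_Mapping.lookup (wedge n l) (shifted_vacuum_maya 0)) * wedge_coeff n C l)"
    by (rule mfps_eqI)
       (simp add: double_schur_def bra_def vac exp_H lookup_sum mfps_coeff_sum mult.commute[of "mfps_coeff _ _"])
  also have "\<dots> = det (fun_mat n (\<lambda>a b. K (- int a) (C ! b)))"
    by (rule vacuum_component[OF C refl])
  finally show ?thesis
    using KP_tau_function_minor[of n "\<lambda>b. C ! b"] C by (auto simp: index_lists_def subset_iff)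
qed

end
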